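(* Let $\mathbb{P}$ be the set of prime numbers, let $\mathcal{P}\subset\mathbb{P}$, let $\mathcal{Q}:=\mathbb{P}\smallsetminus\mathcal{P}$, and let $b\geq 2$ be an integer. For $n\geq 1$ let $a_n\in\{0,1,\dots,b-1\}$ be the residue of $\Omega_{\mathcal{P}}(n)$ modulo $b$, where $\Omega_{\mathcal{P}}(n)$ is the sum of the exponents, in the canonical factorization of $n$, of those prime factors that do not belong to $\mathcal{P}$, and let $$\xi_{\mathcal{P}}=\sum_{n\geq 1}\frac{a_n}{b^n}.$$ Then the number $\xi_{\mathcal{P}}$ is simply normal to the base $b$ if, and only if, $$\sum_{p\in\mathcal{Q}}\frac1p=\infty.$$ Moreover, defining, for integers $0\leq k<b$ and $N\geq 1$, $$\varepsilon_{N,k}:=\left|\frac1N\,\big|\{1\leq n\leq N: a_n=k\}\big|-\frac1b\right|,\qquad E(N):=\sum_{p\leq N,\ p\in\mathcal{Q}}\frac1p,$$ we have $$\varepsilon_{N,k}\ll \exp\left(-\frac{2E(N)}{9b^2}\right),$$ that is, there is a constant $C>0$ such that $\varepsilon_{N,k}\leq C\exp\left(-2E(N)/(9b^2)\right)$ for all integers $N\geq 1$ and $0\leq k<b$.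
   Context: A real number is called simply normal to the integer base $b\geq 2$ if every possible digit in $\{0,1,\dots,b-1\}$ (representing $\mathbb{Z}/b\mathbb{Z}$) occurs in its base-$b$ expansion with the same asymptotic frequency $1/b$. The base-$b$ digits of $\xi_{\mathcal{P}}$ are the $a_n$, so that simple normality of $\xi_{\mathcal{P}}$ to the base $b$ means that $\frac1N|\{1\leq n\leq N:a_n=k\}|\to 1/b$ as $N\to\infty$ for every $0\leq k<b$. Equivalently to the description in the claim, $\Omega_{\mathcal{P}}$ is the completely additive arithmetical function (i.e. $\Omega_{\mathcal{P}}(mn)=\Omega_{\mathcal{P}}(m)+\Omega_{\mathcal{P}}(n)$ for all $m,n\geq1$) with $\Omega_{\mathcal{P}}(p)=1$ for primes $p\notin\mathcal{P}$ and $\Omega_{\mathcal{P}}(p)=0$ for primes $p\in\mathcal{P}$. The set $\mathcal{P}$ is an arbitrary set of primes (finite, infinite, empty, or all of $\mathbb{P}$). The set $\mathcal{P}$ and the base $b$ are fixed. *)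

theory Defs
  imports "HOL-Analysis.Analysis" "HOL-Computational_Algebra.Primes"
begin

text \<open>The \<open>n\<close>-th digit after the radix point (\<open>n \<ge> 1\<close>) of the canonical base-\<open>b\<close> expansion,
  i.e. the one which does not end in an infinite run of the digit \<open>b - 1\<close>. The integer part of \<open>x\<close>
  plays no role.\<close>

definition base_digit :: "nat \<Rightarrow> real \<Rightarrow> nat \<Rightarrow> nat" where
  "base_digit b x n = nat (\<lfloor>x * real b ^ n\<rfloor> mod int b)"

definition simply_normal :: "nat \<Rightarrow> real \<Rightarrow> bool" where
  "simply_normal b x \<longleftrightarrow>
     (\<forall>k<b. (\<lambda>N. real (card {n \<in> {1..N}. base_digit b x n = k}) / real N) \<longlonglongrightarrow> 1 / real b)"

definition Omega_outside :: "nat set \<Rightarrow> nat \<Rightarrow> nat" where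
  "Omega_outside P n = (\<Sum>p \<in> prime_factors n - P. multiplicity p n)"

definition Omega_residue :: "nat set \<Rightarrow> nat \<Rightarrow> nat \<Rightarrow> nat" where
  "Omega_residue P b n = Omega_outside P n mod b"

definition xi :: "nat set \<Rightarrow> nat \<Rightarrow> real" where
  "xi P b = (\<Sum>n. real (Omega_residue P b (Suc n)) / real b ^ Suc n)"

definition residue_discrepancy :: "nat set \<Rightarrow> nat \<Rightarrow> nat \<Rightarrow> nat \<Rightarrow> real" where
  "residue_discrepancy P b N k =
     \<bar>real (card {n \<in> {1..N}. Omega_residue P b n = k}) / real N - 1 / real b\<bar>"

definition primes_outside :: "nat set \<Rightarrow> nat set" where
  "primes_outside P = {p. prime p} - P"

definition recip_sum :: "nat set \<Rightarrow> nat \<Rightarrow> real" where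
  "recip_sum P N = (\<Sum>p \<in> {p \<in> primes_outside P. p \<le> N}. 1 / real p)"

end

theory Submission
  imports Defs "HOL-Probability.Sinc_Integral" "HOL-Number_Theory.Prime_Powers" "HOL-Real_Asymp.Real_Asymp"
begin

text \<open>Let \<open>\<zeta>\<close> be a \<open>b\<close>-th root of unity other than \<open>1\<close>, and
  let \<open>f(n) = \<zeta> ^ \<Omega>(n)\<close>, where \<open>\<Omega>\<close> counts the prime
  factors outside \<open>P\<close>. This is a completely multiplicative function with values in the roots of unity;
  it is \<open>1\<close> at the primes of \<open>P\<close>, and stays at distance at least \<open>4/b\<close> from \<open>1\<close> at the other primes.
  By finite Fourier inversion (\<open>count_residue\<close>) the frequencies of the digits are governed by the sums
  \<open>S(N)\<close> of \<open>f\<close> over \<open>n \<le> N\<close>, so the quantitative claim is an estimate of Halasz type,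
  \<open>S(N) = O(N exp (- 2\<kappa>E/9))\<close> with \<open>\<kappa> = 1/b\<^sup>2\<close> and \<open>E\<close> the sum of \<open>1/p\<close> over the primes \<open>p \<le> N\<close> outside \<open>P\<close>.

  The obstruction to cancellation in \<open>S\<close> would be that \<open>f(p)\<close> imitates \<open>p ^ (iy)\<close> for some real \<open>y\<close>. It cannot:
  then \<open>p ^ (iby)\<close> would be close to \<open>f(p) ^ b = 1\<close> for most primes, which contradicts the boundedness of the
  zeta function away from its pole; and if \<open>y\<close> is so small that \<open>p ^ (iby)\<close> does not move for the primes up to \<open>Y\<close>,
  then the primes outside \<open>P\<close> up to \<open>Y\<close> contribute through their distance from \<open>1\<close>. With Mertens' theorem
  this gives \<open>F(1 + \<alpha> + iy) = O(exp (- \<kappa>E) (1 + |y|) ^ \<kappa> / \<alpha>)\<close> for the Dirichlet series \<open>F\<close> of \<open>f\<close>, uniformly in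
  \<open>y\<close>, where \<open>E\<close> is the sum of \<open>1/p\<close> over the primes outside \<open>P\<close> up to \<open>exp (1/\<alpha>)\<close> (\<open>norm_dseries_le\<close>).

  This saving is carried to \<open>S\<close> in three steps. The sums of \<open>f(n) ln n\<close> have the transform
  \<open>- F'(s)/s = F(s)/s * G(s)\<close>, where \<open>G\<close> has the coefficients \<open>\<Lambda>(n)f(n)\<close>. The factor \<open>F\<close> is bounded pointwise and
  \<open>G\<close> in mean square by Chebyshev's bound, so Plancherel's inequality saves \<open>exp (- 2\<kappa>E)\<close> in the mean square of
  these sums (\<open>log_sum_mean_square\<close>). Removing the logarithm costs a factor \<open>1/U\<^sup>2\<close> beyond a trivially estimated
  initial range of length \<open>U\<close>; the best \<open>U\<close> leaves a saving \<open>exp (- 2\<kappa>E/3)\<close> in the mean square of \<open>S\<close>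
  (\<open>partial_sum_mean_square\<close>). Finally \<open>f ln\<close> is the convolution of \<open>\<Lambda>f\<close> with \<open>f\<close>, so an average of
  its sums over a short interval of relative length \<open>\<eta>\<close> is a bilinear expression in \<open>S\<close> and the prime powers, to
  which the Cauchy-Schwarz inequality applies. The result is a saving \<open>exp (- \<kappa>E/3) \<eta> ^ (-1/2)\<close>
  against an error \<open>\<eta>\<close> from the smoothing, and \<open>\<eta> = exp (- 2\<kappa>E/9)\<close> balances the two (\<open>norm_partial_sum_le_saving\<close>).

  Sufficiency of divergence is then immediate, once it is checked that the digits are the residues
  (\<open>base_digit_xi\<close>). For necessity, suppose that the sum of \<open>1/p\<close> over the primes outside \<open>P\<close> converges and that the number is
  simply normal. Then the mean value of \<open>f\<close> is \<open>0\<close>, and it remains \<open>0\<close> when finitely many primes are moved into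
  \<open>P\<close> (\<open>negligible_insert_prime\<close>). But after moving enough of them at least three quarters of all integers have no
  prime factor outside \<open>P\<close>, and the mean value is bounded below (\<open>char_sum_large\<close>).\<close>

section \<open>Sums over prime powers\<close>

text \<open>Legendre's formula, from \<open>ln = \<Lambda> * 1\<close>; the induction works because
  \<open>\<lfloor>n/d\<rfloor>\<close> jumps exactly at the multiples of \<open>d\<close>.\<close>
lemma ln_fact_mangoldt:
  "ln (fact n :: real) = (\<Sum>d=1..n. mangoldt d * real (n div d))"
proof (induction n)
  case 0
  then show ?case by simp
next
  case (Suc n)
  have set_eq: "{d. d dvd Suc n} = {d \<in> {1..Suc n}. d dvd Suc n}"
    using dvd_imp_le by (auto simp: Suc_le_eq intro!: Nat.gr0I)
  have step: "mangoldt d * real (Suc n div d)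
      = mangoldt d * real (n div d) + (if d dvd Suc n then mangoldt d else 0)" for d :: nat
    by (auto simp: div_Suc dvd_eq_mod_eq_0 algebra_simps)
  have "(\<Sum>d=1..Suc n. mangoldt d * real (Suc n div d))
      = (\<Sum>d=1..Suc n. mangoldt d * real (n div d)) + (\<Sum>d=1..Suc n. if d dvd Suc n then mangoldt d else 0)"
    by (simp only: step sum.distrib)
  also have "(\<Sum>d=1..Suc n. mangoldt d * real (n div d)) = (\<Sum>d=1..n. mangoldt d * real (n div d))"
    by simp
  also have "(\<Sum>d=1..Suc n. if d dvd Suc n then mangoldt d else (0::real)) = (\<Sum>d | d dvd Suc n. mangoldt d)"
    unfolding set_eq by (rule sum.inter_filter[symmetric]) simp
  also have "\<dots> = ln (real (Suc n))"
    using mangoldt_sum[of "Suc n", where ?'a = real] by simp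
  also have "(\<Sum>d=1..n. mangoldt d * real (n div d)) = ln (fact n)"
    using Suc by simp
  finally show ?case
    by (simp add: ln_mult del: of_nat_Suc)
qed

text \<open>Chebyshev's argument: every prime power in \<open>(n, 2n]\<close> contributes fully to
  \<open>ln (2n choose n)\<close>, because \<open>\<lfloor>2n/d\<rfloor> - 2\<lfloor>n/d\<rfloor>\<close> is never negative and is \<open>1\<close> there.\<close>
lemma chebyshev_step: "(\<Sum>d\<in>{n<..2*n}. mangoldt d) \<le> 2 * real n * ln 2"
proof -
  have ge: "2 * (n div d) \<le> 2 * n div d" for d :: nat
    by (cases "d = 0") (auto simp: less_eq_div_iff_mult_less_eq mult.assoc)
  have "(\<Sum>d\<in>{n<..2*n}. mangoldt d) \<le>
      (\<Sum>d\<in>{n<..2*n}. mangoldt d * (real (2 * n div d) - 2 * real (n div d)))"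
  proof (rule sum_mono)
    fix d assume d: "d \<in> {n<..2*n}"
    then have "2 * n div d \<ge> 1"
      by (simp add: Suc_le_eq div_greater_zero_iff)
    moreover have "n div d = 0" using d by simp
    ultimately show "mangoldt d \<le> mangoldt d * (real (2 * n div d) - 2 * real (n div d))"
      using mangoldt_nonneg[of d] by (simp add: mult_le_cancel_left1)
  qed
  also have "\<dots> \<le> (\<Sum>d=1..2*n. mangoldt d * (real (2 * n div d) - 2 * real (n div d)))"
  proof (rule sum_mono2)
    fix d :: nat
    have "real (2 * (n div d)) \<le> real (2 * n div d)"
      using ge by (simp only: of_nat_le_iff)
    then show "0 \<le> mangoldt d * (real (2 * n div d) - 2 * real (n div d))"
      by (intro mult_nonneg_nonneg mangoldt_nonneg) auto
  qed auto
  also have "\<dots> = (\<Sum>d=1..2*n. mangoldt d * real (2 * n div d)) - 2 * (\<Sum>d=1..2*n. mangoldt d * real (n div d))"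
    by (simp add: sum_subtractf right_diff_distrib sum_distrib_left algebra_simps)
  also have "(\<Sum>d=1..2*n. mangoldt d * real (n div d)) = (\<Sum>d=1..n. mangoldt d * real (n div d))"
    by (rule sum.mono_neutral_right) auto
  also have "(\<Sum>d=1..2*n. mangoldt d * real (2 * n div d)) - 2 * (\<Sum>d=1..n. mangoldt d * real (n div d))
      = ln (real ((2 * n) choose n))"
    unfolding ln_fact_mangoldt[symmetric]
    by (simp add: binomial_fact ln_div ln_mult)
  also have "\<dots> \<le> ln (2 ^ (2 * n))"
  proof (rule ln_mono)
    have "real ((2 * n) choose n) \<le> real (2 ^ (2 * n))"
      using binomial_le_pow2[of "2*n" n] by (simp only: of_nat_le_iff)
    then show "real ((2 * n) choose n) \<le> 2 ^ (2 * n)" by simp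
    show "0 < real ((2 * n) choose n)" by (simp add: zero_less_binomial)
  qed
  also have "\<dots> = 2 * real n * ln 2"
    by (simp add: ln_realpow)
  finally show ?thesis .
qed

lemma chebyshev: "(\<Sum>d=1..n. mangoldt d) \<le> 4 * real n"
proof (induction n rule: less_induct)
  case (less n)
  show ?case
  proof (cases "n = 0")
    case True
    then show ?thesis by simp
  next
    case False
    define m where "m = n div 2"
    have m: "m < n" "2 * m \<le> n" "n \<le> 2 * m + 1" using False by (auto simp: m_def)
    have "(\<Sum>d=1..n. mangoldt d :: real) = (\<Sum>d=1..m. mangoldt d) + (\<Sum>d\<in>{m<..n}. mangoldt d)"
      using m by (subst sum.union_disjoint[symmetric]) (auto intro!: sum.cong)
    also have "(\<Sum>d\<in>{m<..n}. mangoldt d :: real) = (\<Sum>d\<in>{m<..2*m}. mangoldt d) + (\<Sum>d\<in>{2*m<..n}. mangoldt d)"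
      using m by (subst sum.union_disjoint[symmetric]) (auto intro!: sum.cong)
    finally have eq: "(\<Sum>d=1..n. mangoldt d :: real)
        = (\<Sum>d=1..m. mangoldt d) + ((\<Sum>d\<in>{m<..2*m}. mangoldt d) + (\<Sum>d\<in>{2*m<..n}. mangoldt d))" .
    have n: "n = 2 * m \<or> n = 2 * m + 1" using m by linarith
    have "(mangoldt (Suc (2 * m)) :: real) \<le> ln (1 + 2 * real m)"
      using mangoldt_le[of "2*m+1"] by (simp add: add_ac)
    also have "\<dots> \<le> 2 * real m"
      using ln_add_one_self_le_self[of "2 * real m"] by simp
    finally have "mangoldt (Suc (2 * m)) \<le> 2 * real m" .
    then have last: "(\<Sum>d\<in>{2*m<..n}. mangoldt d :: real) \<le> 2 * real m"
    proof (cases "n = 2 * m")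
      case False
      then have "{2*m<..n} = {Suc (2 * m)}" using n by auto
      then show ?thesis using \<open>mangoldt (Suc (2 * m)) \<le> 2 * real m\<close> by simp
    qed simp
    have "ln 2 \<le> (1::real)" using ln_2_less_1 by simp
    then have "2 * real m * ln 2 \<le> 2 * real m * 1" by (intro mult_left_mono) auto
    then show ?thesis
      using eq last less[OF m(1)] chebyshev_step[of m] m(2) by linarith
  qed
qed

lemma mangoldt_block:
  assumes "finite A" and "y > 0" and A: "\<And>d. d \<in> A \<Longrightarrow> y \<le> real d \<and> real d \<le> exp 1 * y"
  shows "(\<Sum>d\<in>A. mangoldt d / real d) \<le> 12"
proof -
  define n where "n = nat \<lfloor>exp 1 * y\<rfloor>"
  have n: "real n \<le> exp 1 * y" unfolding n_def by (rule of_nat_floor) (use \<open>y > 0\<close> in simp)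
  have "(\<Sum>d\<in>A. mangoldt d / real d) \<le> (\<Sum>d\<in>A. mangoldt d / y)"
  proof (rule sum_mono)
    fix d assume "d \<in> A"
    then have d: "y \<le> real d" using A by blast
    with \<open>y > 0\<close> have "0 < real d" by linarith
    with d \<open>y > 0\<close> show "mangoldt d / real d \<le> mangoldt d / y"
      by (intro divide_left_mono) (auto simp: mangoldt_nonneg)
  qed
  also have "\<dots> \<le> (\<Sum>d=1..n. mangoldt d / y)"
  proof (rule sum_mono2)
    show "A \<subseteq> {1..n}"
    proof
      fix d assume "d \<in> A"
      then have "real d \<ge> y" "real d \<le> exp 1 * y" using A by auto
      moreover have "d \<le> n" unfolding n_def by (rule le_nat_floor) fact
      moreover have "d \<noteq> 0" using \<open>real d \<ge> y\<close> \<open>y > 0\<close> by (intro notI) simp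
      ultimately show "d \<in> {1..n}" by simp
    qed
  qed (use \<open>y > 0\<close> in \<open>auto simp: mangoldt_nonneg\<close>)
  also have "\<dots> = (\<Sum>d=1..n. mangoldt d) / y" by (simp add: sum_divide_distrib)
  also have "\<dots> \<le> 4 * (exp 1 * y) / y"
    using chebyshev[of n] n \<open>y > 0\<close> by (intro divide_right_mono) auto
  also have "\<dots> \<le> 12" using exp_le \<open>y > 0\<close> by simp
  finally show ?thesis .
qed

text \<open>Up to a constant, the measure with mass \<open>\<Lambda>(n)/n\<close> at \<open>ln n\<close> is
  dominated by Lebesgue measure, as
  seen by functions that do not drop abruptly.\<close>
lemma mangoldt_sum_le_integral:
  fixes \<phi> :: "real \<Rightarrow> real"
  assumes [measurable]: "\<phi> \<in> borel_measurable borel" and nonneg: "\<And>u. 0 \<le> \<phi> u" and "B \<ge> 0"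
    and slow: "\<And>u v. u \<le> v \<Longrightarrow> v \<le> u + 1 \<Longrightarrow> \<phi> u \<le> B * \<phi> v"
  shows "(\<Sum>n. ennreal (mangoldt n / real n * \<phi> (ln (real n))))
           \<le> ennreal (12 * B) * (\<integral>\<^sup>+v. ennreal (\<phi> v) * indicator {0..} v \<partial>lborel)"
proof -
  let ?w = "\<lambda>n. mangoldt n / real n :: real"
  have "ennreal (?w n * \<phi> (ln (real n)))
      \<le> (\<integral>\<^sup>+v. ennreal (?w n * B) * (ennreal (\<phi> v) * indicator {ln (real n)..ln (real n) + 1} v) \<partial>lborel)" for n
  proof -
    have "ennreal (?w n * \<phi> (ln (real n)))
       = (\<integral>\<^sup>+v. ennreal (?w n * \<phi> (ln (real n))) * indicator {ln (real n)..ln (real n) + 1} v \<partial>lborel)"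
      by (subst nn_integral_cmult_indicator) auto
    also have "\<dots> \<le> (\<integral>\<^sup>+v. ennreal (?w n * B) * (ennreal (\<phi> v) * indicator {ln (real n)..ln (real n) + 1} v) \<partial>lborel)"
    proof (intro nn_integral_mono)
      fix v
      show "ennreal (?w n * \<phi> (ln (real n))) * indicator {ln (real n)..ln (real n) + 1} v
         \<le> ennreal (?w n * B) * (ennreal (\<phi> v) * indicator {ln (real n)..ln (real n) + 1} v)"
        using slow[of "ln (real n)" v] nonneg \<open>B \<ge> 0\<close>
        by (auto simp: indicator_def ennreal_mult[symmetric] mangoldt_nonneg mult.assoc intro!: ennreal_leI mult_left_mono divide_right_mono)
    qed
    finally show ?thesis .
  qed
  then have "(\<Sum>n. ennreal (?w n * \<phi> (ln (real n))))
      \<le> (\<Sum>n. \<integral>\<^sup>+v. ennreal (?w n * B) * (ennreal (\<phi> v) * indicator {ln (real n)..ln (real n) + 1} v) \<partial>lborel)"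
    by (intro suminf_le) auto
  also have "\<dots> = (\<integral>\<^sup>+v. (\<Sum>n. ennreal (?w n * B) * (ennreal (\<phi> v) * indicator {ln (real n)..ln (real n) + 1} v)) \<partial>lborel)"
    by (rule nn_integral_suminf[symmetric]) auto
  also have "\<dots> \<le> (\<integral>\<^sup>+v. ennreal (12 * B) * (ennreal (\<phi> v) * indicator {0..} v) \<partial>lborel)"
  proof (intro nn_integral_mono)
    fix v :: real
    show "(\<Sum>n. ennreal (?w n * B) * (ennreal (\<phi> v) * indicator {ln (real n)..ln (real n) + 1} v))
       \<le> ennreal (12 * B) * (ennreal (\<phi> v) * indicator {0..} v)"
    proof (rule suminf_le_const)
      fix N
      define A where "A = {n \<in> {..<N}. n > 0 \<and> v \<in> {ln (real n)..ln (real n) + 1}}"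
      have "(\<Sum>n<N. ennreal (?w n * B) * (ennreal (\<phi> v) * indicator {ln (real n)..ln (real n) + 1} v))
          = (\<Sum>n\<in>A. ennreal (?w n * B * \<phi> v))"
      proof (rule sum.mono_neutral_cong_right)
        show "\<forall>i\<in>{..<N} - A. ennreal (?w i * B) * (ennreal (\<phi> v) * indicator {ln (real i)..ln (real i) + 1} v) = 0"
          by (auto simp: A_def indicator_def intro!: Nat.gr0I)
        show "\<And>x. x \<in> A \<Longrightarrow> ennreal (?w x * B) * (ennreal (\<phi> v) * indicator {ln (real x)..ln (real x) + 1} v)
                  = ennreal (?w x * B * \<phi> v)"
          using nonneg \<open>B \<ge> 0\<close> by (subst ennreal_mult) (auto simp: A_def mangoldt_nonneg)
      qed (auto simp: A_def)
      also have "\<dots> = ennreal (\<Sum>n\<in>A. ?w n * B * \<phi> v)"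
        by (rule sum_ennreal) (intro mult_nonneg_nonneg divide_nonneg_nonneg mangoldt_nonneg nonneg \<open>B \<ge> 0\<close> of_nat_0_le_iff)
      also have "(\<Sum>n\<in>A. ?w n * B * \<phi> v) = (\<Sum>n\<in>A. ?w n) * B * \<phi> v"
        by (simp only: sum_distrib_right)
      also have "\<dots> \<le> ennreal (12 * B) * (ennreal (\<phi> v) * indicator {0..} v)"
      proof (cases "A = {}")
        case False
        then obtain k where "k > 0" "ln (real k) \<le> v" by (auto simp: A_def)
        moreover have "0 \<le> ln (real k)" using \<open>k > 0\<close> by simp
        ultimately have "v \<ge> 0" by linarith
        have "(\<Sum>n\<in>A. ?w n) \<le> 12"
        proof (rule mangoldt_block[where y = "exp (v - 1)"])
          fix d assume "d \<in> A"
          then have d: "d > 0" "ln (real d) \<le> v" "v - 1 \<le> ln (real d)" by (auto simp: A_def)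
          then have "exp (v - 1) \<le> exp (ln (real d))" "exp (ln (real d)) \<le> exp v"
            by (simp_all only: exp_le_cancel_iff)
          then show "exp (v - 1) \<le> real d \<and> real d \<le> exp 1 * exp (v - 1)"
            using d(1) by (simp flip: exp_add)
        qed (auto simp: A_def)
        then have "(\<Sum>n\<in>A. ?w n) * B * \<phi> v \<le> 12 * B * \<phi> v"
          using nonneg \<open>B \<ge> 0\<close> by (intro mult_right_mono) auto
        then show ?thesis
          using \<open>v \<ge> 0\<close> nonneg \<open>B \<ge> 0\<close> by (auto simp: ennreal_mult[symmetric] intro!: ennreal_leI)
      qed auto
      finally show "(\<Sum>n<N. ennreal (?w n * B) * (ennreal (\<phi> v) * indicator {ln (real n)..ln (real n) + 1} v))
           \<le> ennreal (12 * B) * (ennreal (\<phi> v) * indicator {0..} v)" .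
    qed auto
  qed
  also have "\<dots> = ennreal (12 * B) * (\<integral>\<^sup>+v. ennreal (\<phi> v) * indicator {0..} v \<partial>lborel)"
    by (rule nn_integral_cmult) auto
  finally show ?thesis .
qed

lemma sum_le_ennreal_bound:
  fixes f :: "nat \<Rightarrow> real"
  assumes "\<And>n. 0 \<le> f n" and "(\<Sum>n. ennreal (f n)) \<le> ennreal C" and "0 \<le> C"
  shows "summable f" and "suminf f \<le> C"
proof -
  have "(\<Sum>n. ennreal (f n)) \<noteq> top" using assms(2) by (auto simp: top_unique)
  then show "summable f" using assms(1) by (intro summable_suminf_not_top) auto
  from suminf_ennreal2[OF assms(1) this] have "ennreal (suminf f) \<le> ennreal C"
    using assms(2) by (simp only:)
  then show "suminf f \<le> C"
    using assms(3) by (simp only: ennreal_le_iff)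
qed

lemma mangoldt_powr_sum:
  assumes "0 < \<alpha>" "\<alpha> \<le> 1"
  shows "summable (\<lambda>n. mangoldt n * real n powr (-1 - \<alpha>))"
    and "(\<Sum>n. mangoldt n * real n powr (-1 - \<alpha>)) \<le> 36 / \<alpha>"
proof -
  define \<phi> where "\<phi> = (\<lambda>v::real. exp (- (v * \<alpha>)))"
  have eq: "mangoldt n / real n * \<phi> (ln (real n)) = mangoldt n * real n powr (-1 - \<alpha>)" for n
    by (cases "n = 0") (auto simp: \<phi>_def powr_def powr_diff exp_diff exp_minus field_simps exp_add)
  have "(\<Sum>n. ennreal (mangoldt n / real n * \<phi> (ln (real n))))
     \<le> ennreal (12 * 3) * (\<integral>\<^sup>+v. ennreal (\<phi> v) * indicator {0..} v \<partial>lborel)"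
  proof (rule mangoldt_sum_le_integral)
    fix u v :: real assume uv: "u \<le> v" "v \<le> u + 1"
    have "\<phi> u = exp ((v - u) * \<alpha>) * \<phi> v"
      by (simp add: \<phi>_def flip: exp_add) (simp add: algebra_simps)
    also have "exp ((v - u) * \<alpha>) \<le> exp 1"
      using uv assms by (simp add: mult_le_one)
    also have "\<dots> \<le> 3" by (rule exp_le)
    finally show "\<phi> u \<le> 3 * \<phi> v" by (simp add: \<phi>_def)
  qed (auto simp: \<phi>_def)
  also have "(\<integral>\<^sup>+v. ennreal (\<phi> v) * indicator {0..} v \<partial>lborel) = ennreal (1 / \<alpha>)"
  proof -
    have "(\<integral>\<^sup>+v. ennreal (\<phi> v) * indicator {0..} v \<partial>lborel) = ennreal (0 - (- exp (- (0 * \<alpha>)) / \<alpha>))"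
    proof (rule nn_integral_FTC_atLeast)
      show "((\<lambda>x. - exp (- (x * \<alpha>)) / \<alpha>) \<longlongrightarrow> 0) at_top"
        using assms by real_asymp
      show "DERIV (\<lambda>x. - exp (- (x * \<alpha>)) / \<alpha>) x :> \<phi> x" for x
        using assms unfolding \<phi>_def by (auto intro!: derivative_eq_intros simp: field_simps)
    qed (auto simp: \<phi>_def)
    then show ?thesis by simp
  qed
  also have "ennreal (12 * 3) * ennreal (1 / \<alpha>) = ennreal (36 / \<alpha>)"
    using assms by (subst ennreal_mult[symmetric]) auto
  finally have *: "(\<Sum>n. ennreal (mangoldt n * real n powr (-1 - \<alpha>))) \<le> ennreal (36 / \<alpha>)"
    unfolding eq .
  show "summable (\<lambda>n. mangoldt n * real n powr (-1 - \<alpha>))"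
    and "(\<Sum>n. mangoldt n * real n powr (-1 - \<alpha>)) \<le> 36 / \<alpha>"
    using sum_le_ennreal_bound[OF _ *] assms by (auto simp: mangoldt_nonneg)
qed

lemma integrable_cauchy_kernel: "integrable lborel (\<lambda>z::real. 1 / (1 + z\<^sup>2))"
  using integrable_inverse_1_plus_square
  by (simp add: set_integrable_def inverse_eq_divide einterval_def)

text \<open>A bound uniform in the centre \<open>a\<close>: it will measure the correlations of prime powers
  against the Poisson kernel.\<close>
lemma mangoldt_cauchy_sum:
  obtains C where "C > 0"
    "\<And>a. summable (\<lambda>n. mangoldt n / real n * (1 / (1 + (ln (real n) - a)\<^sup>2)))"
    "\<And>a. (\<Sum>n. mangoldt n / real n * (1 / (1 + (ln (real n) - a)\<^sup>2))) \<le> C"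
proof -
  define I where "I = (\<integral>z. 1 / (1 + z\<^sup>2) \<partial>lborel :: real)"
  have I0: "I \<ge> 0" unfolding I_def by (intro integral_nonneg_AE) auto
  have nnI: "(\<integral>\<^sup>+z. ennreal (1 / (1 + z\<^sup>2)) \<partial>lborel) = ennreal I"
    unfolding I_def by (rule nn_integral_eq_integral[OF integrable_cauchy_kernel]) auto
  have *: "(\<Sum>n. ennreal (mangoldt n / real n * (1 / (1 + (ln (real n) - a)\<^sup>2)))) \<le> ennreal (36 * I)" for a
  proof -
    define \<phi> where "\<phi> = (\<lambda>v::real. 1 / (1 + (v - a)\<^sup>2))"
    have slow: "\<phi> u \<le> 3 * \<phi> v" if uv: "u \<le> v" "v \<le> u + 1" for u v
    proof -
      have "(v - a)\<^sup>2 \<le> 2 * (u - a)\<^sup>2 + 2 * (v - u)\<^sup>2"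
        using sum_squares_ge_zero[of "u - a - (v - u)" 0] by (simp add: power2_eq_square algebra_simps)
      moreover have "(v - u)\<^sup>2 \<le> 1" using uv by (simp add: power_le_one)
      ultimately have "1 + (v - a)\<^sup>2 \<le> 3 * (1 + (u - a)\<^sup>2)"
        using zero_le_power2[of "u - a"] by argo
      then show ?thesis
        by (simp add: \<phi>_def divide_simps add_pos_nonneg)
    qed
    have meas: "\<phi> \<in> borel_measurable borel" unfolding \<phi>_def by measurable
    have nonneg: "0 \<le> \<phi> u" for u by (simp add: \<phi>_def)
    have "(\<Sum>n. ennreal (mangoldt n / real n * (1 / (1 + (ln (real n) - a)\<^sup>2))))
       \<le> ennreal (12 * 3) * (\<integral>\<^sup>+v. ennreal (1 / (1 + (v - a)\<^sup>2)) * indicator {0..} v \<partial>lborel)"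
      using mangoldt_sum_le_integral[OF meas nonneg _ slow] unfolding \<phi>_def by simp
    also have "(\<integral>\<^sup>+v. ennreal (1 / (1 + (v - a)\<^sup>2)) * indicator {0..} v \<partial>lborel)
        \<le> (\<integral>\<^sup>+v. ennreal (1 / (1 + (v - a)\<^sup>2)) \<partial>lborel)"
      by (intro nn_integral_mono) (auto simp: indicator_def)
    also have "\<dots> = (\<integral>\<^sup>+z. ennreal (1 / (1 + z\<^sup>2)) \<partial>lborel)"
      using nn_integral_real_affine[of "\<lambda>v. ennreal (1 / (1 + (v - a)\<^sup>2))" 1 a] by simp
    finally have "(\<Sum>n. ennreal (mangoldt n / real n * (1 / (1 + (ln (real n) - a)\<^sup>2))))
        \<le> ennreal (12 * 3) * ennreal I" unfolding nnI by (simp add: mult_left_mono)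
    also have "\<dots> = ennreal (36 * I)" using I0 by (subst ennreal_mult[symmetric]) auto
    finally show ?thesis .
  qed
  show ?thesis
  proof (rule that[of "36 * I + 1"])
    fix a
    note r = sum_le_ennreal_bound[OF _ *[of a]]
    show "summable (\<lambda>n. mangoldt n / real n * (1 / (1 + (ln (real n) - a)\<^sup>2)))"
      by (rule r) (use I0 in \<open>auto intro!: mult_nonneg_nonneg divide_nonneg_nonneg simp: mangoldt_nonneg\<close>)
    have "(\<Sum>n. mangoldt n / real n * (1 / (1 + (ln (real n) - a)\<^sup>2))) \<le> 36 * I"
      by (rule r) (use I0 in \<open>auto intro!: mult_nonneg_nonneg divide_nonneg_nonneg simp: mangoldt_nonneg\<close>)
    then show "(\<Sum>n. mangoldt n / real n * (1 / (1 + (ln (real n) - a)\<^sup>2))) \<le> 36 * I + 1" by simp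
  qed (use I0 in auto)
qed

section \<open>Euler products and the zeta function near its pole\<close>

text \<open>Comparing \<open>1 - w\<close> with \<open>exp (- w)\<close> costs a quadratic error, and
  \<open>\<Sum>1/p\<^sup>2\<close> converges. So an Euler product can be replaced by the exponential of a sum
  over primes up to a bounded factor.\<close>
lemma one_minus_exp_bounds:
  fixes w :: complex
  assumes "norm w \<le> 1 / 2"
  shows "exp (- Re w - 19 * (norm w)\<^sup>2) \<le> norm (1 - w)" "norm (1 - w) \<le> exp (- Re w + 19 * (norm w)\<^sup>2)"
proof -
  define r where "r = norm w"
  define t where "t = 2 * Re w - r\<^sup>2"
  have r: "0 \<le> r" "r \<le> 1 / 2" using assms by (auto simp: r_def)
  have re: "\<bar>Re w\<bar> \<le> r" unfolding r_def by (rule abs_Re_le_cmod)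
  have r2: "r\<^sup>2 \<le> r / 2" using mult_left_mono[OF r(2) r(1)] by (simp add: power2_eq_square)
  have norm2: "(norm (1 - w))\<^sup>2 = 1 - t"
    unfolding t_def r_def cmod_power2 by (simp add: power2_eq_square algebra_simps)
  have "norm (1 - w) \<ge> 1 - r" unfolding r_def using norm_triangle_ineq2[of 1 w] by simp
  then have "(norm (1 - w))\<^sup>2 \<ge> (1 / 2)\<^sup>2" using r by (intro power_mono) auto
  then have t: "1 - t \<ge> 1 / 4" using norm2 by (simp add: power2_eq_square)
  have t_le: "\<bar>t\<bar> \<le> 3 * r" unfolding t_def using re r2 r zero_le_power2[of r] by linarith
  have t2: "t\<^sup>2 \<le> 9 * r\<^sup>2"
    using power_mono[OF t_le, of 2] by (simp add: power_mult_distrib)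
  have up: "1 - t \<le> exp (- t)" using exp_ge_add_one_self[of "-t"] by simp
  have "exp (- t - 4 * t\<^sup>2) \<le> 1 - t"
  proof -
    have "ln (1 / (1 - t)) \<le> 1 / (1 - t) - 1" using t by (intro ln_le_minus_one) auto
    also have "\<dots> = t + t\<^sup>2 / (1 - t)" using t by (simp add: field_simps power2_eq_square)
    also have "t\<^sup>2 / (1 - t) \<le> t\<^sup>2 / (1 / 4)" using t by (intro divide_left_mono) auto
    finally have "- t - 4 * t\<^sup>2 \<le> ln (1 - t)" using t by (simp add: ln_div)
    then show ?thesis using t by (simp add: ln_ge_iff)
  qed
  have "(exp (- Re w - 19 * r\<^sup>2))\<^sup>2 = exp (- 2 * Re w - 38 * r\<^sup>2)"
    by (simp add: power2_eq_square flip: exp_add)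
  also have "\<dots> \<le> exp (- t - 4 * t\<^sup>2)"
    using t2 zero_le_power2[of r] unfolding t_def by (subst exp_le_cancel_iff) linarith
  also have "\<dots> \<le> (norm (1 - w))\<^sup>2" unfolding norm2 by fact
  finally show "exp (- Re w - 19 * (norm w)\<^sup>2) \<le> norm (1 - w)"
    unfolding r_def by (rule power2_le_imp_le) simp
  have "(norm (1 - w))\<^sup>2 \<le> exp (- t)" unfolding norm2 by fact
  also have "\<dots> \<le> exp (- 2 * Re w + 38 * r\<^sup>2)"
    using zero_le_power2[of r] unfolding t_def by (subst exp_le_cancel_iff) linarith
  also have "\<dots> = (exp (- Re w + 19 * r\<^sup>2))\<^sup>2"
    by (simp add: power2_eq_square flip: exp_add)
  finally show "norm (1 - w) \<le> exp (- Re w + 19 * (norm w)\<^sup>2)"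
    unfolding r_def by (rule power2_le_imp_le) simp
qed

text \<open>Multiplying by \<open>1 - g q\<close> deletes the multiples of \<open>q\<close>, because \<open>g q
  * g n = g (q n)\<close>. Working with the sifted series avoids sums over smooth numbers: what is left after
  all primes up to \<open>z\<close> is the term \<open>1\<close> and a tail.\<close>
lemma sieve_out_primes:
  fixes g :: "nat \<Rightarrow> complex"
  assumes g0: "g 0 = 0" and mult: "\<And>m n. g (m * n) = g m * g n" and summ: "summable (\<lambda>n. norm (g n))"
    and "finite T" and "\<And>p. p \<in> T \<Longrightarrow> prime p"
  shows "(\<Prod>p\<in>T. 1 - g p) * suminf g = (\<Sum>n. if \<forall>p\<in>T. \<not> p dvd n then g n else 0)"
  using assms(4,5)
proof (induction T rule: finite_induct)
  case (insert q T)
  define h where "h = (\<lambda>n. if \<forall>p\<in>T. \<not> p dvd n then g n else 0)"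
  define k where "k = (\<lambda>n. if q dvd n then h n else 0)"
  have q: "prime q" and T: "\<And>p. p \<in> T \<Longrightarrow> prime p" using insert by auto
  have summ_h: "summable h" "summable k"
    unfolding h_def k_def by (rule summable_comparison_test[OF _ summ]; intro exI[of _ 0]; auto)+
  have "g q * h n = k (q * n)" for n
  proof -
    have "p dvd q * n \<longleftrightarrow> p dvd n" if "p \<in> T" for p
      using q T[OF that] insert.hyps that by (metis prime_dvd_mult_iff primes_dvd_imp_eq)
    then show ?thesis by (simp add: h_def k_def mult)
  qed
  then have "g q * suminf h = (\<Sum>n. k (q * n))"
    by (simp add: suminf_mult[OF summ_h(1), symmetric])
  also have "\<dots> = suminf k"
    using prime_gt_0_nat[OF q] by (intro suminf_mono_reindex) (auto simp: strict_mono_def k_def)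
  finally have "(1 - g q) * suminf h = suminf h - suminf k" by (simp add: algebra_simps)
  also have "\<dots> = (\<Sum>n. h n - k n)" by (rule suminf_diff[OF summ_h])
  also have "(\<lambda>n. h n - k n) = (\<lambda>n. if \<forall>p\<in>insert q T. \<not> p dvd n then g n else 0)"
    by (auto simp: h_def k_def fun_eq_iff)
  finally show ?case using insert by (simp add: h_def mult.assoc)
qed simp

lemma euler_product_limit:
  fixes g :: "nat \<Rightarrow> complex"
  assumes g0: "g 0 = 0" and g1: "g 1 = 1" and mult: "\<And>m n. g (m * n) = g m * g n"
    and summ: "summable (\<lambda>n. norm (g n))"
  shows "(\<lambda>z. (\<Prod>p | prime p \<and> p \<le> z. 1 - g p) * suminf g) \<longlonglongrightarrow> 1"
proof -
  define S where "S = (\<lambda>z n. if \<forall>p\<in>{p. prime p \<and> p \<le> z}. \<not> p dvd n then g n else 0)"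
  have summ_S: "summable (\<lambda>n. norm (S z n))" for z
    unfolding S_def by (rule summable_comparison_test[OF _ summ]) (auto intro!: exI[of _ 0])
  have fin: "finite {p::nat. prime p \<and> p \<le> z}" for z by (rule finite_subset[of _ "{..z}"]) auto
  have eq: "(\<Prod>p | prime p \<and> p \<le> z. 1 - g p) * suminf g = suminf (S z)" for z
    unfolding S_def by (rule sieve_out_primes[OF g0 mult summ fin]) auto
  have tail: "norm (suminf (S z) - 1) \<le> (\<Sum>n. norm (g (n + Suc z)))" if "z \<ge> 1" for z
  proof -
    have small: "S z n = (if n = 1 then 1 else 0)" if "n < Suc z" for n
    proof (cases "n = 0 \<or> n = 1")
      case True
      then show ?thesis using g0 g1 by (auto simp: S_def)
    next
      case False
      then obtain p where "prime p" "p dvd n" using prime_factor_nat by blast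
      moreover from this False that have "p \<le> z" using dvd_imp_le[of p n] by auto
      ultimately show ?thesis using False by (auto simp: S_def)
    qed
    have "suminf (S z) = (\<Sum>n. S z (n + Suc z)) + (\<Sum>n<Suc z. S z n)"
      by (rule suminf_split_initial_segment) (rule summable_norm_cancel[OF summ_S])
    also have "(\<Sum>n<Suc z. S z n) = (\<Sum>n<Suc z. if n = 1 then 1 else 0)"
      by (rule sum.cong) (auto simp: small)
    also have "\<dots> = 1" using that by (subst sum.delta) auto
    finally have "norm (suminf (S z) - 1) = norm (\<Sum>n. S z (n + Suc z))" by simp
    also have "\<dots> \<le> (\<Sum>n. norm (S z (n + Suc z)))"
      by (rule summable_norm) (rule summable_ignore_initial_segment[OF summ_S])
    also have "\<dots> \<le> (\<Sum>n. norm (g (n + Suc z)))"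
      by (intro suminf_le summable_ignore_initial_segment[OF summ_S] summable_ignore_initial_segment[OF summ])
         (auto simp: S_def)
    finally show ?thesis .
  qed
  have "(\<lambda>z. \<Sum>n. norm (g (n + z))) \<longlonglongrightarrow> 0"
    by (rule suminf_exist_split2[OF summ])
  then have "(\<lambda>z. \<Sum>n. norm (g (n + Suc z))) \<longlonglongrightarrow> 0"
    by (rule LIMSEQ_Suc)
  then have "(\<lambda>z. suminf (S z) - 1) \<longlonglongrightarrow> 0"
    by (rule Lim_null_comparison[rotated]) (use tail in \<open>auto simp: eventually_at_top_linorder\<close>)
  then show ?thesis unfolding eq by (simp add: LIM_zero_iff)
qed

definition euler_error :: real where
  "euler_error = 19 * (\<Sum>n. 1 / real n ^ 2)"

lemma summable_inverse_square: "summable (\<lambda>n. 1 / real n ^ 2)"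
  using inverse_power_summable[of 2] by (simp add: field_simps)

lemma powr_minus_le_inverse:
  assumes "\<alpha> \<ge> 0"
  shows "real n powr (-1 - \<alpha>) \<le> 1 / real n"
proof (cases "n = 0")
  case False
  then have "real n powr (-1 - \<alpha>) \<le> real n powr (-1)"
    using assms by (intro powr_mono) auto
  then show ?thesis using False by (simp add: powr_minus_divide)
qed simp

lemma summable_powr_below: "\<alpha> > 0 \<Longrightarrow> summable (\<lambda>n. real n powr (-1 - \<alpha>))"
  using summable_real_powr_iff[of "-1 - \<alpha>"] by simp

lemma dirichlet_series_abs_exp_bounds:
  fixes g :: "nat \<Rightarrow> complex"
  assumes "\<alpha> > 0" and bound: "\<And>n. norm (g n) \<le> real n powr (-1 - \<alpha>)"
    and g1: "g 1 = 1" and mult: "\<And>m n. g (m * n) = g m * g n"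
  shows "norm (suminf g) \<le> exp ((\<Sum>n. if prime n then Re (g n) else 0) + euler_error)"
    and "exp ((\<Sum>n. if prime n then Re (g n) else 0) - euler_error) \<le> norm (suminf g)"
proof -
  have g0: "g 0 = 0" using bound[of 0] by simp
  have summ: "summable (\<lambda>n. norm (g n))"
    by (rule summable_comparison_test[OF _ summable_powr_below[OF \<open>\<alpha> > 0\<close>]]) (use bound in auto)
  define A where "A = (\<Sum>n. if prime n then Re (g n) else 0)"
  define Az where "Az = (\<lambda>z. \<Sum>p | prime p \<and> p \<le> z. Re (g p))"
  have Re_le: "\<bar>Re (g n)\<bar> \<le> norm (g n)" for n by (rule abs_Re_le_cmod)
  have "summable (\<lambda>n. if prime n then Re (g n) else 0)"
    by (rule summable_comparison_test[OF _ summ]) (auto intro!: exI[of _ 0] simp: Re_le)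
  then have "(\<lambda>z. \<Sum>n\<le>z. if prime n then Re (g n) else 0) \<longlonglongrightarrow> A"
    unfolding A_def by (rule summable_LIMSEQ')
  moreover have "(\<Sum>n\<le>z. if prime n then Re (g n) else 0) = Az z" for z
    unfolding Az_def by (subst sum.inter_filter[symmetric]) (auto intro!: sum.cong)
  ultimately have lim_A: "Az \<longlonglongrightarrow> A" by simp
  have fin: "finite {p::nat. prime p \<and> p \<le> z}" for z by (rule finite_subset[of _ "{..z}"]) auto
  have half: "norm (g p) \<le> 1 / 2" if "prime p" for p
  proof -
    have "norm (g p) \<le> 1 / real p" using bound[of p] powr_minus_le_inverse[of \<alpha> p] \<open>\<alpha> > 0\<close> by linarith
    also have "\<dots> \<le> 1 / 2" using prime_ge_2_nat[OF that] by (intro divide_left_mono) auto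
    finally show ?thesis .
  qed
  have sq: "(\<Sum>p | prime p \<and> p \<le> z. 19 * (norm (g p))\<^sup>2) \<le> euler_error" for z
  proof -
    have "(\<Sum>p | prime p \<and> p \<le> z. 19 * (norm (g p))\<^sup>2) \<le> (\<Sum>p | prime p \<and> p \<le> z. 19 * (1 / real p ^ 2))"
    proof (intro sum_mono mult_left_mono)
      fix p :: nat
      have "norm (g p) \<le> 1 / real p" using bound[of p] powr_minus_le_inverse[of \<alpha> p] \<open>\<alpha> > 0\<close> by linarith
      then show "(norm (g p))\<^sup>2 \<le> 1 / real p ^ 2" using power_mono[of "norm (g p)" "1 / real p" 2] by (simp add: power_divide)
    qed auto
    also have "\<dots> = 19 * (\<Sum>p | prime p \<and> p \<le> z. 1 / real p ^ 2)" by (simp add: sum_distrib_left)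
    also have "\<dots> \<le> euler_error" unfolding euler_error_def
      by (intro mult_left_mono sum_le_suminf summable_inverse_square fin) auto
    finally show ?thesis .
  qed
  have up: "norm (\<Prod>p | prime p \<and> p \<le> z. 1 - g p) \<le> exp (- Az z + euler_error)" for z
  proof -
    have "norm (\<Prod>p | prime p \<and> p \<le> z. 1 - g p) \<le> (\<Prod>p | prime p \<and> p \<le> z. exp (- Re (g p) + 19 * (norm (g p))\<^sup>2))"
      unfolding prod_norm[symmetric]
      by (intro prod_mono conjI norm_ge_zero one_minus_exp_bounds(2) half) simp
    also have "\<dots> = exp (- Az z + (\<Sum>p | prime p \<and> p \<le> z. 19 * (norm (g p))\<^sup>2))"
      by (simp add: exp_sum[OF fin, symmetric] Az_def sum.distrib sum_subtractf sum_negf)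
    also have "\<dots> \<le> exp (- Az z + euler_error)" using sq by simp
    finally show ?thesis .
  qed
  have low: "exp (- Az z - euler_error) \<le> norm (\<Prod>p | prime p \<and> p \<le> z. 1 - g p)" for z
  proof -
    have "exp (- Az z - euler_error) \<le> exp (- Az z - (\<Sum>p | prime p \<and> p \<le> z. 19 * (norm (g p))\<^sup>2))"
      using sq by simp
    also have "\<dots> = (\<Prod>p | prime p \<and> p \<le> z. exp (- Re (g p) - 19 * (norm (g p))\<^sup>2))"
      by (simp add: exp_sum[OF fin, symmetric] Az_def sum_subtractf sum_negf)
    also have "\<dots> \<le> norm (\<Prod>p | prime p \<and> p \<le> z. 1 - g p)"
      unfolding prod_norm[symmetric]
      by (intro prod_mono conjI exp_ge_zero one_minus_exp_bounds(1) half) simp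
    finally show ?thesis .
  qed
  have lim: "(\<lambda>z. norm (\<Prod>p | prime p \<and> p \<le> z. 1 - g p) * norm (suminf g)) \<longlonglongrightarrow> 1"
    using tendsto_norm[OF euler_product_limit[OF g0 g1 mult summ]] by (simp add: norm_mult)
  have "exp (- A - euler_error) * norm (suminf g) \<le> 1"
  proof (rule LIMSEQ_le[OF _ lim])
    show "(\<lambda>z. exp (- Az z - euler_error) * norm (suminf g)) \<longlonglongrightarrow> exp (- A - euler_error) * norm (suminf g)"
      by (intro tendsto_intros lim_A)
  qed (intro exI allI impI mult_right_mono low norm_ge_zero)
  then show "norm (suminf g) \<le> exp ((\<Sum>n. if prime n then Re (g n) else 0) + euler_error)"
    unfolding A_def[symmetric] by (simp add: exp_add exp_diff exp_minus field_simps)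
  have "1 \<le> exp (- A + euler_error) * norm (suminf g)"
  proof (rule LIMSEQ_le[OF lim])
    show "(\<lambda>z. exp (- Az z + euler_error) * norm (suminf g)) \<longlonglongrightarrow> exp (- A + euler_error) * norm (suminf g)"
      by (intro tendsto_intros lim_A)
  qed (intro exI allI impI mult_right_mono up norm_ge_zero)
  then show "exp ((\<Sum>n. if prime n then Re (g n) else 0) - euler_error) \<le> norm (suminf g)"
    unfolding A_def[symmetric] by (simp add: exp_add exp_diff exp_minus field_simps)
qed

lemma norm_nat_powr: "norm (complex_of_nat n powr s) = real n powr Re s"
  by (cases "n = 0") (auto simp: norm_powr_real_powr)

lemma zeta_summable: "Re s > 1 \<Longrightarrow> summable (\<lambda>n. norm (of_nat n powr (-s) :: complex))"
  by (simp add: norm_nat_powr summable_real_powr_iff)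

text \<open>Each term of the zeta series is compared with the integral of \<open>x powr (-s)\<close> over
  \<open>[n, n + 1]\<close>. The crude growth in \<open>norm s\<close> is harmless, since only its power
  \<open>\<kappa> \<le> 1/4\<close> enters later.\<close>
lemma powr_integral_step:
  fixes s :: complex
  assumes "Re s > 1" and "n > 0"
  shows "norm (of_nat n powr (-s) - (of_nat n powr (1 - s) - of_nat (Suc n) powr (1 - s)) / (s - 1)) \<le> norm s / real n ^ 2"
proof -
  define S where "S = closed_segment (of_nat n :: complex) (of_nat (Suc n))"
  have inS: "\<exists>x. z = of_real x \<and> real n \<le> x \<and> x \<le> real n + 1" if "z \<in> S" for z
  proof -
    from that obtain t where t: "0 \<le> t" "t \<le> 1" "z = (1 - t) *\<^sub>R of_nat n + t *\<^sub>R of_nat (Suc n)"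
      by (auto simp: S_def closed_segment_def)
    then have "z = of_real (real n + t)" by (simp add: scaleR_conv_of_real algebra_simps)
    then show ?thesis using t by (intro exI[of _ "real n + t"]) auto
  qed
  have ends: "of_nat n \<in> S" "of_nat (Suc n) \<in> S" "convex S" by (auto simp: S_def)
  have slit: "z \<notin> \<real>\<^sub>\<le>\<^sub>0" if "z \<in> S" for z using inS[OF that] \<open>n > 0\<close> by auto
  have s1: "s - 1 \<noteq> 0" using assms by auto
  have inner: "norm (of_nat n powr (-s) - z powr (-s)) \<le> norm s / real n ^ 2" if z: "z \<in> S" for z
  proof -
    have "norm (of_nat n powr (-s) - z powr (-s)) \<le> norm s / real n ^ 2 * norm (of_nat n - z)"
    proof (rule field_differentiable_bound[OF ends(3) _ _ ends(1) z])
      fix w assume w: "w \<in> S"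
      show "((\<lambda>w. w powr (-s)) has_field_derivative (- s) * w powr (- s - 1)) (at w within S)"
        by (rule has_field_derivative_at_within) (rule has_field_derivative_powr[OF slit[OF w]])
      from inS[OF w] obtain x where x: "w = of_real x" "real n \<le> x" by auto
      have "norm (w powr (- s - 1)) = x powr (- Re s - 1)"
        using x \<open>n > 0\<close> by (simp add: norm_powr_real_powr)
      also have "\<dots> \<le> real n powr (- Re s - 1)" using x \<open>n > 0\<close> assms by (intro powr_mono2') auto
      also have "\<dots> \<le> real n powr (-2)" using assms by (intro powr_mono) auto
      also have "\<dots> = 1 / real n ^ 2" using \<open>n > 0\<close> by (simp add: powr_minus_divide powr_numeral)
      finally have "norm (w powr (- s - 1)) \<le> 1 / real n ^ 2" .
      from mult_left_mono[OF this norm_ge_zero[of s]]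
      show "norm ((- s) * w powr (- s - 1)) \<le> norm s / real n ^ 2" by (simp add: norm_mult)
    qed
    moreover have "norm (of_nat n - z) \<le> 1"
    proof -
      from inS[OF z] obtain x where x: "z = of_real x" "real n \<le> x" "x \<le> real n + 1" by auto
      have "norm (of_nat n - z) = norm (of_real (real n - x) :: complex)" using x(1) by simp
      also have "\<dots> \<le> 1" using x(2,3) unfolding norm_of_real by simp
      finally show ?thesis .
    qed
    ultimately show ?thesis
      using mult_left_mono[of "norm (of_nat n - z)" 1 "norm s / real n ^ 2"] by simp
  qed
  have "norm ((of_nat (Suc n) * of_nat n powr (-s) + of_nat (Suc n) powr (1 - s) / (s - 1))
            - (of_nat n * of_nat n powr (-s) + of_nat n powr (1 - s) / (s - 1)))
       \<le> norm s / real n ^ 2 * norm (of_nat (Suc n) - of_nat n :: complex)"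
  proof (rule field_differentiable_bound[OF ends(3) _ _ ends(2,1)])
    fix z assume z: "z \<in> S"
    have "((\<lambda>z. z powr (1 - s)) has_field_derivative (1 - s) * z powr (1 - s - 1)) (at z)"
      by (rule has_field_derivative_powr[OF slit[OF z]])
    then have "((\<lambda>z. z * of_nat n powr (-s) + z powr (1 - s) / (s - 1)) has_field_derivative
          of_nat n powr (-s) + (1 - s) * z powr (1 - s - 1) / (s - 1)) (at z)"
      using s1 slit[OF z] by (auto intro!: derivative_eq_intros)
    moreover have "of_nat n powr (-s) + (1 - s) * z powr (1 - s - 1) / (s - 1) = of_nat n powr (-s) - z powr (-s)"
      using s1 by (simp add: field_simps)
    ultimately show "((\<lambda>z. z * of_nat n powr (-s) + z powr (1 - s) / (s - 1)) has_field_derivative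
          of_nat n powr (-s) - z powr (-s)) (at z within S)"
      by (simp add: has_field_derivative_at_within)
  qed (rule inner)
  then show ?thesis by (simp add: algebra_simps diff_divide_distrib)
qed

lemma zeta_near_pole:
  fixes s :: complex
  assumes "Re s > 1"
  shows "norm ((\<Sum>n. of_nat n powr (-s)) - 1 / (s - 1)) \<le> 2 * norm s"
proof -
  define d where "d = (\<lambda>n. (of_nat (Suc n) powr (1 - s) - of_nat (Suc (Suc n)) powr (1 - s)) / (s - 1) :: complex)"
  define e where "e = (\<lambda>n. of_nat (Suc n) powr (-s) - d n)"
  have "(\<lambda>n. norm (of_nat n powr (1 - s) :: complex)) \<longlonglongrightarrow> 0"
    unfolding norm_nat_powr using assms by (intro tendsto_neg_powr filterlim_real_sequentially) auto
  then have lim0: "(\<lambda>n. of_nat (Suc n) powr (1 - s) :: complex) \<longlonglongrightarrow> 0"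
    by (intro LIMSEQ_Suc) (simp add: tendsto_norm_zero_iff)
  have "d sums (((of_nat (Suc 0) powr (1 - s)) - 0) / (s - 1))"
    unfolding d_def by (intro sums_divide telescope_sums') (rule lim0)
  then have d_sums: "d sums (1 / (s - 1))" by simp
  have z_sums: "(\<lambda>n. of_nat (Suc n) powr (-s)) sums (\<Sum>n. of_nat n powr (-s) :: complex)"
    using summable_sums[OF summable_norm_cancel[OF zeta_summable[OF assms]]]
    by (subst sums_Suc_iff) simp
  have e_sums: "e sums ((\<Sum>n. of_nat n powr (-s)) - 1 / (s - 1))"
    unfolding e_def by (rule sums_diff[OF z_sums d_sums])
  have sq: "(\<lambda>n. norm s * (1 / real (Suc n) ^ 2)) sums (norm s * (pi\<^sup>2 / 6))"
    using inverse_squares_sums by (intro sums_mult) (simp add: add_ac)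
  have e_le: "norm (e n) \<le> norm s * (1 / real (Suc n) ^ 2)" for n
    using powr_integral_step[OF assms, of "Suc n"] unfolding e_def d_def by simp
  have "norm (suminf e) \<le> norm s * (pi\<^sup>2 / 6)"
    using norm_suminf_le[OF e_le sums_summable[OF sq]] sums_unique[OF sq] by simp
  also have "\<dots> \<le> norm s * 2"
  proof (intro mult_left_mono)
    have "pi\<^sup>2 \<le> (32 / 10)\<^sup>2" using pi_less_4 pi_approx by (intro power_mono) auto
    then show "pi\<^sup>2 / 6 \<le> 2" by (simp add: power2_eq_square)
  qed auto
  finally show ?thesis using sums_unique[OF e_sums] by simp
qed

section \<open>Twisted sums over primes\<close>

text \<open>The parameter \<open>\<alpha>\<close> is the distance to the line \<open>Re s = 1\<close>; it acts
  as a smooth cutoff of the primes at \<open>exp (1/\<alpha>)\<close>.\<close>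
definition prime_sum :: "real \<Rightarrow> (nat \<Rightarrow> real) \<Rightarrow> real" where
  "prime_sum \<alpha> c = (\<Sum>n. if prime n then c n * real n powr (-1 - \<alpha>) else 0)"

lemma euler_error_nonneg: "0 \<le> euler_error"
  unfolding euler_error_def by (intro mult_nonneg_nonneg suminf_nonneg summable_inverse_square) auto

lemma summable_prime_sum:
  assumes "\<alpha> > 0" and "\<And>p. prime p \<Longrightarrow> \<bar>c p\<bar> \<le> M"
  shows "summable (\<lambda>n. if prime n then c n * real n powr (-1 - \<alpha>) else 0)"
proof (rule summable_comparison_test[OF _ summable_mult[OF summable_powr_below[OF \<open>\<alpha> > 0\<close>], of "\<bar>M\<bar>"]], intro exI[of _ 0] allI impI)
  fix n :: nat
  show "norm (if prime n then c n * real n powr (-1 - \<alpha>) else 0) \<le> \<bar>M\<bar> * real n powr (-1 - \<alpha>)"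
    using assms(2)[of n] by (auto simp: abs_mult intro!: mult_right_mono)
qed

lemma prime_sum_mono:
  assumes "\<alpha> > 0" and "\<And>p. prime p \<Longrightarrow> \<bar>c p\<bar> \<le> M" and "\<And>p. prime p \<Longrightarrow> \<bar>d p\<bar> \<le> N"
    and "\<And>p. prime p \<Longrightarrow> c p \<le> d p"
  shows "prime_sum \<alpha> c \<le> prime_sum \<alpha> d"
  unfolding prime_sum_def
  by (rule suminf_le[OF _ summable_prime_sum[OF assms(1,2)] summable_prime_sum[OF assms(1,3)]])
     (auto intro!: mult_right_mono assms(4))

lemma prime_sum_diff:
  assumes "\<alpha> > 0" and "\<And>p. prime p \<Longrightarrow> \<bar>c p\<bar> \<le> M" and "\<And>p. prime p \<Longrightarrow> \<bar>d p\<bar> \<le> N"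
  shows "prime_sum \<alpha> (\<lambda>p. c p - d p) = prime_sum \<alpha> c - prime_sum \<alpha> d"
  unfolding prime_sum_def
  by (subst suminf_diff[OF summable_prime_sum[OF assms(1,2)] summable_prime_sum[OF assms(1,3)]])
     (auto simp: left_diff_distrib intro!: suminf_cong)

lemma prime_sum_cmult:
  assumes "\<alpha> > 0" and "\<And>p. prime p \<Longrightarrow> \<bar>c p\<bar> \<le> M"
  shows "prime_sum \<alpha> (\<lambda>p. k * c p) = k * prime_sum \<alpha> c"
  unfolding prime_sum_def
  by (subst suminf_mult[OF summable_prime_sum[OF assms], symmetric])
     (auto simp: mult.assoc intro!: suminf_cong)

lemma prime_sum_finite:
  assumes "finite T" and "\<And>p. p \<in> T \<Longrightarrow> prime p"
  shows "prime_sum \<alpha> (\<lambda>p. if p \<in> T then c p else 0) = (\<Sum>p\<in>T. c p * real p powr (-1 - \<alpha>))"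
  unfolding prime_sum_def
  by (subst suminf_finite[OF assms(1)]) (auto intro!: sum.cong simp: assms(2))

lemma powr_vertical:
  assumes "n > 0"
  shows "of_nat n powr (- Complex (1 + \<alpha>) y) = of_real (real n powr (-1 - \<alpha>)) * cis (- (y * ln (real n)))"
proof -
  have "of_nat n powr (- Complex (1 + \<alpha>) y) = exp (- Complex (1 + \<alpha>) y * of_real (ln (real n)))"
    using assms by (simp add: powr_def Ln_of_nat)
  also have "- Complex (1 + \<alpha>) y * of_real (ln (real n)) = of_real ((-1 - \<alpha>) * ln (real n)) + \<i> * of_real (- (y * ln (real n)))"
    by (simp add: complex_eq_iff algebra_simps)
  also have "exp \<dots> = of_real (exp ((-1 - \<alpha>) * ln (real n))) * cis (- (y * ln (real n)))"
    unfolding exp_add exp_of_real cis_conv_exp ..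
  also have "exp ((-1 - \<alpha>) * ln (real n)) = real n powr (-1 - \<alpha>)"
    using assms by (simp add: powr_def)
  finally show ?thesis .
qed

text \<open>The Euler product turns sums over primes twisted by \<open>p\<^sup>-\<^sup>i\<^sup>y\<close> into
  the size of a Dirichlet series.\<close>
lemma dirichlet_series_vs_prime_sum:
  fixes f :: "nat \<Rightarrow> complex" and \<alpha> y :: real
  assumes "\<alpha> > 0" and f1: "f 1 = 1" and norm: "\<And>n. n > 0 \<Longrightarrow> norm (f n) = 1"
    and mult: "\<And>m n. m > 0 \<Longrightarrow> n > 0 \<Longrightarrow> f (m * n) = f m * f n"
  defines "D \<equiv> norm (\<Sum>n. f n * of_nat n powr (- Complex (1 + \<alpha>) y))"
    and "A \<equiv> prime_sum \<alpha> (\<lambda>p. Re (f p * cis (- (y * ln (real p)))))"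
  shows "D \<le> exp (A + euler_error)" and "exp (A - euler_error) \<le> D"
proof -
  define g where "g = (\<lambda>n. f n * of_nat n powr (- Complex (1 + \<alpha>) y))"
  have g_norm: "norm (g n) \<le> real n powr (-1 - \<alpha>)" for n
    by (cases "n = 0") (auto simp: g_def norm_mult norm norm_nat_powr)
  have g_one: "g 1 = 1" unfolding g_def using f1 by simp
  have g_mult: "g (m * n) = g m * g n" for m n
  proof (cases "m = 0 \<or> n = 0")
    case False
    then show ?thesis using mult[of m n] by (simp add: g_def powr_times_real)
  qed (auto simp: g_def)
  have "(\<Sum>n. if prime n then Re (g n) else 0) = A"
    unfolding A_def prime_sum_def
  proof (rule suminf_cong)
    fix n :: nat
    have "Re (g n) = Re (f n * cis (- (y * ln (real n)))) * real n powr (-1 - \<alpha>)" if "prime n"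
      unfolding g_def powr_vertical[OF prime_gt_0_nat[OF that]] by (simp add: algebra_simps)
    then show "(if prime n then Re (g n) else 0) = (if prime n then Re (f n * cis (- (y * ln (real n)))) * real n powr (-1 - \<alpha>) else 0)"
      by simp
  qed
  then show "D \<le> exp (A + euler_error)" and "exp (A - euler_error) \<le> D"
    using dirichlet_series_abs_exp_bounds[OF \<open>\<alpha> > 0\<close> g_norm g_one g_mult] unfolding D_def g_def by auto
qed

lemma norm_zeta_le:
  assumes "\<alpha> > 0"
  shows "norm (\<Sum>n. of_nat n powr (- Complex (1 + \<alpha>) u)) \<le> 1 / norm (Complex \<alpha> u) + 2 * norm (Complex (1 + \<alpha>) u)"
proof -
  have eq: "Complex (1 + \<alpha>) u - 1 = Complex \<alpha> u" by (simp add: complex_eq_iff)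
  have "norm (\<Sum>n. of_nat n powr (- Complex (1 + \<alpha>) u))
      \<le> norm (1 / Complex \<alpha> u) + norm ((\<Sum>n. of_nat n powr (- Complex (1 + \<alpha>) u)) - 1 / Complex \<alpha> u)"
    using norm_triangle_sub by blast
  also have "norm ((\<Sum>n. of_nat n powr (- Complex (1 + \<alpha>) u)) - 1 / Complex \<alpha> u) \<le> 2 * norm (Complex (1 + \<alpha>) u)"
    using zeta_near_pole[of "Complex (1 + \<alpha>) u"] assms unfolding eq by simp
  finally show ?thesis by (simp add: norm_divide)
qed

lemma prime_sum_cos_le:
  assumes "\<alpha> > 0"
  shows "prime_sum \<alpha> (\<lambda>p. cos (u * ln (real p)))
     \<le> ln (1 / norm (Complex \<alpha> u) + 2 * norm (Complex (1 + \<alpha>) u)) + euler_error"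
proof -
  have "exp (prime_sum \<alpha> (\<lambda>p. cos (u * ln (real p))) - euler_error) \<le> norm (\<Sum>n. of_nat n powr (- Complex (1 + \<alpha>) u))"
    using dirichlet_series_vs_prime_sum(2)[of \<alpha> "\<lambda>_. 1" u] assms by simp
  also note norm_zeta_le[OF assms, of u]
  finally have *: "exp (prime_sum \<alpha> (\<lambda>p. cos (u * ln (real p))) - euler_error)
      \<le> 1 / norm (Complex \<alpha> u) + 2 * norm (Complex (1 + \<alpha>) u)" .
  have "prime_sum \<alpha> (\<lambda>p. cos (u * ln (real p))) - euler_error
      \<le> ln (1 / norm (Complex \<alpha> u) + 2 * norm (Complex (1 + \<alpha>) u))"
    using * less_le_trans[OF exp_gt_zero *] by (simp add: ln_ge_iff)
  then show ?thesis by simp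
qed

text \<open>The case \<open>u = 0\<close> in both directions: near its pole the zeta function has the exact
  order \<open>1/\<alpha>\<close>. The lower bound \<open>Z \<ge> 1/\<alpha> - 4\<close> says nothing for large
  \<open>\<alpha>\<close>, where \<open>Z \<ge> 1\<close> takes over.\<close>
lemma prime_sum_one:
  assumes "0 < \<alpha>" "\<alpha> \<le> 1"
  shows "ln (1 / \<alpha>) - (ln 5 + euler_error) \<le> prime_sum \<alpha> (\<lambda>_. 1)"
    and "prime_sum \<alpha> (\<lambda>_. 1) \<le> ln (1 / \<alpha>) + (ln 5 + euler_error)"
proof -
  define Z where "Z = norm (\<Sum>n. of_nat n powr (- Complex (1 + \<alpha>) 0) :: complex)"
  have c0: "Complex a 0 = of_real a" for a by (simp add: complex_eq_iff)
  have eqs: "norm (Complex \<alpha> 0) = \<alpha>" "norm (Complex (1 + \<alpha>) 0) = 1 + \<alpha>"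
    using assms unfolding c0 norm_of_real by auto
  have inv: "1 \<le> 1 / \<alpha>" using assms by simp
  have "i + 2 * (1 + \<alpha>) \<le> 5 * i" if "1 \<le> i" for i
    using assms that by (simp add: algebra_simps)
  from this[OF inv] have "ln (1 / \<alpha> + 2 * (1 + \<alpha>)) \<le> ln (5 * (1 / \<alpha>))"
    using assms by (intro ln_mono) (auto intro: add_pos_pos)
  also have "\<dots> = ln 5 + ln (1 / \<alpha>)" using assms by (simp add: ln_mult ln_div)
  finally show "prime_sum \<alpha> (\<lambda>_. 1) \<le> ln (1 / \<alpha>) + (ln 5 + euler_error)"
    using prime_sum_cos_le[of \<alpha> 0] assms unfolding eqs by simp
  have zsum: "summable (\<lambda>n. real n powr (-1 - \<alpha>))" by (rule summable_powr_below) fact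
  have z_eq: "Z = (\<Sum>n. real n powr (-1 - \<alpha>))"
  proof -
    have "(of_nat n powr (- Complex (1 + \<alpha>) 0) :: complex) = of_real (real n powr (-1 - \<alpha>))" for n
      by (cases "n = 0") (simp_all add: powr_vertical)
    then have "Z = norm (complex_of_real (\<Sum>n. real n powr (-1 - \<alpha>)))"
      unfolding Z_def by (simp add: suminf_of_real[OF zsum])
    then show ?thesis by (simp add: suminf_nonneg[OF zsum])
  qed
  have Z1: "1 \<le> Z"
    unfolding z_eq using sum_le_suminf[OF zsum, of "{1}"] by simp
  have "1 / \<alpha> - 4 \<le> Z"
  proof -
    have eq: "Complex (1 + \<alpha>) 0 - 1 = of_real \<alpha>" by (simp add: complex_eq_iff)
    have "norm ((\<Sum>n. of_nat n powr (- Complex (1 + \<alpha>) 0)) - 1 / of_real \<alpha> :: complex) \<le> 2 * (1 + \<alpha>)"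
      using zeta_near_pole[of "Complex (1 + \<alpha>) 0"] assms unfolding eq eqs by simp
    moreover have "norm (1 / of_real \<alpha> :: complex) - Z \<le> norm ((\<Sum>n. of_nat n powr (- Complex (1 + \<alpha>) 0)) - 1 / of_real \<alpha> :: complex)"
      unfolding Z_def by (metis norm_minus_commute norm_triangle_ineq2)
    moreover have "norm (1 / of_real \<alpha> :: complex) = 1 / \<alpha>" using assms by (simp add: norm_divide)
    moreover have "2 * (1 + \<alpha>) \<le> 4" using assms by simp
    ultimately show ?thesis by linarith
  qed
  then have "1 / (5 * \<alpha>) \<le> Z"
  proof (cases "\<alpha> \<le> 1 / 5")
    case True
    then have "5 \<le> 1 / \<alpha>" using assms by (simp add: field_simps)
    moreover have "1 / (5 * \<alpha>) = 1 / \<alpha> / 5" by simp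
    ultimately show ?thesis using \<open>1 / \<alpha> - 4 \<le> Z\<close> by linarith
  next
    case False
    then have "1 / (5 * \<alpha>) \<le> 1" using assms by (simp add: field_simps)
    then show ?thesis using Z1 by linarith
  qed
  also have "Z \<le> exp (prime_sum \<alpha> (\<lambda>_. 1) + euler_error)"
    using dirichlet_series_vs_prime_sum(1)[of \<alpha> "\<lambda>_. 1" 0] assms unfolding Z_def by simp
  finally have *: "1 / (5 * \<alpha>) \<le> exp (prime_sum \<alpha> (\<lambda>_. 1) + euler_error)" .
  have "ln (1 / (5 * \<alpha>)) \<le> prime_sum \<alpha> (\<lambda>_. 1) + euler_error"
    using ln_mono[OF *] assms by simp
  then show "ln (1 / \<alpha>) - (ln 5 + euler_error) \<le> prime_sum \<alpha> (\<lambda>_. 1)"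
    using assms by (simp add: ln_div ln_mult)
qed

text \<open>The primes up to \<open>exp (1/\<alpha>)\<close>; indexing them by \<open>\<alpha>\<close> keeps the
  cutoff in step with the Dirichlet series at \<open>1 + \<alpha>\<close>.\<close>
definition primes_upto :: "real \<Rightarrow> nat set" where
  "primes_upto \<alpha> = {p. prime p \<and> \<alpha> * ln (real p) \<le> 1}"

definition recip_upto :: "nat set \<Rightarrow> real \<Rightarrow> real" where
  "recip_upto Q \<alpha> = (\<Sum>p\<in>primes_upto \<alpha> \<inter> Q. 1 / real p)"

lemma finite_primes_upto: "\<alpha> > 0 \<Longrightarrow> finite (primes_upto \<alpha>)"
proof (rule finite_subset)
  assume "\<alpha> > 0"
  show "primes_upto \<alpha> \<subseteq> {..nat \<lfloor>exp (1 / \<alpha>)\<rfloor>}"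
  proof
    fix p assume p: "p \<in> primes_upto \<alpha>"
    then have "ln (real p) \<le> 1 / \<alpha>" using \<open>\<alpha> > 0\<close> by (simp add: primes_upto_def field_simps)
    moreover have "p > 0" using p by (auto simp: primes_upto_def prime_gt_0_nat)
    ultimately have "real p \<le> exp (1 / \<alpha>)" by (subst (asm) exp_le_cancel_iff[symmetric]) simp
    then show "p \<in> {..nat \<lfloor>exp (1 / \<alpha>)\<rfloor>}" by (simp add: le_nat_floor)
  qed
qed simp

text \<open>On this range \<open>p powr (- \<alpha>)\<close> is at least \<open>exp (- 1)\<close>, so the
  convergent sum over all prime powers dominates.\<close>
lemma sum_ln_over_primes:
  assumes "0 < \<alpha>" "\<alpha> \<le> 1"
  shows "(\<Sum>p\<in>primes_upto \<alpha>. ln (real p) / real p) \<le> 108 / \<alpha>"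
proof -
  have "(\<Sum>p\<in>primes_upto \<alpha>. ln (real p) / real p) \<le> (\<Sum>p\<in>primes_upto \<alpha>. 3 * (mangoldt p * real p powr (-1 - \<alpha>)))"
  proof (rule sum_mono)
    fix p assume "p \<in> primes_upto \<alpha>"
    then have p: "prime p" "\<alpha> * ln (real p) \<le> 1" "p > 0" by (auto simp: primes_upto_def prime_gt_0_nat)
    have "real p powr (-1 - \<alpha>) = exp (- (\<alpha> * ln (real p))) / real p"
      using p(3) by (simp add: powr_def left_diff_distrib exp_diff exp_minus inverse_eq_divide)
    moreover have "1 / 3 \<le> exp (- (\<alpha> * ln (real p)))"
    proof -
      have "exp (-1) \<le> exp (- (\<alpha> * ln (real p)))" using p by simp
      moreover have "1 / 3 \<le> exp (-1 :: real)" using exp_le by (simp add: exp_minus field_simps)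
      ultimately show ?thesis by linarith
    qed
    ultimately have "1 / real p \<le> 3 * real p powr (-1 - \<alpha>)"
      using p(3) by (simp add: field_simps)
    moreover have "0 \<le> ln (real p)" using p(3) by simp
    ultimately have "ln (real p) * (1 / real p) \<le> ln (real p) * (3 * real p powr (-1 - \<alpha>))"
      by (intro mult_left_mono)
    then show "ln (real p) / real p \<le> 3 * (mangoldt p * real p powr (-1 - \<alpha>))" using p(1) by simp
  qed
  also have "\<dots> = 3 * (\<Sum>p\<in>primes_upto \<alpha>. mangoldt p * real p powr (-1 - \<alpha>))" by (simp add: sum_distrib_left)
  also have "(\<Sum>p\<in>primes_upto \<alpha>. mangoldt p * real p powr (-1 - \<alpha>)) \<le> (\<Sum>n. mangoldt n * real n powr (-1 - \<alpha>))"
    using assms by (intro sum_le_suminf mangoldt_powr_sum finite_primes_upto) (auto simp: mangoldt_nonneg)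
  also have "\<dots> \<le> 36 / \<alpha>" by (rule mangoldt_powr_sum) fact+
  finally show ?thesis by simp
qed

text \<open>Removing the factor \<open>p powr (- \<alpha>)\<close> costs \<open>\<alpha> ln p / p\<close> per
  prime, which adds up to \<open>O(1)\<close> over the primes up to \<open>exp (1/\<alpha>)\<close>.\<close>
lemma recip_upto_vs_prime_sum:
  assumes "0 < \<alpha>" "\<alpha> \<le> 1" and T: "T \<subseteq> primes_upto \<alpha>"
  shows "(\<Sum>p\<in>T. 1 / real p) - 108 \<le> (\<Sum>p\<in>T. real p powr (-1 - \<alpha>))"
proof -
  have fin: "finite T" using T finite_primes_upto[OF assms(1)] finite_subset by blast
  have "(\<Sum>p\<in>T. 1 / real p - real p powr (-1 - \<alpha>)) \<le> (\<Sum>p\<in>T. \<alpha> * (ln (real p) / real p))"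
  proof (rule sum_mono)
    fix p assume "p \<in> T"
    then have p: "p > 0" using T by (auto simp: primes_upto_def prime_gt_0_nat)
    have "real p powr (-1 - \<alpha>) = exp (- (\<alpha> * ln (real p))) / real p"
      using p by (simp add: powr_def left_diff_distrib exp_diff exp_minus inverse_eq_divide)
    moreover have "1 - \<alpha> * ln (real p) \<le> exp (- (\<alpha> * ln (real p)))"
      using exp_ge_add_one_self[of "- (\<alpha> * ln (real p))"] by simp
    ultimately show "1 / real p - real p powr (-1 - \<alpha>) \<le> \<alpha> * (ln (real p) / real p)"
      using divide_right_mono[of "1 - exp (- (\<alpha> * ln (real p)))" "\<alpha> * ln (real p)" "real p"] p
      by (simp add: diff_divide_distrib)
  qed
  also have "\<dots> = \<alpha> * (\<Sum>p\<in>T. ln (real p) / real p)" by (simp add: sum_distrib_left)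
  also have "(\<Sum>p\<in>T. ln (real p) / real p) \<le> (\<Sum>p\<in>primes_upto \<alpha>. ln (real p) / real p)"
    using T assms(1) by (intro sum_mono2 finite_primes_upto)
      (auto simp: primes_upto_def prime_gt_0_nat Suc_le_eq intro!: divide_nonneg_nonneg ln_ge_zero)
  then have "\<alpha> * (\<Sum>p\<in>T. ln (real p) / real p) \<le> \<alpha> * (108 / \<alpha>)"
    using sum_ln_over_primes[OF assms(1,2)] assms(1) by (intro mult_left_mono) auto
  finally show ?thesis using assms(1) by (simp add: sum_subtractf)
qed

text \<open>Beyond \<open>exp (1/\<alpha>)\<close> one has \<open>1 \<le> \<alpha> ln p\<close>, and
  \<open>\<alpha>\<close> cancels the pole of the sum with weights \<open>\<Lambda>\<close>.\<close>
lemma prime_sum_tail: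
  assumes "0 < \<alpha>" "\<alpha> \<le> 1"
  shows "prime_sum \<alpha> (\<lambda>_. 1) - 36 \<le> (\<Sum>p\<in>primes_upto \<alpha>. real p powr (-1 - \<alpha>))"
proof -
  let ?c = "\<lambda>p. if p \<in> primes_upto \<alpha> then 1 else 0 :: real"
  have "prime_sum \<alpha> (\<lambda>_. 1) - (\<Sum>p\<in>primes_upto \<alpha>. 1 * real p powr (-1 - \<alpha>)) = prime_sum \<alpha> (\<lambda>_. 1) - prime_sum \<alpha> ?c"
    using assms by (subst prime_sum_finite[OF finite_primes_upto]) (auto simp: primes_upto_def)
  also have "\<dots> = prime_sum \<alpha> (\<lambda>p. 1 - ?c p)"
    using assms by (intro prime_sum_diff[symmetric, of _ _ 1 _ 1]) auto
  also have "\<dots> \<le> (\<Sum>n. \<alpha> * (mangoldt n * real n powr (-1 - \<alpha>)))"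
    unfolding prime_sum_def
  proof (rule suminf_le)
    fix n :: nat
    show "(if prime n then (1 - ?c n) * real n powr (-1 - \<alpha>) else 0) \<le> \<alpha> * (mangoldt n * real n powr (-1 - \<alpha>))"
    proof (cases "prime n \<and> n \<notin> primes_upto \<alpha>")
      case True
      then have "1 \<le> \<alpha> * ln (real n)" by (auto simp: primes_upto_def)
      from mult_right_mono[OF this, of "real n powr (-1 - \<alpha>)"]
      show ?thesis using True by (simp add: mult.assoc)
    next
      case False
      then have "(if prime n then (1 - ?c n) * real n powr (-1 - \<alpha>) else 0) = 0" by auto
      also have "\<dots> \<le> \<alpha> * (mangoldt n * real n powr (-1 - \<alpha>))"
        using assms by (intro mult_nonneg_nonneg mangoldt_nonneg) auto
      finally show ?thesis .
    qed
  qed (use assms in \<open>auto intro!: summable_mult mangoldt_powr_sum summable_prime_sum[of _ _ 1]\<close>)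
  also have "\<dots> = \<alpha> * (\<Sum>n. mangoldt n * real n powr (-1 - \<alpha>))"
    by (rule suminf_mult) (rule mangoldt_powr_sum[OF assms])
  also have "\<dots> \<le> \<alpha> * (36 / \<alpha>)" using assms by (intro mult_left_mono mangoldt_powr_sum) auto
  finally show ?thesis using assms by simp
qed

lemma ln_prime_upto_nonneg: "p \<in> primes_upto \<alpha> \<Longrightarrow> 0 \<le> ln (real p)"
  by (auto simp: primes_upto_def prime_gt_0_nat Suc_le_eq intro!: ln_ge_zero)

lemma primes_upto_antimono:
  assumes "\<alpha> \<le> m"
  shows "primes_upto m \<subseteq> primes_upto \<alpha>"
proof
  fix p assume p: "p \<in> primes_upto m"
  then have "\<alpha> * ln (real p) \<le> m * ln (real p)"
    using assms ln_prime_upto_nonneg[OF p] by (intro mult_right_mono) auto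
  then show "p \<in> primes_upto \<alpha>" using p by (auto simp: primes_upto_def)
qed

definition mertens_error :: real where
  "mertens_error = 2 * (ln 5 + euler_error) + 144"

text \<open>Mertens' second theorem between \<open>exp (1/m)\<close> and \<open>exp (1/\<alpha>)\<close>. The
  constant in front of the logarithm must be \<open>1\<close>, since it enters the final exponent; comparing
  both ends with \<open>ln \<zeta>(1 + \<alpha>)\<close> and \<open>ln \<zeta>(1 + m)\<close> gives this, which
  Chebyshev's bound alone would not.\<close>
lemma recip_upto_diff_le:
  assumes "0 < \<alpha>" "\<alpha> \<le> m" "m \<le> 1"
  shows "recip_upto Q \<alpha> - recip_upto Q m \<le> ln (m / \<alpha>) + mertens_error"
proof -
  have fin: "finite (primes_upto \<alpha>)" using assms by (intro finite_primes_upto) auto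
  have sub: "primes_upto m \<subseteq> primes_upto \<alpha>" using assms by (intro primes_upto_antimono)
  have "recip_upto Q \<alpha> - recip_upto Q m = (\<Sum>p\<in>primes_upto \<alpha> \<inter> Q - primes_upto m \<inter> Q. 1 / real p)"
    unfolding recip_upto_def using sub fin by (intro sum_diff[symmetric]) auto
  also have "\<dots> \<le> (\<Sum>p\<in>primes_upto \<alpha> - primes_upto m. 1 / real p)"
    using fin by (intro sum_mono2) auto
  also have "\<dots> = (\<Sum>p\<in>primes_upto \<alpha>. 1 / real p) - (\<Sum>p\<in>primes_upto m. 1 / real p)"
    using sub fin by (intro sum_diff) auto
  also have "(\<Sum>p\<in>primes_upto \<alpha>. 1 / real p) \<le> ln (1 / \<alpha>) + (ln 5 + euler_error) + 108"
  proof -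
    have "(\<Sum>p\<in>primes_upto \<alpha>. 1 / real p) - 108 \<le> (\<Sum>p\<in>primes_upto \<alpha>. 1 * real p powr (-1 - \<alpha>))"
      using recip_upto_vs_prime_sum[of \<alpha> "primes_upto \<alpha>"] assms by simp
    also have "\<dots> = prime_sum \<alpha> (\<lambda>p. if p \<in> primes_upto \<alpha> then 1 else 0)"
      using fin by (intro prime_sum_finite[symmetric]) (auto simp: primes_upto_def)
    also have "\<dots> \<le> prime_sum \<alpha> (\<lambda>_. 1)"
      using assms by (intro prime_sum_mono[of _ _ 1 _ 1]) auto
    also have "\<dots> \<le> ln (1 / \<alpha>) + (ln 5 + euler_error)" using assms by (intro prime_sum_one) auto
    finally show ?thesis by simp
  qed
  also have "ln (1 / \<alpha>) + (ln 5 + euler_error) + 108 - (\<Sum>p\<in>primes_upto m. 1 / real p)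
      \<le> ln (1 / \<alpha>) + (ln 5 + euler_error) + 108 - (ln (1 / m) - (ln 5 + euler_error) - 36)"
  proof (rule diff_left_mono)
    show "(\<Sum>p\<in>primes_upto m. 1 / real p) \<ge> ln (1 / m) - (ln 5 + euler_error) - 36"
    proof -
    have "ln (1 / m) - (ln 5 + euler_error) - 36 \<le> prime_sum m (\<lambda>_. 1) - 36"
      using assms by (intro diff_right_mono prime_sum_one) auto
    also have "\<dots> \<le> (\<Sum>p\<in>primes_upto m. real p powr (-1 - m))" using assms by (intro prime_sum_tail) auto
    also have "\<dots> \<le> (\<Sum>p\<in>primes_upto m. 1 / real p)"
      using assms by (intro sum_mono powr_minus_le_inverse) auto
    finally show ?thesis .
  qed
  qed
  finally show ?thesis
    using assms by (simp add: mertens_error_def ln_div)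
qed

lemma recip_upto_le:
  assumes "0 < \<alpha>" "\<alpha> \<le> 1"
  shows "recip_upto Q \<alpha> \<le> ln (1 / \<alpha>) + mertens_error + 1"
proof -
  have "recip_upto Q 1 \<le> 1"
  proof -
    have "primes_upto 1 \<inter> Q \<subseteq> {2}"
    proof
      fix p assume p: "p \<in> primes_upto 1 \<inter> Q"
      then have "prime p" "ln (real p) \<le> 1" by (auto simp: primes_upto_def)
      then have "real p \<le> exp 1" using prime_gt_0_nat[of p] by (subst (asm) exp_le_cancel_iff[symmetric]) simp
      then have "real p < 4" using exp_le by linarith
      then have "p < 4" by simp
      moreover have "p \<noteq> 3"
      proof
        assume "p = 3"
        then have "3 \<le> exp (1::real)" using \<open>real p \<le> exp 1\<close> by simp
        then show False using e_less_272 by simp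
      qed
      ultimately show "p \<in> {2}" using prime_ge_2_nat[OF \<open>prime p\<close>] by auto
    qed
    then have "recip_upto Q 1 \<le> (\<Sum>p\<in>{2}. 1 / real p)" unfolding recip_upto_def by (intro sum_mono2) auto
    then show ?thesis by simp
  qed
  then show ?thesis using recip_upto_diff_le[of \<alpha> 1 Q] assms by simp
qed

text \<open>What the argument uses of \<open>f(n) = \<zeta> ^ \<Omega>(n)\<close>. The set \<open>Q\<close>
  plays the role of the primes outside \<open>P\<close>; the gap \<open>4/b\<close> is a lower bound for
  \<open>2 sin (\<pi>/b)\<close>, the least distance between \<open>1\<close> and another \<open>b\<close>-th
  root of unity.\<close>
locale root_valued =
  fixes f :: "nat \<Rightarrow> complex" and Q :: "nat set" and b :: nat
  assumes b_ge_2: "b \<ge> 2"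
    and f_one: "f 1 = 1"
    and f_mult: "\<And>m n. m > 0 \<Longrightarrow> n > 0 \<Longrightarrow> f (m * n) = f m * f n"
    and f_norm: "\<And>n. n > 0 \<Longrightarrow> norm (f n) = 1"
    and f_root: "\<And>p. prime p \<Longrightarrow> f p ^ b = 1"
    and f_gap: "\<And>p. prime p \<Longrightarrow> p \<in> Q \<Longrightarrow> 4 / real b \<le> norm (1 - f p)"
begin

text \<open>The exponent of all savings. It is the loss in \<open>one_minus_Re_power_le\<close>, where passing
  to \<open>b\<close>-th powers multiplies distances by at most \<open>b\<close> and hence their squares by
  \<open>b\<^sup>2\<close>.\<close>
definition \<kappa> :: real where "\<kappa> = 1 / (real b)\<^sup>2"

lemma \<kappa>_bounds: "0 < \<kappa>" "\<kappa> \<le> 1 / 4"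
proof -
  have "2 ^ 2 \<le> (real b)\<^sup>2" using b_ge_2 by (intro power_mono) auto
  then show "\<kappa> \<le> 1 / 4" unfolding \<kappa>_def by (simp add: divide_simps)
qed (use b_ge_2 in \<open>simp add: \<kappa>_def\<close>)

lemma one_minus_Re_eq:
  assumes "norm z = 1"
  shows "1 - Re z = (norm (1 - z))\<^sup>2 / 2"
  using assms cmod_power2[of z] unfolding cmod_power2[of "1 - z"]
  by (simp add: power2_eq_square algebra_simps)

lemma one_minus_Re_power_le:
  assumes "norm z = 1"
  shows "\<kappa> * (1 - Re (z ^ b)) \<le> 1 - Re z"
proof -
  have "norm (1 ^ b - z ^ b) \<le> real b * norm (1 - z)"
    using assms by (intro norm_power_diff) auto
  then have "(norm (1 - z ^ b))\<^sup>2 \<le> (real b)\<^sup>2 * (norm (1 - z))\<^sup>2"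
    using power_mono[of "norm (1 - z ^ b)" "real b * norm (1 - z)" 2] by (simp add: power_mult_distrib)
  then show ?thesis
    using b_ge_2 assms unfolding one_minus_Re_eq[OF assms] \<kappa>_def
    by (subst one_minus_Re_eq) (simp_all add: norm_power field_simps)
qed

text \<open>One half of the squared distance between \<open>f(p)\<close> and \<open>p ^ (iy)\<close>: how far
  \<open>f\<close> fails to imitate \<open>n ^ (iy)\<close> at \<open>p\<close>.\<close>
definition defect :: "real \<Rightarrow> nat \<Rightarrow> real" where
  "defect y p = 1 - Re (f p * cis (- (y * ln (real p))))"

lemma norm_twist: "p > 0 \<Longrightarrow> norm (f p * cis (- (y * ln (real p)))) = 1"
  by (simp add: norm_mult f_norm)

lemma defect_bounds:
  assumes "prime p" shows "0 \<le> defect y p" "\<bar>defect y p\<bar> \<le> 2"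
proof -
  have "\<bar>Re (f p * cis (- (y * ln (real p))))\<bar> \<le> 1"
    using abs_Re_le_cmod[of "f p * cis (- (y * ln (real p)))"] norm_twist[OF prime_gt_0_nat[OF assms]]
    by (simp only:)
  then show "0 \<le> defect y p" "\<bar>defect y p\<bar> \<le> 2" unfolding defect_def by linarith+
qed

text \<open>Raising to the \<open>b\<close>-th power erases \<open>f\<close>, so that only the oscillation of
  \<open>p\<^sup>i\<^sup>b\<^sup>y\<close> is left.\<close>
lemma defect_ge_oscillation:
  assumes "prime p"
  shows "\<kappa> * (1 - cos (real b * y * ln (real p))) \<le> defect y p"
proof -
  have "(f p * cis (- (y * ln (real p)))) ^ b = cis (- (real b * y * ln (real p)))"
    unfolding power_mult_distrib f_root[OF assms] Complex.DeMoivre by (simp add: mult.assoc)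
  then have "Re ((f p * cis (- (y * ln (real p)))) ^ b) = cos (real b * y * ln (real p))" by simp
  then show ?thesis
    using one_minus_Re_power_le[OF norm_twist[OF prime_gt_0_nat[OF assms]], of y] unfolding defect_def by simp
qed

text \<open>While \<open>p ^ (iy)\<close> stays within \<open>1/b\<close> of \<open>1\<close>, the gap
  \<open>4/b\<close> shrinks to no less than \<open>3/b\<close>.\<close>
lemma defect_ge_gap:
  assumes "prime p" "p \<in> Q" "\<bar>real b * y\<bar> * ln (real p) \<le> 1"
  shows "\<kappa> \<le> defect y p"
proof -
  let ?c = "cis (- (y * ln (real p)))"
  have p: "real p \<ge> 1" using prime_ge_1_nat[OF assms(1)] by simp
  have "norm (1 - ?c) \<le> \<bar>y * ln (real p)\<bar>"
    using dist_exp_i_1[of "- (y * ln (real p))"] abs_sin_x_le_abs_x[of "y * ln (real p) / 2"]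
    by (simp add: cis_conv_exp norm_minus_commute)
  also have "\<dots> = \<bar>real b * y\<bar> * ln (real p) / real b"
    using p b_ge_2 by (simp add: abs_mult)
  also have "\<dots> \<le> 1 / real b" using assms(3) by (intro divide_right_mono) auto
  finally have 1: "norm (1 - ?c) \<le> 1 / real b" .
  have "norm (1 - f p) \<le> norm (1 - f p * ?c) + norm (f p * (1 - ?c))"
    using norm_triangle_ineq4[of "1 - f p * ?c" "f p * (1 - ?c)"] by (simp add: algebra_simps)
  also have "norm (f p * (1 - ?c)) \<le> 1 / real b"
    using 1 f_norm[OF prime_gt_0_nat[OF assms(1)]] by (simp add: norm_mult)
  finally have "3 / real b \<le> norm (1 - f p * ?c)"
    using f_gap[OF assms(1,2)] by (simp add: field_simps)
  then have "(3 / real b)\<^sup>2 \<le> (norm (1 - f p * ?c))\<^sup>2" by (intro power_mono) auto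
  then have "(3 / real b)\<^sup>2 / 2 \<le> defect y p"
    unfolding defect_def one_minus_Re_eq[OF norm_twist[OF prime_gt_0_nat[OF assms(1)]]] by simp
  moreover have "\<kappa> \<le> (3 / real b)\<^sup>2 / 2" 
    unfolding \<kappa>_def using divide_right_mono[of 1 "9 / 2" "(real b)\<^sup>2"] by (simp add: power_divide)
  ultimately show ?thesis by linarith
qed

definition defect_error :: real where
  "defect_error = 217 + ln 5 + 2 * euler_error + ln (7 * real b) + mertens_error"

text \<open>For \<open>u = b y\<close> of size at least \<open>1\<close> the oscillation bound at all primes is
  enough, as the zeta function is of size \<open>O(|u|)\<close> at \<open>1 + \<alpha> + iu\<close>. For smaller
  \<open>u\<close> the primes are split at \<open>exp (1/m)\<close> with \<open>m = max \<alpha> |u|\<close>,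
  the point from which \<open>p ^ (iu)\<close> begins to turn: below it the gap at the primes of
  \<open>Q\<close> is used, above it the oscillation. The latter yields \<open>ln (m/\<alpha>)\<close>, exactly
  what Mertens' theorem allows \<open>Q\<close> to contribute there.\<close>
lemma prime_sum_defect_ge:
  assumes \<alpha>: "0 < \<alpha>" "\<alpha> \<le> 1"
  shows "\<kappa> * (recip_upto Q \<alpha> - ln (1 + \<bar>y\<bar>) - defect_error) \<le> prime_sum \<alpha> (defect y)"
proof -
  define u where "u = real b * y"
  define c where "c = (\<lambda>p. 1 - cos (u * ln (real p)))"
  have c_bound: "0 \<le> c p" "\<bar>c p\<bar> \<le> 2" for p
    unfolding c_def using cos_ge_minus_one[of "u * ln (real p)"] cos_le_one[of "u * ln (real p)"] by linarith+
  have cos_bound: "\<bar>cos (u * ln (real p))\<bar> \<le> 1" for p by (rule abs_cos_le_one)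
  have b1: "1 \<le> real b" and ln7: "0 \<le> ln (7 :: real)" "ln 7 \<le> ln (7 * real b)"
    using b_ge_2 by (auto intro!: ln_mono)
  have c_sum: "ln (1 / \<alpha>) - (ln 5 + 2 * euler_error) - ln (1 / norm (Complex \<alpha> u) + 2 * norm (Complex (1 + \<alpha>) u))
      \<le> prime_sum \<alpha> c"
    unfolding c_def using prime_sum_one(1)[OF \<alpha>] prime_sum_cos_le[OF \<alpha>(1), of u]
    by (subst prime_sum_diff[OF \<alpha>(1), of _ 1 _ 1]) (auto simp: cos_bound)
  have norm_u: "\<bar>u\<bar> \<le> norm (Complex \<alpha> u)" "\<alpha> \<le> norm (Complex \<alpha> u)" "norm (Complex (1 + \<alpha>) u) \<le> 2 + \<bar>u\<bar>"
    using abs_Im_le_cmod[of "Complex \<alpha> u"] abs_Re_le_cmod[of "Complex \<alpha> u"] cmod_le[of "Complex (1 + \<alpha>) u"] \<alpha> by auto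
  show ?thesis
  proof (cases "1 \<le> \<bar>u\<bar>")
    case True
    have "1 / norm (Complex \<alpha> u) \<le> 1" using True norm_u(1) by (simp add: divide_simps)
    then have "1 / norm (Complex \<alpha> u) + 2 * norm (Complex (1 + \<alpha>) u) \<le> 7 * \<bar>u\<bar>"
      using True norm_u(3) by linarith
    also have "\<dots> \<le> (7 * real b) * (1 + \<bar>y\<bar>)" using b1 by (simp add: u_def abs_mult algebra_simps)
    finally have "ln (1 / norm (Complex \<alpha> u) + 2 * norm (Complex (1 + \<alpha>) u)) \<le> ln ((7 * real b) * (1 + \<bar>y\<bar>))"
      using \<alpha> norm_u by (intro ln_mono) (auto intro!: add_pos_nonneg)
    also have "\<dots> = ln (7 * real b) + ln (1 + \<bar>y\<bar>)" using b1 by (intro ln_mult_pos) auto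
    finally have "ln (1 / \<alpha>) - (ln 5 + 2 * euler_error) - (ln (7 * real b) + ln (1 + \<bar>y\<bar>)) \<le> prime_sum \<alpha> c"
      using c_sum by linarith
    then have "recip_upto Q \<alpha> - ln (1 + \<bar>y\<bar>) - defect_error \<le> prime_sum \<alpha> c"
      using recip_upto_le[OF \<alpha>, of Q] unfolding defect_error_def by linarith
    then have "\<kappa> * (recip_upto Q \<alpha> - ln (1 + \<bar>y\<bar>) - defect_error) \<le> \<kappa> * prime_sum \<alpha> c"
      using \<kappa>_bounds by (intro mult_left_mono) auto
    also have "\<dots> = prime_sum \<alpha> (\<lambda>p. \<kappa> * c p)"
      by (rule prime_sum_cmult[symmetric, OF \<alpha>(1), of _ 2]) (rule c_bound)
    also have "\<dots> \<le> prime_sum \<alpha> (defect y)"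
    proof (rule prime_sum_mono[OF \<alpha>(1), of _ 2 _ 2])
      show "\<bar>\<kappa> * c p\<bar> \<le> 2" for p
        using \<kappa>_bounds c_bound[of p] mult_mono[of \<kappa> 1 "c p" 2] by (simp add: abs_mult)
      show "\<kappa> * c p \<le> defect y p" if "prime p" for p
        using defect_ge_oscillation[OF that, of y] by (simp add: c_def u_def)
    qed (rule defect_bounds)
    finally show ?thesis .
  next
    case False
    define m where "m = max \<alpha> \<bar>u\<bar>"
    have m: "0 < m" "\<alpha> \<le> m" "m \<le> 1" "\<bar>u\<bar> \<le> m" using \<alpha> False by (auto simp: m_def)
    define T where "T = primes_upto m"
    have T: "finite T" "T \<subseteq> primes_upto \<alpha>" "\<And>p. p \<in> T \<Longrightarrow> prime p"
      unfolding T_def using m finite_primes_upto[of m] primes_upto_antimono[of \<alpha> m]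
      by (simp, simp, simp add: primes_upto_def)
    \<comment> \<open>The pointwise minorant of the defect, divided by \<open>\<kappa>\<close>: the gap on
      \<open>T\<close>, the oscillation off \<open>T\<close>. It is written as a difference so that the
      oscillation can be summed over all primes, where the zeta function controls it.\<close>
    define d where "d = (\<lambda>p. (if p \<in> T \<inter> Q then 1 else 0) - ((if p \<in> T then c p else 0) - c p))"
    have d_bound: "\<bar>d p\<bar> \<le> 3" for p using c_bound[of p] by (auto simp: d_def)
    have "1 / norm (Complex \<alpha> u) \<le> 1 / m" 
      using norm_u \<alpha> m(1) by (intro divide_left_mono mult_pos_pos) (auto simp: m_def)
    moreover have "6 \<le> 6 / m" using m by (simp add: field_simps)
    ultimately have "1 / norm (Complex \<alpha> u) + 2 * norm (Complex (1 + \<alpha>) u) \<le> 7 / m"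
      using norm_u(3) False by simp
    then have "ln (1 / norm (Complex \<alpha> u) + 2 * norm (Complex (1 + \<alpha>) u)) \<le> ln (7 / m)"
      using \<alpha> norm_u by (intro ln_mono) (auto intro!: add_pos_nonneg)
    also have "\<dots> = ln 7 - ln m" using m by (simp add: ln_div)
    finally have c_sum': "ln (m / \<alpha>) - (ln 5 + 2 * euler_error) - ln 7 \<le> prime_sum \<alpha> c"
      using c_sum m \<alpha> by (simp add: ln_div)
    have "(\<Sum>p\<in>T. c p * real p powr (-1 - \<alpha>)) \<le> (\<Sum>p\<in>T. m * (ln (real p) / real p))"
    proof (rule sum_mono)
      fix p assume p: "p \<in> T"
      have ln: "0 \<le> ln (real p)" using p unfolding T_def by (rule ln_prime_upto_nonneg)
      have "c p = 2 * (sin (u * ln (real p) / 2))\<^sup>2"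
        using cos_double_sin[of "u * ln (real p) / 2"] by (simp add: c_def)
      also have "\<dots> \<le> 2 * \<bar>sin (u * ln (real p) / 2)\<bar>"
        using mult_left_mono[of "\<bar>sin (u * ln (real p) / 2)\<bar>" 1 "\<bar>sin (u * ln (real p) / 2)\<bar>"]
        by (simp add: power2_eq_square flip: abs_mult)
      also have "\<dots> \<le> \<bar>u\<bar> * ln (real p)"
        using abs_sin_x_le_abs_x[of "u * ln (real p) / 2"] ln by (simp add: abs_mult)
      also have "\<dots> \<le> m * ln (real p)" using m ln by (intro mult_right_mono)
      finally have "c p * real p powr (-1 - \<alpha>) \<le> m * ln (real p) * (1 / real p)"
        using powr_minus_le_inverse[of \<alpha> p] c_bound m ln \<alpha> by (intro mult_mono) auto
      then show "c p * real p powr (-1 - \<alpha>) \<le> m * (ln (real p) / real p)" by simp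
    qed
    also have "\<dots> = m * (\<Sum>p\<in>T. ln (real p) / real p)" by (simp add: sum_distrib_left)
    also have "\<dots> \<le> m * (108 / m)"
      unfolding T_def using m by (intro mult_left_mono sum_ln_over_primes) auto
    finally have sum_T: "(\<Sum>p\<in>T. c p * real p powr (-1 - \<alpha>)) \<le> 108" using m by simp
    have sum_TQ: "recip_upto Q m - 108 \<le> (\<Sum>p\<in>T \<inter> Q. real p powr (-1 - \<alpha>))"
      unfolding recip_upto_def T_def[symmetric] using T by (intro recip_upto_vs_prime_sum[OF \<alpha>]) auto
    have "prime_sum \<alpha> d = (\<Sum>p\<in>T \<inter> Q. 1 * real p powr (-1 - \<alpha>))
        - ((\<Sum>p\<in>T. c p * real p powr (-1 - \<alpha>)) - prime_sum \<alpha> c)"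
    proof -
      have "prime_sum \<alpha> d = prime_sum \<alpha> (\<lambda>p. if p \<in> T \<inter> Q then 1 else 0) - prime_sum \<alpha> (\<lambda>p. (if p \<in> T then c p else 0) - c p)"
        unfolding d_def using c_bound by (intro prime_sum_diff[OF \<alpha>(1), of _ 1 _ 2]) auto
      also have "prime_sum \<alpha> (\<lambda>p. (if p \<in> T then c p else 0) - c p) = prime_sum \<alpha> (\<lambda>p. if p \<in> T then c p else 0) - prime_sum \<alpha> c"
        using c_bound by (intro prime_sum_diff[OF \<alpha>(1), of _ 2 _ 2]) auto
      also have "prime_sum \<alpha> (\<lambda>p. if p \<in> T then c p else 0) = (\<Sum>p\<in>T. c p * real p powr (-1 - \<alpha>))"
        using T by (intro prime_sum_finite)
      also have "prime_sum \<alpha> (\<lambda>p. if p \<in> T \<inter> Q then 1 else 0) = (\<Sum>p\<in>T \<inter> Q. 1 * real p powr (-1 - \<alpha>))"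
        using T by (intro prime_sum_finite) auto
      finally show ?thesis .
    qed
    then have "recip_upto Q \<alpha> - defect_error \<le> prime_sum \<alpha> d"
      using sum_TQ sum_T c_sum' recip_upto_diff_le[OF \<alpha>(1) m(2,3), of Q] ln7 unfolding defect_error_def
      by simp
    moreover have "0 \<le> ln (1 + \<bar>y\<bar>)" by simp
    ultimately have "recip_upto Q \<alpha> - ln (1 + \<bar>y\<bar>) - defect_error \<le> prime_sum \<alpha> d" by linarith
    then have "\<kappa> * (recip_upto Q \<alpha> - ln (1 + \<bar>y\<bar>) - defect_error) \<le> \<kappa> * prime_sum \<alpha> d"
      using \<kappa>_bounds by (intro mult_left_mono) auto
    also have "\<dots> = prime_sum \<alpha> (\<lambda>p. \<kappa> * d p)"
      by (rule prime_sum_cmult[symmetric, OF \<alpha>(1), of _ 3]) (rule d_bound)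
    also have "\<dots> \<le> prime_sum \<alpha> (defect y)"
    proof (rule prime_sum_mono[OF \<alpha>(1), of _ 3 _ 2])
      show "\<bar>\<kappa> * d p\<bar> \<le> 3" for p
        using \<kappa>_bounds d_bound[of p] mult_mono[of \<kappa> 1 "\<bar>d p\<bar>" 3] by (simp add: abs_mult)
      show "\<kappa> * d p \<le> defect y p" if p: "prime p" for p
      proof (cases "p \<in> T")
        case True
        have "\<bar>real b * y\<bar> * ln (real p) \<le> m * ln (real p)"
          using m(4) ln_prime_upto_nonneg[of p m] True by (intro mult_right_mono) (auto simp: T_def u_def)
        also have "\<dots> \<le> 1" using True by (simp add: T_def primes_upto_def)
        finally have "p \<in> Q \<Longrightarrow> \<kappa> \<le> defect y p" by (intro defect_ge_gap[OF p])
        then show ?thesis using True defect_bounds[OF p, of y] by (auto simp: d_def)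
      next
        case False
        then show ?thesis using defect_ge_oscillation[OF p, of y] by (simp add: d_def c_def u_def)
      qed
    qed (rule defect_bounds)
    finally show ?thesis .
  qed
qed

abbreviation dseries :: "real \<Rightarrow> real \<Rightarrow> complex" where
  "dseries \<alpha> y \<equiv> (\<Sum>n. f n * of_nat n powr (- Complex (1 + \<alpha>) y))"

lemma norm_dseries_le:
  obtains C where "C > 0" and
    "\<And>\<alpha> y. 0 < \<alpha> \<Longrightarrow> \<alpha> \<le> 1 \<Longrightarrow>
       norm (dseries \<alpha> y) \<le> C / \<alpha> * exp (- \<kappa> * recip_upto Q \<alpha>) * (1 + \<bar>y\<bar>) powr \<kappa>"
proof (rule that)
  define C where "C = exp (ln 5 + 2 * euler_error + \<kappa> * defect_error)"
  show "C > 0" by (simp add: C_def)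
  fix \<alpha> y :: real assume \<alpha>: "0 < \<alpha>" "\<alpha> \<le> 1"
  have "norm (dseries \<alpha> y) \<le> exp (prime_sum \<alpha> (\<lambda>p. Re (f p * cis (- (y * ln (real p))))) + euler_error)"
    by (rule dirichlet_series_vs_prime_sum(1)[OF \<alpha>(1) f_one f_norm f_mult])
  also have "prime_sum \<alpha> (\<lambda>p. Re (f p * cis (- (y * ln (real p))))) = prime_sum \<alpha> (\<lambda>p. 1 - defect y p)"
    by (simp add: defect_def)
  also have "\<dots> = prime_sum \<alpha> (\<lambda>_. 1) - prime_sum \<alpha> (defect y)"
    by (rule prime_sum_diff[OF \<alpha>(1), of _ 1 _ 2]) (auto intro: defect_bounds)
  also have "exp (prime_sum \<alpha> (\<lambda>_. 1) - prime_sum \<alpha> (defect y) + euler_error)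
      \<le> exp (ln 5 + 2 * euler_error + \<kappa> * defect_error + ln (1 / \<alpha>) + - \<kappa> * recip_upto Q \<alpha> + \<kappa> * ln (1 + \<bar>y\<bar>))"
    using prime_sum_one(2)[OF \<alpha>] prime_sum_defect_ge[OF \<alpha>, of y]
    by (simp add: algebra_simps)
  also have "\<dots> = C * exp (ln (1 / \<alpha>)) * exp (- \<kappa> * recip_upto Q \<alpha>) * exp (\<kappa> * ln (1 + \<bar>y\<bar>))"
    by (simp only: exp_add C_def)
  also have "\<dots> = C / \<alpha> * exp (- \<kappa> * recip_upto Q \<alpha>) * (1 + \<bar>y\<bar>) powr \<kappa>"
    using \<alpha> by (simp add: powr_def)
  finally show "norm (dseries \<alpha> y) \<le> C / \<alpha> * exp (- \<kappa> * recip_upto Q \<alpha>) * (1 + \<bar>y\<bar>) powr \<kappa>" .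
qed

end

section \<open>The Poisson kernel and Plancherel's inequality\<close>

text \<open>The open half-line matches the interval integral. The closed one is what an integer \<open>n\<close>
  contributes to the partial sums over \<open>n \<le> exp v\<close>, as a function of \<open>v\<close>. Both
  occur when the line is cut at \<open>0\<close>.\<close>
lemma integral_exp_halfline_open:
  fixes s :: complex
  assumes "Re s > 0"
  shows "has_bochner_integral lborel (\<lambda>v. indicator {a<..} v *\<^sub>R exp (- (s * of_real v))) (exp (- (s * of_real a)) / s)"
proof -
  define r where "r = Re s"
  have r: "r > 0" using assms by (simp add: r_def)
  have nn: "(\<integral>\<^sup>+v. ennreal (exp (- (r * v))) * indicator {a..} v \<partial>lborel) = ennreal (0 - (- exp (- (r * a)) / r))"
  proof (rule nn_integral_FTC_atLeast)
    show "((\<lambda>x. - exp (- (r * x)) / r) \<longlongrightarrow> 0) at_top" using r by real_asymp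
    show "DERIV (\<lambda>x. - exp (- (r * x)) / r) x :> exp (- (r * x))" for x
      using r by (auto intro!: derivative_eq_intros)
  qed auto
  have int: "integrable lborel (\<lambda>v. indicator {a<..} v *\<^sub>R exp (- (s * of_real v)))"
  proof (rule integrableI_bounded)
    show "(\<lambda>v. indicator {a<..} v *\<^sub>R exp (- (s * of_real v))) \<in> borel_measurable lborel"
      by measurable
    have "(\<integral>\<^sup>+v. ennreal (norm (indicator {a<..} v *\<^sub>R exp (- (s * of_real v)))) \<partial>lborel)
        \<le> (\<integral>\<^sup>+v. ennreal (exp (- (r * v))) * indicator {a..} v \<partial>lborel)"
      by (intro nn_integral_mono) (auto simp: indicator_def r_def)
    also have "\<dots> < \<infinity>" unfolding nn by simp
    finally show "(\<integral>\<^sup>+v. ennreal (norm (indicator {a<..} v *\<^sub>R exp (- (s * of_real v)))) \<partial>lborel) < \<infinity>" .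
  qed
  have s0: "s \<noteq> 0" using assms by auto
  have "(LBINT v=ereal a..\<infinity>. exp (- (s * of_real v))) = 0 - (- exp (- (s * of_real a)) / s)"
  proof (rule interval_integral_FTC_integrable)
    show "((\<lambda>v. - exp (- (s * of_real v)) / s) has_vector_derivative exp (- (s * of_real x))) (at x)" for x
    proof -
      have "((\<lambda>z. - exp (- (s * z)) / s) has_field_derivative exp (- (s * of_real x))) (at (of_real x))"
        using s0 by (auto intro!: derivative_eq_intros)
      from has_vector_derivative_real_field[OF this] show ?thesis .
    qed
    show "set_integrable lborel (einterval (ereal a) \<infinity>) (\<lambda>v. exp (- (s * of_real v)))"
      using int by (simp add: set_integrable_def einterval_def greaterThan_def)
    show "(((\<lambda>v. - exp (- (s * of_real v)) / s) \<circ> real_of_ereal) \<longlongrightarrow> - exp (- (s * of_real a)) / s) (at_right (ereal a))"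
      using s0 unfolding ereal_tendsto_simps by (intro tendsto_intros) auto
    have "((\<lambda>v. exp (- (r * v))) \<longlongrightarrow> 0) at_top" using r by real_asymp
    then have "((\<lambda>v. exp (- (s * of_real v))) \<longlongrightarrow> 0) at_top"
      by (subst tendsto_norm_zero_iff[symmetric]) (simp add: r_def)
    then show "(((\<lambda>v. - exp (- (s * of_real v)) / s) \<circ> real_of_ereal) \<longlongrightarrow> 0) (at_left \<infinity>)"
      unfolding ereal_tendsto_simps
      using tendsto_minus[OF tendsto_divide[OF _ tendsto_const s0]] by force
  qed (auto intro!: continuous_intros)
  then have "(\<integral>v. indicator {a<..} v *\<^sub>R exp (- (s * of_real v)) \<partial>lborel) = exp (- (s * of_real a)) / s"
    by (simp add: interval_lebesgue_integral_def set_lebesgue_integral_def einterval_def greaterThan_def)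
  then show ?thesis using int by (simp add: has_bochner_integral_iff)
qed

lemma integral_exp_halfline:
  fixes s :: complex
  assumes "Re s > 0"
  shows "has_bochner_integral lborel (\<lambda>v. indicator {a..} v *\<^sub>R exp (- (s * of_real v))) (exp (- (s * of_real a)) / s)"
proof -
  have "AE v in lborel. indicator {a<..} v *\<^sub>R exp (- (s * of_real v)) = indicator {a..} v *\<^sub>R exp (- (s * of_real v))"
    using AE_lborel_singleton[of a] by eventually_elim (auto simp: indicator_def)
  then show ?thesis
    using integral_exp_halfline_open[OF assms, of a]
    by (subst has_bochner_integral_cong_AE[symmetric]) auto
qed

text \<open>The Poisson kernel of width \<open>1/L\<close>, normalised as the Fourier transform of \<open>exp (-
  |y| / L)\<close>.\<close>
definition poisson :: "real \<Rightarrow> real \<Rightarrow> real" where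
  "poisson L v = 2 * L / (1 + L\<^sup>2 * v\<^sup>2)"

lemma poisson_measurable [measurable]: "poisson L \<in> borel_measurable borel"
  unfolding poisson_def by measurable

lemma poisson_nonneg: "L > 0 \<Longrightarrow> 0 \<le> poisson L v"
  by (simp add: poisson_def)

lemma fourier_laplace:
  assumes "L > 0"
  shows "has_bochner_integral lborel (\<lambda>y. of_real (exp (- \<bar>y\<bar> / L)) * cis (- (y * v))) (of_real (poisson L v) :: complex)"
proof -
  define s where "s = Complex (1 / L) v"
  have exp_eq: "exp (- (Complex (1 / L) t * of_real y)) = of_real (exp (- y / L)) * cis (- (y * t))" for t y
  proof -
    have "- (Complex (1 / L) t * of_real y) = of_real (- y / L) + \<i> * of_real (- (y * t))"
      by (simp add: complex_eq_iff)
    then show ?thesis unfolding cis_conv_exp by (simp only: exp_add exp_of_real)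
  qed
  have 1: "has_bochner_integral lborel (\<lambda>y. indicator {0..} y *\<^sub>R exp (- (s * of_real y))) (1 / s)"
    using integral_exp_halfline[of s 0] assms by (simp add: s_def)
  have "has_bochner_integral lborel (\<lambda>y. indicator {0<..} y *\<^sub>R exp (- (cnj s * of_real y))) (1 / cnj s)"
    using integral_exp_halfline_open[of "cnj s" 0] assms by (simp add: s_def)
  then have 2: "has_bochner_integral lborel (\<lambda>y. indicator {0<..} (- y) *\<^sub>R exp (- (cnj s * of_real (- y)))) (1 / cnj s)"
    using lborel_has_bochner_integral_real_affine_iff[of "-1" "\<lambda>y. indicator {0<..} y *\<^sub>R exp (- (cnj s * of_real y))" "1 / cnj s" 0]
    by simp
  have "has_bochner_integral lborel (\<lambda>y. indicator {0..} y *\<^sub>R exp (- (s * of_real y))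
      + indicator {0<..} (- y) *\<^sub>R exp (- (cnj s * of_real (- y)))) (1 / s + 1 / cnj s)"
    by (rule has_bochner_integral_add[OF 1 2])
  also have "(\<lambda>y. indicator {0..} y *\<^sub>R exp (- (s * of_real y))
      + indicator {0<..} (- y) *\<^sub>R exp (- (cnj s * of_real (- y)))) = (\<lambda>y. of_real (exp (- \<bar>y\<bar> / L)) * cis (- (y * v)))"
  proof
    fix y :: real
    have cnj: "cnj s = Complex (1 / L) (- v)" by (simp add: s_def complex_eq_iff)
    show "indicator {0..} y *\<^sub>R exp (- (s * of_real y)) + indicator {0<..} (- y) *\<^sub>R exp (- (cnj s * of_real (- y)))
       = of_real (exp (- \<bar>y\<bar> / L)) * cis (- (y * v))"
      unfolding cnj unfolding s_def exp_eq by (cases "y \<ge> 0") (auto simp: indicator_def)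
  qed
  also have "1 / s + 1 / cnj s = of_real (poisson L v)"
  proof -
    have "s \<noteq> 0" using assms by (auto simp: s_def complex_eq_iff)
    then have "1 / s + 1 / cnj s = (cnj s + s) / (s * cnj s)" by (simp add: field_simps)
    also have "\<dots> = of_real (2 * Re s / (norm s)\<^sup>2)"
      by (simp add: complex_add_cnj add.commute[of "cnj s"] complex_norm_square[symmetric])
    also have "2 * Re s / (norm s)\<^sup>2 = poisson L v"
      unfolding poisson_def cmod_power2 using assms by (simp add: s_def field_simps power2_eq_square)
    finally show ?thesis .
  qed
  finally show ?thesis .
qed

lemma cnj_borel_measurable [measurable]: "cnj \<in> borel_measurable borel"
  by (intro borel_measurable_continuous_onI continuous_intros)

lemma cis_borel_measurable [measurable]: "cis \<in> borel_measurable borel"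
  by (intro borel_measurable_continuous_onI continuous_intros)

lemma integrable_pair_mult:
  fixes f :: "'a \<Rightarrow> complex" and g :: "'b \<Rightarrow> complex"
  assumes "sigma_finite_measure M" "sigma_finite_measure N" and f: "integrable M f" and g: "integrable N g"
  shows "integrable (M \<Otimes>\<^sub>M N) (\<lambda>z. f (fst z) * g (snd z))"
    and "(\<integral>z. f (fst z) * g (snd z) \<partial>(M \<Otimes>\<^sub>M N)) = (\<integral>x. f x \<partial>M) * (\<integral>y. g y \<partial>N)"
proof -
  interpret M: sigma_finite_measure M by fact
  interpret N: sigma_finite_measure N by fact
  interpret P: pair_sigma_finite M N ..
  have [measurable]: "f \<in> borel_measurable M" "g \<in> borel_measurable N" using f g by auto
  show 1: "integrable (M \<Otimes>\<^sub>M N) (\<lambda>z. f (fst z) * g (snd z))"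
  proof (rule P.Fubini_integrable)
    show "integrable M (\<lambda>x. \<integral>y. norm (f (fst (x, y)) * g (snd (x, y))) \<partial>N)"
      using f by (simp add: norm_mult)
    show "AE x in M. integrable N (\<lambda>y. f (fst (x, y)) * g (snd (x, y)))" using g by simp
  qed measurable
  show "(\<integral>z. f (fst z) * g (snd z) \<partial>(M \<Otimes>\<^sub>M N)) = (\<integral>x. f x \<partial>M) * (\<integral>y. g y \<partial>N)"
    using P.integral_fst'[OF 1] by simp
qed

text \<open>The quadratic form of the Poisson kernel is the weighted mean square of a Fourier transform. With
  counting measure this governs Dirichlet series, with Lebesgue measure it leads to Plancherel's inequality.\<close>
lemma poisson_quadratic_form:
  fixes a :: "'a \<Rightarrow> complex" and \<phi> :: "'a \<Rightarrow> real"
  assumes M: "sigma_finite_measure M" and a: "integrable M a" and [measurable]: "\<phi> \<in> borel_measurable M" and L: "L > 0"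
  defines "A \<equiv> \<lambda>y. \<integral>x. a x * cis (- (y * \<phi> x)) \<partial>M"
  shows "integrable lborel (\<lambda>y. exp (- \<bar>y\<bar> / L) * (norm (A y))\<^sup>2)"
    and "integrable (M \<Otimes>\<^sub>M M) (\<lambda>z. a (fst z) * cnj (a (snd z)) * of_real (poisson L (\<phi> (fst z) - \<phi> (snd z))))"
    and "of_real (\<integral>y. exp (- \<bar>y\<bar> / L) * (norm (A y))\<^sup>2 \<partial>lborel)
        = (\<integral>z. a (fst z) * cnj (a (snd z)) * of_real (poisson L (\<phi> (fst z) - \<phi> (snd z))) \<partial>(M \<Otimes>\<^sub>M M))"
proof -
  interpret M: sigma_finite_measure M by fact
  interpret MM: pair_sigma_finite M M ..
  interpret N: sigma_finite_measure "M \<Otimes>\<^sub>M M" by (rule MM.P.sigma_finite_measure_axioms)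
  interpret R: pair_sigma_finite lborel "M \<Otimes>\<^sub>M M" ..
  have [measurable]: "a \<in> borel_measurable M" using a by auto
  define c where "c = (\<lambda>z. a (fst z) * cnj (a (snd z)))"
  define \<psi> where "\<psi> = (\<lambda>z. \<phi> (fst z) - \<phi> (snd z))"
  have [measurable]: "c \<in> borel_measurable (M \<Otimes>\<^sub>M M)" "\<psi> \<in> borel_measurable (M \<Otimes>\<^sub>M M)"
    unfolding c_def \<psi>_def by (measurable, measurable)
  have c_int: "integrable (M \<Otimes>\<^sub>M M) c"
    unfolding c_def using a by (intro integrable_pair_mult M) auto
  have int_y: "integrable M (\<lambda>x. a x * cis (- (y * \<phi> x)))" for y
    by (rule Bochner_Integration.integrable_bound[OF a]) (auto simp: norm_mult)
  have A_sq: "of_real ((norm (A y))\<^sup>2) = (\<integral>z. c z * cis (- (y * \<psi> z)) \<partial>(M \<Otimes>\<^sub>M M))" for y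
  proof -
    have "of_real ((norm (A y))\<^sup>2) = A y * cnj (A y)" by (rule complex_norm_square)
    also have "cnj (A y) = (\<integral>x. cnj (a x * cis (- (y * \<phi> x))) \<partial>M)" unfolding A_def
      by (rule integral_bounded_linear[OF bounded_linear_cnj int_y, symmetric])
    also have "A y * \<dots> = (\<integral>z. (a (fst z) * cis (- (y * \<phi> (fst z)))) * cnj (a (snd z) * cis (- (y * \<phi> (snd z)))) \<partial>(M \<Otimes>\<^sub>M M))"
      unfolding A_def
      by (intro integrable_pair_mult(2)[symmetric] M int_y integrable_bounded_linear[OF bounded_linear_cnj int_y])
    also have "(\<lambda>z. (a (fst z) * cis (- (y * \<phi> (fst z)))) * cnj (a (snd z) * cis (- (y * \<phi> (snd z))))) = (\<lambda>z. c z * cis (- (y * \<psi> z)))"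
    proof
      fix z
      have "cis (- (y * \<psi> z)) = cis (- (y * \<phi> (fst z))) * cis (y * \<phi> (snd z))"
        unfolding cis_mult \<psi>_def by (simp add: algebra_simps)
      then show "(a (fst z) * cis (- (y * \<phi> (fst z)))) * cnj (a (snd z) * cis (- (y * \<phi> (snd z)))) = c z * cis (- (y * \<psi> z))"
        by (simp add: c_def cis_cnj)
    qed
    finally show ?thesis .
  qed
  have w_int: "integrable lborel (\<lambda>y. of_real (exp (- \<bar>y\<bar> / L)) :: complex)"
    using fourier_laplace[OF L, of 0] by (simp add: has_bochner_integral_iff)
  have prod: "integrable (lborel \<Otimes>\<^sub>M (M \<Otimes>\<^sub>M M)) (\<lambda>(y, z). of_real (exp (- \<bar>y\<bar> / L)) * (c z * cis (- (y * \<psi> z))))"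
  proof (rule Bochner_Integration.integrable_bound)
    show "integrable (lborel \<Otimes>\<^sub>M (M \<Otimes>\<^sub>M M)) (\<lambda>p. of_real (exp (- \<bar>fst p\<bar> / L)) * c (snd p))"
      by (rule integrable_pair_mult[OF _ _ w_int c_int]) unfold_locales
  qed (auto simp: norm_mult split: prod.splits)
  have eq: "(\<integral>z. of_real (exp (- \<bar>y\<bar> / L)) * (c z * cis (- (y * \<psi> z))) \<partial>(M \<Otimes>\<^sub>M M)) = of_real (exp (- \<bar>y\<bar> / L) * (norm (A y))\<^sup>2)" for y
    unfolding of_real_mult A_sq by simp
  have "integrable lborel (\<lambda>y. of_real (exp (- \<bar>y\<bar> / L) * (norm (A y))\<^sup>2) :: complex)"
    using R.integrable_fst[OF prod] unfolding eq .
  from integrable_Re[OF this] show "integrable lborel (\<lambda>y. exp (- \<bar>y\<bar> / L) * (norm (A y))\<^sup>2)"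
    by simp
  have inner: "(\<integral>y. of_real (exp (- \<bar>y\<bar> / L)) * (c z * cis (- (y * \<psi> z))) \<partial>lborel) = c z * of_real (poisson L (\<psi> z))" for z
  proof -
    have "(\<integral>y. of_real (exp (- \<bar>y\<bar> / L)) * (c z * cis (- (y * \<psi> z))) \<partial>lborel)
        = (\<integral>y. c z * (of_real (exp (- \<bar>y\<bar> / L)) * cis (- (y * \<psi> z))) \<partial>lborel)" by (simp add: mult_ac)
    also have "\<dots> = c z * of_real (poisson L (\<psi> z))"
      using fourier_laplace[OF L, of "\<psi> z"] by (simp add: has_bochner_integral_iff)
    finally show ?thesis .
  qed
  show "integrable (M \<Otimes>\<^sub>M M) (\<lambda>z. a (fst z) * cnj (a (snd z)) * of_real (poisson L (\<phi> (fst z) - \<phi> (snd z))))"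
    using R.integrable_snd[OF prod] unfolding inner by (simp add: c_def \<psi>_def)
  have "of_real (\<integral>y. exp (- \<bar>y\<bar> / L) * (norm (A y))\<^sup>2 \<partial>lborel) = (\<integral>y. of_real (exp (- \<bar>y\<bar> / L) * (norm (A y))\<^sup>2) \<partial>lborel :: complex)"
    by (rule integral_complex_of_real[symmetric])
  also have "\<dots> = (\<integral>z. \<integral>y. of_real (exp (- \<bar>y\<bar> / L)) * (c z * cis (- (y * \<psi> z))) \<partial>lborel \<partial>(M \<Otimes>\<^sub>M M))"
    unfolding eq[symmetric] by (rule R.Fubini_integral[symmetric, OF prod])
  also have "\<dots> = (\<integral>z. c z * of_real (poisson L (\<psi> z)) \<partial>(M \<Otimes>\<^sub>M M))" unfolding inner ..
  finally show "of_real (\<integral>y. exp (- \<bar>y\<bar> / L) * (norm (A y))\<^sup>2 \<partial>lborel)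
        = (\<integral>z. a (fst z) * cnj (a (snd z)) * of_real (poisson L (\<phi> (fst z) - \<phi> (snd z))) \<partial>(M \<Otimes>\<^sub>M M))"
    by (simp add: c_def \<psi>_def)
qed

text \<open>Schur's test: the kernel is positive, so that only the absolute values of the coefficients matter.\<close>
lemma poisson_mean_square_le:
  fixes a :: "'a \<Rightarrow> complex" and \<phi> :: "'a \<Rightarrow> real"
  assumes M: "sigma_finite_measure M" and a: "integrable M a" and [measurable]: "\<phi> \<in> borel_measurable M" and L: "L > 0"
    and B: "B \<ge> 0" and bound: "\<And>x. (\<integral>\<^sup>+x'. ennreal (norm (a x') * poisson L (\<phi> x - \<phi> x')) \<partial>M) \<le> ennreal B"
  shows "(\<integral>y. exp (- \<bar>y\<bar> / L) * (norm (\<integral>x. a x * cis (- (y * \<phi> x)) \<partial>M))\<^sup>2 \<partial>lborel) \<le> B * (\<integral>x. norm (a x) \<partial>M)"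
proof -
  interpret M: sigma_finite_measure M by fact
  have [measurable]: "a \<in> borel_measurable M" using a by auto
  let ?I = "\<integral>y. exp (- \<bar>y\<bar> / L) * (norm (\<integral>x. a x * cis (- (y * \<phi> x)) \<partial>M))\<^sup>2 \<partial>lborel"
  note q = poisson_quadratic_form[OF M a assms(3) L]
  have "ennreal (norm (of_real ?I :: complex))
      \<le> (\<integral>\<^sup>+z. norm (a (fst z) * cnj (a (snd z)) * of_real (poisson L (\<phi> (fst z) - \<phi> (snd z)))) \<partial>(M \<Otimes>\<^sub>M M))"
    unfolding q(3) by (rule integral_norm_bound_ennreal[OF q(2)])
  also have "\<dots> = (\<integral>\<^sup>+x. \<integral>\<^sup>+x'. ennreal (norm (a x)) * ennreal (norm (a x') * poisson L (\<phi> x - \<phi> x')) \<partial>M \<partial>M)"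
    by (subst M.nn_integral_fst[symmetric]) (auto simp: norm_mult poisson_nonneg[OF L] ennreal_mult[symmetric] mult.assoc)
  also have "\<dots> = (\<integral>\<^sup>+x. ennreal (norm (a x)) * (\<integral>\<^sup>+x'. ennreal (norm (a x') * poisson L (\<phi> x - \<phi> x')) \<partial>M) \<partial>M)"
    by (intro nn_integral_cong nn_integral_cmult) measurable
  also have "\<dots> \<le> (\<integral>\<^sup>+x. ennreal (norm (a x)) * ennreal B \<partial>M)"
    by (intro nn_integral_mono mult_left_mono bound) auto
  also have "\<dots> = (\<integral>\<^sup>+x. ennreal (norm (a x)) \<partial>M) * ennreal B"
    by (rule nn_integral_multc) measurable
  also have "(\<integral>\<^sup>+x. ennreal (norm (a x)) \<partial>M) = ennreal (\<integral>x. norm (a x) \<partial>M)"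
    using a by (intro nn_integral_eq_integral) auto
  also have "\<dots> * ennreal B = ennreal (B * (\<integral>x. norm (a x) \<partial>M))"
    using B by (subst ennreal_mult[symmetric]) (auto simp: mult.commute)
  finally have "norm (of_real ?I :: complex) \<le> B * (\<integral>x. norm (a x) \<partial>M)"
    using B by (subst (asm) ennreal_le_iff) auto
  then show ?thesis by simp
qed

text \<open>As \<open>L\<close> tends to infinity the Poisson kernel is an approximate identity: the
  inner integral converges to a multiple of \<open>g\<close> at every point of continuity, so the quadratic
  form of \<open>g\<close> tends to the same multiple of its square norm. The multiple is left as an integral, as only its positivity matters.\<close>
lemma plancherel_le:
  fixes g :: "real \<Rightarrow> complex"
  assumes g: "integrable lborel g" and bounded: "\<And>v. norm (g v) \<le> B" and cont: "AE v in lborel. isCont g v"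
    and K: "\<And>L. L > 0 \<Longrightarrow> (\<integral>y. exp (- \<bar>y\<bar> / L) * (norm (\<integral>v. g v * cis (- (y * v)) \<partial>lborel))\<^sup>2 \<partial>lborel) \<le> K"
  shows "integrable lborel (\<lambda>v. (norm (g v))\<^sup>2)"
    and "2 * (\<integral>z. 1 / (1 + z\<^sup>2) \<partial>lborel) * (\<integral>v. (norm (g v))\<^sup>2 \<partial>lborel) \<le> K"
proof -
  have [measurable]: "g \<in> borel_measurable borel" using g by auto
  define k where "k = (\<lambda>z. of_real (2 * (1 / (1 + z\<^sup>2))) :: complex)"
  have [measurable]: "k \<in> borel_measurable borel" unfolding k_def by measurable
  have k_int: "integrable lborel k"
    unfolding k_def using integrable_cauchy_kernel by (intro integrable_of_real integrable_mult_right) auto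
  have k_val: "(\<integral>z. k z \<partial>lborel) = of_real (2 * (\<integral>z. 1 / (1 + z\<^sup>2) \<partial>lborel))"
    unfolding k_def by (subst integral_complex_of_real) (simp only: integral_mult_right_zero)
  have B0: "B \<ge> 0" using bounded[of 0] norm_ge_zero[of "g 0"] by linarith
  show sq_int: "integrable lborel (\<lambda>v. (norm (g v))\<^sup>2)"
  proof (rule Bochner_Integration.integrable_bound)
    show "integrable lborel (\<lambda>v. B * norm (g v))" using g by auto
    show "AE v in lborel. norm ((norm (g v))\<^sup>2) \<le> norm (B * norm (g v))"
      using bounded B0 by (intro AE_I2) (auto simp: power2_eq_square intro!: mult_right_mono)
  qed measurable
  define h where "h = (\<lambda>n v. \<integral>z. cnj (g (v + z / real (Suc n))) * k z \<partial>lborel)"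
  have dom_h: "AE z in lborel. norm (cnj (g (v + z / real (Suc n))) * k z) \<le> B * norm (k z)" for n v
    using bounded by (intro AE_I2) (auto simp: norm_mult intro!: mult_right_mono)
  have Bk_int: "integrable lborel (\<lambda>z. B * norm (k z))" using k_int by auto
  have h_bound: "norm (h n v) \<le> (\<integral>z. B * norm (k z) \<partial>lborel)" for n v
  proof -
    have "norm (h n v) \<le> (\<integral>z. norm (cnj (g (v + z / real (Suc n))) * k z) \<partial>lborel)"
      unfolding h_def by (rule integral_norm_bound)
    also have "\<dots> \<le> (\<integral>z. B * norm (k z) \<partial>lborel)"
      using bounded B0 by (intro integral_mono'[OF Bk_int]) (auto simp: norm_mult intro!: mult_right_mono)
    finally show ?thesis .
  qed
  have [measurable]: "h n \<in> borel_measurable borel" for n unfolding h_def by measurable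
  have h_lim: "(\<lambda>n. h n v) \<longlonglongrightarrow> cnj (g v) * (\<integral>z. k z \<partial>lborel)" if v: "isCont g v" for v
  proof -
    have "(\<lambda>n. \<integral>z. cnj (g (v + z / real (Suc n))) * k z \<partial>lborel) \<longlonglongrightarrow> (\<integral>z. cnj (g v) * k z \<partial>lborel)"
    proof (rule integral_dominated_convergence[OF _ _ Bk_int])
      show "AE z in lborel. (\<lambda>n. cnj (g (v + z / real (Suc n))) * k z) \<longlonglongrightarrow> cnj (g v) * k z"
      proof (intro AE_I2 tendsto_intros)
        fix z :: real
        have "(\<lambda>n. v + z / real (Suc n)) \<longlonglongrightarrow> v" by real_asymp
        then show "(\<lambda>n. g (v + z / real (Suc n))) \<longlonglongrightarrow> g v"
          by (rule isCont_tendsto_compose[OF v])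
      qed
    qed (use dom_h in auto)
    then show ?thesis unfolding h_def by simp
  qed
  \<comment> \<open>The substitution \<open>w = v + z/L\<close> gives the kernel a fixed shape and moves
    \<open>L\<close> into the argument of \<open>g\<close>.\<close>
  have quad: "of_real (\<integral>y. exp (- \<bar>y\<bar> / real (Suc n)) * (norm (\<integral>v. g v * cis (- (y * v)) \<partial>lborel))\<^sup>2 \<partial>lborel)
       = (\<integral>v. g v * h n v \<partial>lborel)" for n
  proof -
    let ?L = "real (Suc n)"
    note q = poisson_quadratic_form[OF sigma_finite_lborel g, of "\<lambda>v. v" ?L, simplified]
    have "of_real (\<integral>y. exp (- \<bar>y\<bar> / ?L) * (norm (\<integral>v. g v * cis (- (y * v)) \<partial>lborel))\<^sup>2 \<partial>lborel)
       = (\<integral>z. g (fst z) * cnj (g (snd z)) * of_real (poisson ?L (fst z - snd z)) \<partial>(lborel \<Otimes>\<^sub>M lborel))"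
      using poisson_quadratic_form(3)[OF sigma_finite_lborel g, of "\<lambda>v. v" ?L] by simp
    also have "\<dots> = (\<integral>v. \<integral>w. g v * cnj (g w) * of_real (poisson ?L (v - w)) \<partial>lborel \<partial>lborel)"
      using lborel_pair.integral_fst'[OF poisson_quadratic_form(2)[OF sigma_finite_lborel g, of "\<lambda>v. v" ?L]] by simp
    also have "\<dots> = (\<integral>v. g v * h n v \<partial>lborel)"
    proof (rule Bochner_Integration.integral_cong[OF refl])
      fix v
      have "(\<integral>w. g v * cnj (g w) * of_real (poisson ?L (v - w)) \<partial>lborel)
          = g v * (\<integral>w. cnj (g w) * of_real (poisson ?L (v - w)) \<partial>lborel)"
        by (simp add: mult.assoc)
      also have "(\<integral>w. cnj (g w) * of_real (poisson ?L (v - w)) \<partial>lborel)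
          = \<bar>1 / ?L\<bar> *\<^sub>R (\<integral>z. cnj (g (v + 1 / ?L * z)) * of_real (poisson ?L (v - (v + 1 / ?L * z))) \<partial>lborel)"
        by (rule lborel_integral_real_affine) simp
      also have "\<dots> = (\<integral>z. \<bar>1 / ?L\<bar> *\<^sub>R (cnj (g (v + 1 / ?L * z)) * of_real (poisson ?L (v - (v + 1 / ?L * z)))) \<partial>lborel)"
        by simp
      also have "\<dots> = h n v" unfolding h_def
      proof (rule Bochner_Integration.integral_cong[OF refl])
        fix z
        have "\<bar>1 / ?L\<bar> * poisson ?L (v - (v + 1 / ?L * z)) = 2 * (1 / (1 + z\<^sup>2))"
          by (simp add: poisson_def power_divide del: of_nat_Suc)
        then have kz: "of_real \<bar>1 / ?L\<bar> * of_real (poisson ?L (v - (v + 1 / ?L * z))) = k z"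
          unfolding k_def by (metis of_real_mult)
        show "\<bar>1 / ?L\<bar> *\<^sub>R (cnj (g (v + 1 / ?L * z)) * of_real (poisson ?L (v - (v + 1 / ?L * z))))
            = cnj (g (v + z / ?L)) * k z"
          unfolding kz[symmetric] by (simp add: scaleR_conv_of_real mult_ac del: of_nat_Suc)
      qed
      finally show "(\<integral>w. g v * cnj (g w) * of_real (poisson ?L (v - w)) \<partial>lborel) = g v * h n v" .
    qed
    finally show ?thesis .
  qed
  have "(\<lambda>n. \<integral>v. g v * h n v \<partial>lborel) \<longlonglongrightarrow> (\<integral>v. g v * (cnj (g v) * (\<integral>z. k z \<partial>lborel)) \<partial>lborel)"
  proof (rule integral_dominated_convergence)
    show "integrable lborel (\<lambda>v. norm (g v) * (\<integral>z. B * norm (k z) \<partial>lborel))" using g by auto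
    show "AE v in lborel. (\<lambda>n. g v * h n v) \<longlonglongrightarrow> g v * (cnj (g v) * (\<integral>z. k z \<partial>lborel))"
      using cont by eventually_elim (intro tendsto_intros h_lim)
    show "AE v in lborel. norm (g v * h n v) \<le> norm (g v) * (\<integral>z. B * norm (k z) \<partial>lborel)" for n
      using h_bound by (intro AE_I2) (auto simp: norm_mult intro!: mult_left_mono)
  qed measurable
  also have "(\<integral>v. g v * (cnj (g v) * (\<integral>z. k z \<partial>lborel)) \<partial>lborel) = of_real (2 * (\<integral>z. 1 / (1 + z\<^sup>2) \<partial>lborel) * (\<integral>v. (norm (g v))\<^sup>2 \<partial>lborel))"
  proof -
    have "(\<integral>v. g v * (cnj (g v) * (\<integral>z. k z \<partial>lborel)) \<partial>lborel) = (\<integral>v. of_real ((norm (g v))\<^sup>2) * (\<integral>z. k z \<partial>lborel) \<partial>lborel)"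
      by (simp only: complex_norm_square mult.assoc)
    also have "\<dots> = of_real (\<integral>v. (norm (g v))\<^sup>2 \<partial>lborel) * (\<integral>z. k z \<partial>lborel)"
      by (simp only: integral_mult_left_zero integral_complex_of_real)
    finally show ?thesis unfolding k_val by (simp add: mult_ac)
  qed
  finally have "(\<lambda>n. of_real (\<integral>y. exp (- \<bar>y\<bar> / real (Suc n)) * (norm (\<integral>v. g v * cis (- (y * v)) \<partial>lborel))\<^sup>2 \<partial>lborel) :: complex)
     \<longlonglongrightarrow> of_real (2 * (\<integral>z. 1 / (1 + z\<^sup>2) \<partial>lborel) * (\<integral>v. (norm (g v))\<^sup>2 \<partial>lborel))"
    unfolding quad .
  then have "(\<lambda>n. \<integral>y. exp (- \<bar>y\<bar> / real (Suc n)) * (norm (\<integral>v. g v * cis (- (y * v)) \<partial>lborel))\<^sup>2 \<partial>lborel)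
     \<longlonglongrightarrow> 2 * (\<integral>z. 1 / (1 + z\<^sup>2) \<partial>lborel) * (\<integral>v. (norm (g v))\<^sup>2 \<partial>lborel)"
    by (rule tendsto_of_real_iff[THEN iffD1])
  then show "2 * (\<integral>z. 1 / (1 + z\<^sup>2) \<partial>lborel) * (\<integral>v. (norm (g v))\<^sup>2 \<partial>lborel) \<le> K"
    by (rule LIMSEQ_le_const2) (use K in auto)
qed

section \<open>Partial sums of a multiplicative function and their transforms\<close>

text \<open>The positive integers up to \<open>exp v\<close>. On the logarithmic scale Dirichlet convolutions
  become translations and Mellin transforms become Fourier transforms.\<close>
definition log_upto :: "real \<Rightarrow> nat set" where
  "log_upto v = {n. n > 0 \<and> ln (real n) \<le> v}"

lemma log_upto_eq: "log_upto v = {1..nat \<lfloor>exp v\<rfloor>}"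
proof -
  have "n \<in> log_upto v \<longleftrightarrow> n \<in> {1..nat \<lfloor>exp v\<rfloor>}" for n
  proof (cases "n > 0")
    case True
    then have "ln (real n) \<le> v \<longleftrightarrow> real n \<le> exp v"
      by (metis exp_le_cancel_iff exp_ln of_nat_0_less_iff)
    also have "\<dots> \<longleftrightarrow> n \<le> nat \<lfloor>exp v\<rfloor>" by (simp add: le_nat_iff le_floor_iff)
    finally show ?thesis using True by (auto simp: log_upto_def)
  qed (auto simp: log_upto_def)
  then show ?thesis by blast
qed

lemma finite_log_upto [simp]: "finite (log_upto v)"
  by (simp add: log_upto_eq)

lemma card_log_upto_le: "real (card (log_upto v)) \<le> exp v"
  by (simp add: log_upto_eq)

lemma log_upto_mono: "v \<le> w \<Longrightarrow> log_upto v \<subseteq> log_upto w"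
  by (auto simp: log_upto_def)

lemma ln_log_upto: "n \<in> log_upto v \<Longrightarrow> 0 \<le> ln (real n) \<and> ln (real n) \<le> v"
  by (auto simp: log_upto_def Suc_le_eq)

lemma log_upto_negative: "v < 0 \<Longrightarrow> log_upto v = {}"
  by (auto dest: ln_log_upto)

lemma ln_fact_ge: "real m * ln (real m) - real m \<le> ln (fact m)"
proof (induction m)
  case (Suc m)
  have "real (Suc m) * ln (real (Suc m)) - real (Suc m) \<le> ln (real (Suc m)) + (real m * ln (real m) - real m)"
  proof (cases "m = 0")
    case False
    have "ln (1 + 1 / real m) \<le> 1 / real m" by (rule ln_add_one_self_le_self) simp
    moreover have "1 + 1 / real m = real (Suc m) / real m" using False by (simp add: field_simps)
    ultimately have "ln (real (Suc m)) - ln (real m) \<le> 1 / real m"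
      using False ln_div[of "real (Suc m)" "real m"] by (simp del: of_nat_Suc)
    then have "real m * (ln (real (Suc m)) - ln (real m)) \<le> real m * (1 / real m)"
      by (intro mult_left_mono) auto
    then show ?thesis using False by (simp add: algebra_simps)
  qed simp
  also have "\<dots> \<le> ln (real (Suc m)) + ln (fact m)" using Suc by simp
  also have "\<dots> = ln (fact (Suc m))" by (simp add: ln_mult del: of_nat_Suc)
  finally show ?case .
qed simp

text \<open>The error of replacing \<open>ln n\<close> by \<open>ln x\<close> under the sum over \<open>n \<le>
  x\<close>; Stirling's lower bound for the factorial makes it \<open>O(x)\<close>.\<close>
lemma sum_log_deficit:
  assumes "v \<ge> 0"
  shows "(\<Sum>n\<in>log_upto v. v - ln (real n)) \<le> exp v"
proof -
  define m where "m = nat \<lfloor>exp v\<rfloor>"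
  have "1 \<le> exp v" using assms by simp
  then have m: "1 \<le> m" "real m \<le> exp v" unfolding m_def by (simp_all add: le_nat_iff le_floor_iff)
  have "(\<Sum>n\<in>log_upto v. v - ln (real n)) = real m * v - (\<Sum>n\<in>{1..m}. ln (real n))"
    by (simp add: log_upto_eq m_def sum_subtractf)
  also have "(\<Sum>n\<in>{1..m}. ln (real n)) = ln (fact m)"
    by (induction m) (simp_all add: ln_mult add.commute del: of_nat_Suc)
  also have "real m * v - ln (fact m) \<le> real m * v - (real m * ln (real m) - real m)"
    using ln_fact_ge[of m] by simp
  also have "\<dots> = real m * (v - ln (real m)) + real m" by (simp add: algebra_simps)
  also have "v - ln (real m) = ln (exp v / real m)" using m by (simp add: ln_div)
  also have "real m * ln (exp v / real m) \<le> real m * (exp v / real m - 1)"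
    using m by (intro mult_left_mono ln_le_minus_one) auto
  also have "real m * (exp v / real m - 1) + real m = exp v" using m by (simp add: field_simps)
  finally show ?thesis by simp
qed

context root_valued
begin

definition partial_sum :: "real \<Rightarrow> complex" where
  "partial_sum v = (\<Sum>n\<in>log_upto v. f n)"

definition log_sum :: "real \<Rightarrow> complex" where
  "log_sum v = (\<Sum>n\<in>log_upto v. f n * of_real (ln (real n)))"

lemma partial_sum_negative: "v < 0 \<Longrightarrow> partial_sum v = 0" and log_sum_negative: "v < 0 \<Longrightarrow> log_sum v = 0"
  by (simp_all add: partial_sum_def log_sum_def log_upto_negative)

lemma norm_partial_sum_le: "norm (partial_sum v) \<le> exp v"
proof -
  have "norm (partial_sum v) \<le> (\<Sum>n\<in>log_upto v. norm (f n))" unfolding partial_sum_def by (rule norm_sum)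
  also have "\<dots> = real (card (log_upto v))" by (simp add: f_norm log_upto_def)
  finally show ?thesis using card_log_upto_le[of v] by linarith
qed

lemma norm_log_sum_le: "v \<ge> 0 \<Longrightarrow> norm (log_sum v) \<le> v * exp v"
proof -
  assume v: "v \<ge> 0"
  have "norm (log_sum v) \<le> (\<Sum>n\<in>log_upto v. v)" unfolding log_sum_def
  proof (rule sum_norm_le)
    fix n assume n: "n \<in> log_upto v"
    then have "norm (f n) = 1" by (simp add: f_norm log_upto_def)
    then show "norm (f n * of_real (ln (real n))) \<le> v" using ln_log_upto[OF n] by (simp add: norm_mult)
  qed
  also have "\<dots> = v * real (card (log_upto v))" by simp
  also have "\<dots> \<le> v * exp v" using v card_log_upto_le[of v] by (intro mult_left_mono)
  finally show ?thesis .
qed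

lemma partial_sum_times_log:
  assumes "v \<ge> 0"
  shows "v * norm (partial_sum v) \<le> norm (log_sum v) + exp v"
proof -
  have "of_real v * partial_sum v = log_sum v + (\<Sum>n\<in>log_upto v. f n * of_real (v - ln (real n)))"
    unfolding partial_sum_def log_sum_def by (simp add: sum_distrib_left sum.distrib[symmetric] algebra_simps)
  then have "norm (of_real v * partial_sum v) \<le> norm (log_sum v) + norm (\<Sum>n\<in>log_upto v. f n * of_real (v - ln (real n)))"
    by (metis norm_triangle_ineq)
  also have "norm (\<Sum>n\<in>log_upto v. f n * of_real (v - ln (real n))) \<le> (\<Sum>n\<in>log_upto v. v - ln (real n))"
  proof (rule sum_norm_le)
    fix n assume n: "n \<in> log_upto v"
    then have "norm (f n) = 1" by (simp add: f_norm log_upto_def)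
    moreover have "norm (complex_of_real (v - ln (real n))) = v - ln (real n)"
      using ln_log_upto[OF n] by (subst norm_of_real) simp
    ultimately show "norm (f n * of_real (v - ln (real n))) \<le> v - ln (real n)"
      by (simp only: norm_mult mult_1_left order_refl)
  qed
  also have "\<dots> \<le> exp v" by (rule sum_log_deficit) fact
  finally show ?thesis using assms by (simp add: norm_mult)
qed

text \<open>\<open>log\<close> is the Dirichlet convolution of \<open>\<Lambda>\<close> and \<open>1\<close>, so
  multiplying the coefficients by
  \<open>log\<close> turns \<open>partial_sum\<close> into a superposition of its own translates.\<close>
lemma log_sum_convolution:
  assumes "v \<le> w"
  shows "log_sum v = (\<Sum>d\<in>log_upto w. mangoldt d * f d * partial_sum (v - ln (real d)))"
proof -
  have "log_sum v = (\<Sum>n\<in>log_upto v. \<Sum>d | d dvd n. f n * mangoldt d)"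
    unfolding log_sum_def
  proof (rule sum.cong[OF refl])
    fix n assume "n \<in> log_upto v"
    then have "n \<noteq> 0" by (simp add: log_upto_def)
    then show "f n * of_real (ln (real n)) = (\<Sum>d | d dvd n. f n * mangoldt d)"
      by (simp only: mangoldt_sum[symmetric] sum_distrib_left not_False_eq_True)
  qed
  also have "\<dots> = (\<Sum>(n, d)\<in>(SIGMA n:log_upto v. {d. d dvd n}). f n * mangoldt d)"
    by (rule sum.Sigma) (simp, use finite_divisors_nat in \<open>auto simp: log_upto_def\<close>)
  also have "\<dots> = (\<Sum>(d, m)\<in>(SIGMA d:log_upto w. log_upto (v - ln (real d))). mangoldt d * f d * f m)"
  proof (rule sum.reindex_bij_witness[where i = "\<lambda>(d, m). (d * m, d)" and j = "\<lambda>(n, d). (d, n div d)"], goal_cases)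
    case (2 a)
    then obtain n d where a: "a = (n, d)" "n \<in> log_upto v" "d dvd n" by auto
    then obtain m where m: "n = d * m" by auto
    with a have pos: "d > 0" "m > 0" by (auto simp: log_upto_def)
    then have ln: "ln (real n) = ln (real d) + ln (real m)" "0 \<le> ln (real m)" unfolding m by (simp_all add: ln_mult)
    moreover have "ln (real n) \<le> v" using a by (simp add: log_upto_def)
    ultimately have "ln (real d) \<le> w" "ln (real m) \<le> v - ln (real d)" using assms by linarith+
    then show ?case using a m pos by (simp add: log_upto_def)
  next
    case (4 a)
    then obtain d m where a: "a = (d, m)" "d \<in> log_upto w" "m \<in> log_upto (v - ln (real d))" by auto
    then have "d > 0" "m > 0" "ln (real d) + ln (real m) \<le> v" by (auto simp: log_upto_def)
    then show ?case using a(1) by (simp add: log_upto_def ln_mult)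
  next
    case (5 a)
    then obtain n d where a: "a = (n, d)" "n \<in> log_upto v" "d dvd n" by auto
    then obtain m where m: "n = d * m" by auto
    with a have pos: "d > 0" "m > 0" by (auto simp: log_upto_def)
    then show ?case using a(1) m by (simp add: f_mult mult_ac)
  qed (auto simp: log_upto_def)
  also have "\<dots> = (\<Sum>d\<in>log_upto w. \<Sum>m\<in>log_upto (v - ln (real d)). mangoldt d * f d * f m)"
    by (rule sum.Sigma[symmetric]) auto
  also have "\<dots> = (\<Sum>d\<in>log_upto w. mangoldt d * f d * partial_sum (v - ln (real d)))"
    by (simp add: partial_sum_def sum_distrib_left)
  finally show ?thesis .
qed

lemma log_sum_convolution_suminf: "log_sum v = (\<Sum>d. mangoldt d * f d * partial_sum (v - ln (real d)))"
proof -
  have "(\<Sum>d. mangoldt d * f d * partial_sum (v - ln (real d))) = (\<Sum>d\<in>log_upto v. mangoldt d * f d * partial_sum (v - ln (real d)))"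
  proof (rule suminf_finite)
    fix d assume "d \<notin> log_upto v"
    then have "d = 0 \<or> v - ln (real d) < 0" by (auto simp: log_upto_def)
    then show "mangoldt d * f d * partial_sum (v - ln (real d)) = 0" by (auto simp: partial_sum_negative)
  qed simp
  then show ?thesis using log_sum_convolution[of v v] by simp
qed

lemma partial_sum_suminf: "partial_sum v = (\<Sum>n. if n > 0 \<and> ln (real n) \<le> v then f n else 0)"
  unfolding partial_sum_def by (subst suminf_finite[of "log_upto v"]) (auto intro!: sum.cong, auto simp: log_upto_def)

lemma partial_sum_measurable [measurable]: "partial_sum \<in> borel_measurable borel"
  unfolding partial_sum_suminf[abs_def] by measurable

lemma log_sum_measurable [measurable]: "log_sum \<in> borel_measurable borel"
  unfolding log_sum_convolution_suminf[abs_def] by measurable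

text \<open>Each integer \<open>n\<close> contributes the transform of a half-line starting at \<open>ln
  n\<close>, and the series converges absolutely to the right of \<open>1\<close>.\<close>
lemma partial_sum_transform:
  assumes "\<alpha> > 0"
  shows "integrable lborel (\<lambda>v. partial_sum v * exp (- (Complex (1 + \<alpha>) y * of_real v)))"
    and "(\<integral>v. partial_sum v * exp (- (Complex (1 + \<alpha>) y * of_real v)) \<partial>lborel) = dseries \<alpha> y / Complex (1 + \<alpha>) y"
proof -
  define s where "s = Complex (1 + \<alpha>) y"
  have Re: "Re s > 0" using assms by (simp add: s_def)
  define h where "h = (\<lambda>n v. (if n > 0 then f n else 0) * (indicator {ln (real n)..} v *\<^sub>R exp (- (s * of_real v))))"
  have h_int: "has_bochner_integral lborel (h n) ((if n > 0 then f n else 0) * (exp (- (s * of_real (ln (real n)))) / s))" for n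
    unfolding h_def by (rule has_bochner_integral_mult_right) (rule integral_exp_halfline[OF Re])
  have coeff: "(if n > 0 then f n else 0) * (exp (- (s * of_real (ln (real n)))) / s) = f n * of_nat n powr (-s) / s" for n
    by (cases "n = 0") (simp_all add: powr_def Ln_of_nat)
  have h_eq: "partial_sum v * exp (- (s * of_real v)) = (\<Sum>n. h n v)" and h_fin: "summable (\<lambda>n. norm (h n v))" for v
  proof -
    have 0: "h n v = (if n \<in> log_upto v then f n * exp (- (s * of_real v)) else 0)" for n
      by (auto simp: h_def log_upto_def indicator_def)
    show "summable (\<lambda>n. norm (h n v))"
      unfolding 0 by (rule summable_finite[of "log_upto v"]) auto
    show "partial_sum v * exp (- (s * of_real v)) = (\<Sum>n. h n v)"
      unfolding 0 by (subst suminf_finite[of "log_upto v"]) (auto simp: partial_sum_def sum_distrib_right)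
  qed
  have norm_h: "(\<integral>v. norm (h n v) \<partial>lborel) \<le> real n powr (-1 - \<alpha>)" for n
  proof (cases "n > 0")
    case True
    have "(\<integral>v. norm (h n v) \<partial>lborel) = (\<integral>v. indicator {ln (real n)..} v * exp (- ((1 + \<alpha>) * v)) \<partial>lborel)"
      unfolding h_def s_def using True by (intro Bochner_Integration.integral_cong) (auto simp: norm_mult f_norm indicator_def)
    also have "\<dots> = exp (- ((1 + \<alpha>) * ln (real n))) / (1 + \<alpha>)"
    proof -
      have "has_bochner_integral lborel (\<lambda>v. indicator {ln (real n)..} v *\<^sub>R exp (- (of_real (1 + \<alpha>) * of_real v)))
          (exp (- (of_real (1 + \<alpha>) * of_real (ln (real n)))) / of_real (1 + \<alpha>) :: complex)"
        using assms by (intro integral_exp_halfline) simp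
      then have "has_bochner_integral lborel (\<lambda>v. complex_of_real (indicator {ln (real n)..} v * exp (- ((1 + \<alpha>) * v))))
          (complex_of_real (exp (- ((1 + \<alpha>) * ln (real n))) / (1 + \<alpha>)))"
        by (simp add: scaleR_conv_of_real exp_of_real[symmetric])
      then have "(\<integral>v. complex_of_real (indicator {ln (real n)..} v * exp (- ((1 + \<alpha>) * v))) \<partial>lborel)
          = complex_of_real (exp (- ((1 + \<alpha>) * ln (real n))) / (1 + \<alpha>))"
        by (rule has_bochner_integral_integral_eq)
      then show ?thesis unfolding integral_complex_of_real of_real_eq_iff .
    qed
    also have "\<dots> \<le> exp (- ((1 + \<alpha>) * ln (real n))) / 1"
      using assms by (intro divide_left_mono) auto
    also have "\<dots> = real n powr (-1 - \<alpha>)" using True by (simp add: powr_def algebra_simps)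
    finally show ?thesis .
  qed (simp add: h_def)
  have summ: "summable (\<lambda>n. \<integral>v. norm (h n v) \<partial>lborel)"
    by (rule summable_comparison_test'[OF summable_powr_below[OF assms], of 0]) (simp add: norm_h)
  note si = integrable_suminf[of lborel h, OF _ _ summ] integral_suminf[of lborel h, OF _ _ summ]
  have "integrable lborel (\<lambda>v. \<Sum>n. h n v)"
    by (rule si(1)) (use h_int h_fin in \<open>auto simp: has_bochner_integral_iff\<close>)
  then show "integrable lborel (\<lambda>v. partial_sum v * exp (- (Complex (1 + \<alpha>) y * of_real v)))"
    unfolding s_def[symmetric] h_eq .
  have "(\<integral>v. (\<Sum>n. h n v) \<partial>lborel) = (\<Sum>n. \<integral>v. h n v \<partial>lborel)"
    by (rule si(2)) (use h_int h_fin in \<open>auto simp: has_bochner_integral_iff\<close>)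
  also have "\<dots> = (\<Sum>n. f n * of_nat n powr (-s) / s)"
    using h_int unfolding coeff by (simp add: has_bochner_integral_iff)
  also have "\<dots> = (\<Sum>n. f n * of_nat n powr (-s)) / s"
  proof (rule suminf_divide)
    show "summable (\<lambda>n. f n * of_nat n powr (-s))"
    proof (rule summable_comparison_test'[OF summable_powr_below[OF assms], of 0])
      show "norm (f n * of_nat n powr (-s)) \<le> real n powr (-1 - \<alpha>)" for n
        by (cases "n = 0") (simp_all add: norm_mult f_norm norm_nat_powr s_def)
    qed
  qed
  finally show "(\<integral>v. partial_sum v * exp (- (Complex (1 + \<alpha>) y * of_real v)) \<partial>lborel) = dseries \<alpha> y / Complex (1 + \<alpha>) y"
    unfolding s_def[symmetric] h_eq .
qed

text \<open>The logarithmic derivative \<open>- F'/F\<close> of the Dirichlet series of \<open>f\<close>.\<close>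
abbreviation ldseries :: "real \<Rightarrow> real \<Rightarrow> complex" where
  "ldseries \<alpha> y \<equiv> (\<Sum>n. mangoldt n * f n * of_real (real n powr (-1 - \<alpha>)) * cis (- (y * ln (real n))))"

text \<open>The convolution identity turns \<open>log_sum\<close> into translates of \<open>partial_sum\<close>,
  and a translation by \<open>ln d\<close> multiplies the transform by \<open>d powr (-s)\<close>. This proves
  \<open>- F' = F * (- F'/F)\<close> without multiplying Dirichlet series.\<close>
lemma log_sum_transform:
  assumes "0 < \<alpha>" "\<alpha> \<le> 1"
  shows "integrable lborel (\<lambda>v. log_sum v * exp (- (Complex (1 + \<alpha>) y * of_real v)))"
    and "(\<integral>v. log_sum v * exp (- (Complex (1 + \<alpha>) y * of_real v)) \<partial>lborel)
       = dseries \<alpha> y / Complex (1 + \<alpha>) y * ldseries \<alpha> y"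
proof -
  define s where "s = Complex (1 + \<alpha>) y"
  define T where "T = (\<lambda>v. partial_sum v * exp (- (s * of_real v)))"
  have T_int: "integrable lborel T" and T_val: "(\<integral>v. T v \<partial>lborel) = dseries \<alpha> y / s"
    using partial_sum_transform[OF assms(1), of y] unfolding T_def s_def by auto
  define c where "c = (\<lambda>n. mangoldt n * f n * of_real (real n powr (-1 - \<alpha>)) * cis (- (y * ln (real n))))"
  have c_norm: "norm (c n) = mangoldt n * real n powr (-1 - \<alpha>)" for n
    by (cases "n = 0") (auto simp: c_def norm_mult f_norm mangoldt_nonneg)
  have c_exp: "mangoldt n * f n * exp (- (s * of_real (ln (real n)))) = c n" for n
  proof (cases "n = 0")
    case False
    then show ?thesis using powr_vertical[of n \<alpha> y] by (simp add: c_def s_def powr_def Ln_of_nat mult_ac)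
  qed (simp add: c_def)
  define h where "h = (\<lambda>n v. c n * T (v - ln (real n)))"
  have shift: "integrable lborel (\<lambda>v. T (v - t))" "(\<integral>v. T (v - t) \<partial>lborel) = (\<integral>v. T v \<partial>lborel)"
    "(\<integral>v. norm (T (v - t)) \<partial>lborel) = (\<integral>v. norm (T v) \<partial>lborel)" for t
    using lborel_integrable_real_affine[OF T_int, of 1 "-t"]
      lborel_integral_real_affine[of 1 T "-t"] lborel_integral_real_affine[of 1 "\<lambda>v. norm (T v)" "-t"]
    by simp_all
  have h_int: "integrable lborel (h n)" for n unfolding h_def using shift(1) by simp
  have h_term: "h n v = mangoldt n * f n * partial_sum (v - ln (real n)) * exp (- (s * of_real v))" for n v
  proof -
    have "exp (- (s * of_real (ln (real n)))) * exp (- (s * of_real (v - ln (real n)))) = exp (- (s * of_real v))"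
      by (simp add: exp_add[symmetric] algebra_simps)
    then show ?thesis unfolding h_def c_exp[symmetric] T_def by (simp add: mult_ac)
  qed
  have h_zero: "h n v = 0" if "n \<notin> log_upto v" for n v
  proof -
    have "n = 0 \<or> v - ln (real n) < 0" using that by (auto simp: log_upto_def)
    then show ?thesis by (auto simp: h_term partial_sum_negative)
  qed
  have h_fin: "summable (\<lambda>n. norm (h n v))" for v
    by (rule summable_finite[of "log_upto v"]) (auto simp: h_zero)
  have h_eq: "log_sum v * exp (- (s * of_real v)) = (\<Sum>n. h n v)" for v
  proof -
    have "(\<Sum>n. h n v) = (\<Sum>n\<in>log_upto v. h n v)" by (rule suminf_finite) (auto simp: h_zero)
    also have "\<dots> = log_sum v * exp (- (s * of_real v))"
      unfolding h_term log_sum_convolution[OF order_refl] by (simp add: sum_distrib_right)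
    finally show ?thesis ..
  qed
  have "(\<integral>v. norm (h n v) \<partial>lborel) = mangoldt n * real n powr (-1 - \<alpha>) * (\<integral>v. norm (T v) \<partial>lborel)" for n
    unfolding h_def norm_mult c_norm by (simp add: shift)
  then have summ: "summable (\<lambda>n. \<integral>v. norm (h n v) \<partial>lborel)"
    using mangoldt_powr_sum(1)[OF assms] by (simp add: summable_mult2)
  note si = integrable_suminf[of lborel h, OF _ _ summ] integral_suminf[of lborel h, OF _ _ summ]
  have "integrable lborel (\<lambda>v. \<Sum>n. h n v)" by (rule si(1)) (use h_int h_fin in auto)
  then show "integrable lborel (\<lambda>v. log_sum v * exp (- (Complex (1 + \<alpha>) y * of_real v)))"
    unfolding s_def[symmetric] h_eq .
  have "(\<integral>v. (\<Sum>n. h n v) \<partial>lborel) = (\<Sum>n. \<integral>v. h n v \<partial>lborel)" by (rule si(2)) (use h_int h_fin in auto)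
  also have "\<dots> = (\<Sum>n. c n * (dseries \<alpha> y / s))" unfolding h_def by (simp add: shift T_val)
  also have "\<dots> = (\<Sum>n. c n) * (dseries \<alpha> y / s)"
  proof (rule suminf_mult2[symmetric])
    show "summable c"
      by (rule summable_comparison_test'[OF mangoldt_powr_sum(1)[OF assms], of 0]) (simp add: c_norm)
  qed
  finally show "(\<integral>v. log_sum v * exp (- (Complex (1 + \<alpha>) y * of_real v)) \<partial>lborel)
       = dseries \<alpha> y / Complex (1 + \<alpha>) y * ldseries \<alpha> y"
    unfolding s_def[symmetric] h_eq c_def by (simp add: mult.commute)
qed

end

section \<open>The mean square of the logarithmically weighted partial sums\<close>

context root_valued
begin

lemma ldseries_term_norm:
  "norm (mangoldt n * f n * of_real (real n powr (-1 - \<alpha>)) :: complex) = mangoldt n * real n powr (-1 - \<alpha>)"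
  by (cases "n = 0") (auto simp: norm_mult f_norm mangoldt_nonneg)

text \<open>In mean square on every window, the series of \<open>\<Lambda>(n)f(n)\<close> is no larger than if
  \<open>f\<close> were \<open>1\<close>, because the
  weight has a non-negative Fourier transform.\<close>
lemma ldseries_laplace_mean_square:
  obtains C where "C > 0" and
    "\<And>\<alpha> L. 0 < \<alpha> \<Longrightarrow> \<alpha> \<le> 1 \<Longrightarrow> 1 \<le> L \<Longrightarrow>
       (\<integral>\<^sup>+y. ennreal (exp (- \<bar>y\<bar> / L) * (norm (ldseries \<alpha> y))\<^sup>2) \<partial>lborel) \<le> ennreal (C * L / \<alpha>)"
proof -
  obtain C1 where C1: "C1 > 0"
    and C1s: "\<And>a. summable (\<lambda>n. mangoldt n / real n * (1 / (1 + (ln (real n) - a)\<^sup>2)))"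
    and C1b: "\<And>a. (\<Sum>n. mangoldt n / real n * (1 / (1 + (ln (real n) - a)\<^sup>2))) \<le> C1"
    by (rule mangoldt_cauchy_sum, rule that)
  show ?thesis
  proof (rule that[of "72 * C1"])
    fix \<alpha> L :: real assume \<alpha>: "0 < \<alpha>" "\<alpha> \<le> 1" and L: "1 \<le> L"
    define a where "a = (\<lambda>n. mangoldt n * f n * of_real (real n powr (-1 - \<alpha>)) :: complex)"
    have a_norm: "norm (a n) = mangoldt n * real n powr (-1 - \<alpha>)" for n
      unfolding a_def by (rule ldseries_term_norm)
    have a_int: "integrable (count_space UNIV) a"
      unfolding integrable_count_space_nat_iff a_norm by (rule mangoldt_powr_sum(1)[OF \<alpha>])
    have sf: "sigma_finite_measure (count_space (UNIV :: nat set))"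
      by (rule sigma_finite_measure_count_space)
    have meas: "(\<lambda>n::nat. ln (real n)) \<in> borel_measurable (count_space UNIV)" by simp
    have A_eq: "(\<integral>n. a n * cis (- (y * ln (real n))) \<partial>count_space UNIV) = ldseries \<alpha> y" for y
    proof -
      have "integrable (count_space UNIV) (\<lambda>n. a n * cis (- (y * ln (real n))))"
        using a_int by (simp add: integrable_count_space_nat_iff norm_mult)
      from integral_count_space_nat[OF this] show ?thesis by (simp add: a_def)
    qed
    have bound: "(\<integral>\<^sup>+m. ennreal (norm (a m) * poisson L (ln (real n) - ln (real m))) \<partial>count_space UNIV)
        \<le> ennreal (2 * L * C1)" for n :: nat
    proof -
      let ?t = "\<lambda>m. mangoldt m / real m * (1 / (1 + (ln (real m) - ln (real n))\<^sup>2))"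
      have "(\<integral>\<^sup>+m. ennreal (norm (a m) * poisson L (ln (real n) - ln (real m))) \<partial>count_space UNIV)
          = (\<Sum>m. ennreal (norm (a m) * poisson L (ln (real n) - ln (real m))))"
        by (rule nn_integral_count_space_nat)
      also have "\<dots> \<le> (\<Sum>m. ennreal (2 * L * ?t m))"
      proof (intro suminf_le ennreal_leI)
        fix m :: nat
        have "1 * (ln (real m) - ln (real n))\<^sup>2 \<le> L\<^sup>2 * (ln (real m) - ln (real n))\<^sup>2"
          using L by (intro mult_right_mono) (auto simp: one_le_power)
        then have "poisson L (ln (real n) - ln (real m)) \<le> 2 * L / (1 + (ln (real m) - ln (real n))\<^sup>2)"
          unfolding poisson_def using L
          by (intro divide_left_mono mult_pos_pos) (auto simp: power2_commute[of "ln (real n)"] add_pos_nonneg)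
        then have "norm (a m) * poisson L (ln (real n) - ln (real m))
            \<le> (mangoldt m / real m) * (2 * L / (1 + (ln (real m) - ln (real n))\<^sup>2))"
          unfolding a_norm using L \<alpha> powr_minus_le_inverse[of \<alpha> m] poisson_nonneg[of L]
          by (intro mult_mono) (auto simp: mangoldt_nonneg divide_inverse intro!: mult_left_mono)
        then show "norm (a m) * poisson L (ln (real n) - ln (real m)) \<le> 2 * L * ?t m" by (simp add: mult_ac)
      qed auto
      also have "\<dots> = ennreal (\<Sum>m. 2 * L * ?t m)"
        using L C1s[of "ln (real n)"]
        by (intro suminf_ennreal2 summable_mult) (auto simp: mangoldt_nonneg intro!: mult_nonneg_nonneg divide_nonneg_nonneg)
      also have "(\<Sum>m. 2 * L * ?t m) = 2 * L * (\<Sum>m. ?t m)" by (rule suminf_mult[OF C1s])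
      also have "ennreal \<dots> \<le> ennreal (2 * L * C1)"
        using L C1b by (intro ennreal_leI mult_left_mono) auto
      finally show ?thesis .
    qed
    have int: "integrable lborel (\<lambda>y. exp (- \<bar>y\<bar> / L) * (norm (ldseries \<alpha> y))\<^sup>2)"
      using poisson_quadratic_form(1)[OF sf a_int meas, of L] L unfolding A_eq by simp
    have "(\<integral>y. exp (- \<bar>y\<bar> / L) * (norm (ldseries \<alpha> y))\<^sup>2 \<partial>lborel) \<le> 2 * L * C1 * (\<integral>n. norm (a n) \<partial>count_space UNIV)"
      using poisson_mean_square_le[OF sf a_int meas _ _ bound] L C1 unfolding A_eq by simp
    also have "(\<integral>n. norm (a n) \<partial>count_space UNIV) = (\<Sum>n. mangoldt n * real n powr (-1 - \<alpha>))"
      using integral_count_space_nat[OF integrable_norm[OF a_int]] by (simp add: a_norm)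
    also have "2 * L * C1 * \<dots> \<le> 2 * L * C1 * (36 / \<alpha>)"
      by (rule mult_left_mono[OF mangoldt_powr_sum(2)[OF \<alpha>]]) (use L C1 in simp)
    finally have le: "(\<integral>y. exp (- \<bar>y\<bar> / L) * (norm (ldseries \<alpha> y))\<^sup>2 \<partial>lborel) \<le> 72 * C1 * L / \<alpha>" by (simp add: mult_ac)
    show "(\<integral>\<^sup>+y. ennreal (exp (- \<bar>y\<bar> / L) * (norm (ldseries \<alpha> y))\<^sup>2) \<partial>lborel) \<le> ennreal (72 * C1 * L / \<alpha>)"
      by (subst nn_integral_eq_integral[OF int], simp, rule ennreal_leI, rule le)
  qed (use C1 in simp)
qed

text \<open>The pointwise bound for \<open>F(s)/s\<close> leaves the weight \<open>(1 + |y|) powr (2\<kappa> -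
  2)\<close>, for which \<open>-3/2\<close> suffices as \<open>\<kappa> \<le> 1/4\<close>. Its Fourier transform
  is awkward, but at every point a dyadic mixture of Laplace weights dominates it, and the Laplace weights carry
  the mean-square estimate.\<close>
lemma polynomial_weight_le_laplace_mixture:
  fixes y :: real
  shows "\<exists>k::nat. (1 + \<bar>y\<bar>) powr (-3/2) \<le> exp 2 * 2 powr (- 3 / 2 * real k) * exp (- \<bar>y\<bar> / 2 ^ k)"
proof -
  define t where "t = 1 + \<bar>y\<bar>"
  define k where "k = nat \<lfloor>log 2 t\<rfloor>"
  have t: "t \<ge> 1" by (simp add: t_def)
  then have "0 \<le> log 2 t" by simp
  then have k: "real k \<le> log 2 t" "log 2 t < real k + 1" unfolding k_def by linarith+
  have "2 powr real k \<le> t" using k(1) t by (simp add: le_log_iff)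
  have "t < 2 powr (real k + 1)" using k(2) t by (simp add: log_less_iff)
  then have t2: "t < 2 * 2 ^ k" by (simp add: powr_add powr_realpow)
  have "\<bar>y\<bar> / 2 ^ k \<le> 2" using t2 by (simp add: t_def divide_simps)
  then have 1: "1 \<le> exp 2 * exp (- \<bar>y\<bar> / 2 ^ k)" by (simp add: exp_add[symmetric])
  have "t powr (-3/2) \<le> (2 powr real k) powr (-3/2)"
    using \<open>2 powr real k \<le> t\<close> by (intro powr_mono2') auto
  also have "\<dots> = 2 powr (- 3 / 2 * real k)" by (simp add: powr_powr mult_ac)
  also have "\<dots> \<le> 2 powr (- 3 / 2 * real k) * (exp 2 * exp (- \<bar>y\<bar> / 2 ^ k))"
    using mult_left_mono[OF 1, of "2 powr (- 3 / 2 * real k)"] by simp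
  finally show ?thesis unfolding t_def by (intro exI[of _ k]) (simp add: mult_ac)
qed

lemma ldseries_mean_square:
  obtains C where "C > 0" and
    "\<And>\<alpha>. 0 < \<alpha> \<Longrightarrow> \<alpha> \<le> 1 \<Longrightarrow>
       (\<integral>\<^sup>+y. ennreal ((1 + \<bar>y\<bar>) powr (-3/2) * (norm (ldseries \<alpha> y))\<^sup>2) \<partial>lborel) \<le> ennreal (C / \<alpha>)"
proof -
  obtain C where C: "C > 0" and le: "\<And>\<alpha> L. 0 < \<alpha> \<Longrightarrow> \<alpha> \<le> 1 \<Longrightarrow> 1 \<le> L \<Longrightarrow>
       (\<integral>\<^sup>+y. ennreal (exp (- \<bar>y\<bar> / L) * (norm (ldseries \<alpha> y))\<^sup>2) \<partial>lborel) \<le> ennreal (C * L / \<alpha>)"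
    by (rule ldseries_laplace_mean_square, rule that)
  define q :: real where "q = 2 powr (- 1 / 2)"
  have q: "0 < q" "q < 1" unfolding q_def by (auto simp: powr_less_one)
  define c where "c = (\<lambda>k::nat. exp 2 * 2 powr (- 3 / 2 * real k) :: real)"
  have c0: "c k \<ge> 0" for k by (simp add: c_def)
  have cq: "c k * 2 ^ k = exp 2 * q ^ k" for k
  proof -
    have "2 powr (- 3 / 2 * real k) * 2 powr real k = (2 :: real) powr (- 1 / 2 * real k)"
      by (simp add: powr_add[symmetric] algebra_simps)
    also have "\<dots> = q powr real k" unfolding q_def by (simp add: powr_powr)
    also have "\<dots> = q ^ k" using q by (simp add: powr_realpow)
    finally show ?thesis by (simp add: c_def powr_realpow)
  qed
  show ?thesis
  proof (rule that[of "exp 2 * (1 / (1 - q)) * C"])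
    fix \<alpha> :: real assume \<alpha>: "0 < \<alpha>" "\<alpha> \<le> 1"
    have [measurable]: "(\<lambda>y. ldseries \<alpha> y) \<in> borel_measurable borel" by measurable
    let ?g = "\<lambda>y. (norm (ldseries \<alpha> y))\<^sup>2"
    have "(\<integral>\<^sup>+y. ennreal ((1 + \<bar>y\<bar>) powr (-3/2) * ?g y) \<partial>lborel)
        \<le> (\<integral>\<^sup>+y. (\<Sum>k. ennreal (c k) * ennreal (exp (- \<bar>y\<bar> / 2 ^ k) * ?g y)) \<partial>lborel)"
    proof (intro nn_integral_mono)
      fix y :: real
      obtain k :: nat where "(1 + \<bar>y\<bar>) powr (-3/2) \<le> c k * exp (- \<bar>y\<bar> / 2 ^ k)"
        using polynomial_weight_le_laplace_mixture[of y] unfolding c_def by blast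
      then have "(1 + \<bar>y\<bar>) powr (-3/2) * ?g y \<le> (c k * exp (- \<bar>y\<bar> / 2 ^ k)) * ?g y"
        by (rule mult_right_mono) simp
      also have "\<dots> = c k * (exp (- \<bar>y\<bar> / 2 ^ k) * ?g y)" by (rule mult.assoc)
      finally have "(1 + \<bar>y\<bar>) powr (-3/2) * ?g y \<le> c k * (exp (- \<bar>y\<bar> / 2 ^ k) * ?g y)" .
      then have "ennreal ((1 + \<bar>y\<bar>) powr (-3/2) * ?g y) \<le> ennreal (c k) * ennreal (exp (- \<bar>y\<bar> / 2 ^ k) * ?g y)"
        using c0 by (subst ennreal_mult[symmetric]) (auto intro: ennreal_leI)
      also have "\<dots> \<le> (\<Sum>k. ennreal (c k) * ennreal (exp (- \<bar>y\<bar> / 2 ^ k) * ?g y))"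
        using sum_le_suminf[of "\<lambda>k. ennreal (c k) * ennreal (exp (- \<bar>y\<bar> / 2 ^ k) * ?g y)" "{k}"] by simp
      finally show "ennreal ((1 + \<bar>y\<bar>) powr (-3/2) * ?g y)
          \<le> (\<Sum>k. ennreal (c k) * ennreal (exp (- \<bar>y\<bar> / 2 ^ k) * ?g y))" .
    qed
    also have "\<dots> = (\<Sum>k. \<integral>\<^sup>+y. ennreal (c k) * ennreal (exp (- \<bar>y\<bar> / 2 ^ k) * ?g y) \<partial>lborel)"
      by (rule nn_integral_suminf) measurable
    also have "\<dots> = (\<Sum>k. ennreal (c k) * (\<integral>\<^sup>+y. ennreal (exp (- \<bar>y\<bar> / 2 ^ k) * ?g y) \<partial>lborel))"
      by (intro suminf_cong nn_integral_cmult) measurable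
    also have "\<dots> \<le> (\<Sum>k. ennreal (exp 2 * q ^ k * (C / \<alpha>)))"
    proof (intro suminf_le)
      fix k :: nat
      have "ennreal (c k) * (\<integral>\<^sup>+y. ennreal (exp (- \<bar>y\<bar> / 2 ^ k) * ?g y) \<partial>lborel) \<le> ennreal (c k) * ennreal (C * 2 ^ k / \<alpha>)"
        using \<alpha> by (intro mult_left_mono le) auto
      also have "\<dots> = ennreal (c k * 2 ^ k * (C / \<alpha>))"
        using c0 C \<alpha> by (subst ennreal_mult[symmetric]) (auto simp: mult_ac)
      finally show "ennreal (c k) * (\<integral>\<^sup>+y. ennreal (exp (- \<bar>y\<bar> / 2 ^ k) * ?g y) \<partial>lborel) \<le> ennreal (exp 2 * q ^ k * (C / \<alpha>))"
        unfolding cq .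
    qed auto
    also have "\<dots> = ennreal (\<Sum>k. exp 2 * q ^ k * (C / \<alpha>))"
      using q C \<alpha> by (intro suminf_ennreal2 summable_mult2 summable_mult summable_geometric) auto
    also have "(\<Sum>k. exp 2 * q ^ k * (C / \<alpha>)) = exp 2 * (1 / (1 - q)) * (C / \<alpha>)"
    proof -
      have "(\<lambda>k. exp 2 * q ^ k * (C / \<alpha>)) sums (exp 2 * (1 / (1 - q)) * (C / \<alpha>))"
        using q by (intro sums_mult2 sums_mult geometric_sums) auto
      then show ?thesis by (rule sums_unique[symmetric])
    qed
    finally show "(\<integral>\<^sup>+y. ennreal ((1 + \<bar>y\<bar>) powr (-3/2) * ?g y) \<partial>lborel) \<le> ennreal (exp 2 * (1 / (1 - q)) * C / \<alpha>)"
      by simp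
  qed (use q C in simp)
qed

text \<open>The partial sums are step functions with jumps at the countably many \<open>ln n\<close>.\<close>
lemma log_sum_isCont_AE: "AE v in lborel. isCont log_sum v"
proof -
  have null: "range (\<lambda>n::nat. ln (real n)) \<in> null_sets lborel"
    by (rule countable_imp_null_set_lborel) simp
  show ?thesis
  proof (rule AE_I'[OF null], rule subsetI)
    fix v assume "v \<in> {v \<in> space lborel. \<not> isCont log_sum v}"
    then have nc: "\<not> isCont log_sum v" by simp
    show "v \<in> range (\<lambda>n::nat. ln (real n))"
    proof (rule ccontr)
      assume v: "v \<notin> range (\<lambda>n::nat. ln (real n))"
      have "\<forall>\<^sub>F w in nhds v. (ln (real n) \<le> w) = (ln (real n) \<le> v)" for n :: nat
      proof (cases "ln (real n) < v")
        case True
        then show ?thesis using eventually_nhds_in_open[of "{ln (real n)<..}" v] by (auto elim!: eventually_mono)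
      next
        case False
        then have "v < ln (real n)" using v by (metis linorder_neqE_linordered_idom rangeI)
        then show ?thesis using eventually_nhds_in_open[of "{..<ln (real n)}" v] by (auto elim!: eventually_mono)
      qed
      then have "\<forall>\<^sub>F w in nhds v. \<forall>n\<in>log_upto (v + 1). (ln (real n) \<le> w) = (ln (real n) \<le> v)"
        by (intro eventually_ball_finite) auto
      moreover have "\<forall>\<^sub>F w in nhds v. w < v + 1"
        using eventually_nhds_in_open[of "{..<v + 1}" v] by (auto elim!: eventually_mono)
      ultimately have "\<forall>\<^sub>F w in nhds v. log_sum w = log_sum v"
      proof eventually_elim
        case (elim w)
        then have "log_upto w = log_upto v" by (force simp: log_upto_def)
        then show ?case by (simp add: log_sum_def)
      qed
      then have "isCont log_sum v = isCont (\<lambda>_. log_sum v) v" by (rule isCont_cong)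
      then show False using nc by simp
    qed
  qed
qed

text \<open>Plancherel's inequality, with the pointwise bound for \<open>F\<close> and the mean-square bound for
  \<open>F'/F\<close>. Bounding \<open>F\<close> pointwise and only \<open>F'/F\<close> on average is essential:
  the mean square of \<open>F'/F\<close> is \<open>O(1/\<alpha>)\<close>, whereas its maximum can be as large as
  \<open>1/\<alpha>\<close>.\<close>
lemma log_sum_mean_square:
  obtains C where "C > 0" and
    "\<And>\<alpha>. 0 < \<alpha> \<Longrightarrow> \<alpha> \<le> 1 \<Longrightarrow>
      (\<integral>\<^sup>+v. ennreal ((norm (log_sum v))\<^sup>2 * exp (- 2 * (1 + \<alpha>) * v)) \<partial>lborel)
         \<le> ennreal (C / \<alpha> ^ 3 * exp (- 2 * \<kappa> * recip_upto Q \<alpha>))"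
proof -
  obtain CF where CF: "CF > 0" and F_le: "\<And>\<alpha> y. 0 < \<alpha> \<Longrightarrow> \<alpha> \<le> 1 \<Longrightarrow>
       norm (dseries \<alpha> y) \<le> CF / \<alpha> * exp (- \<kappa> * recip_upto Q \<alpha>) * (1 + \<bar>y\<bar>) powr \<kappa>"
    by (rule norm_dseries_le, rule that)
  obtain CG where CG: "CG > 0" and G_le: "\<And>\<alpha>. 0 < \<alpha> \<Longrightarrow> \<alpha> \<le> 1 \<Longrightarrow>
       (\<integral>\<^sup>+y. ennreal ((1 + \<bar>y\<bar>) powr (-3/2) * (norm (ldseries \<alpha> y))\<^sup>2) \<partial>lborel) \<le> ennreal (CG / \<alpha>)"
    by (rule ldseries_mean_square, rule that)
  define I where "I = (\<integral>z. 1 / (1 + z\<^sup>2) \<partial>lborel :: real)"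
  have "I \<noteq> 0"
  proof
    assume "I = 0"
    then have "AE z in lborel. 1 / (1 + z\<^sup>2) = (0::real)"
      unfolding I_def using integrable_cauchy_kernel by (subst (asm) integral_nonneg_eq_0_iff_AE) auto
    then have "AE z in lborel. (z::real) \<in> {}"
      by eventually_elim (simp add: add_nonneg_eq_0_iff)
    then have "emeasure lborel (UNIV :: real set) = 0"
      by (subst (asm) AE_iff_null) (auto simp: null_sets_def)
    then show False by simp
  qed
  moreover have "I \<ge> 0" unfolding I_def by (intro integral_nonneg_AE) auto
  ultimately have I: "I > 0" by simp
  show ?thesis
  proof (rule that[of "2 * CF\<^sup>2 * CG / (2 * I)"])
    fix \<alpha> :: real assume \<alpha>: "0 < \<alpha>" "\<alpha> \<le> 1"
    define B where "B = CF / \<alpha> * exp (- \<kappa> * recip_upto Q \<alpha>)"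
    have B: "B > 0" using CF \<alpha> by (simp add: B_def)
    define g where "g = (\<lambda>v. log_sum v * of_real (exp (- ((1 + \<alpha>) * v))))"
    have g_fourier: "g v * cis (- (y * v)) = log_sum v * exp (- (Complex (1 + \<alpha>) y * of_real v))" for v y
    proof -
      have "- (Complex (1 + \<alpha>) y * of_real v) = of_real (- ((1 + \<alpha>) * v)) + \<i> * of_real (- (y * v))"
        by (simp add: complex_eq_iff)
      then show ?thesis unfolding g_def cis_conv_exp by (simp only: exp_add exp_of_real mult.assoc)
    qed
    have g_int: "integrable lborel g"
      using log_sum_transform(1)[OF \<alpha>, of 0] unfolding g_fourier[symmetric] by simp
    have g_hat: "(\<integral>v. g v * cis (- (y * v)) \<partial>lborel) = dseries \<alpha> y / Complex (1 + \<alpha>) y * ldseries \<alpha> y" for y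
      unfolding g_fourier by (rule log_sum_transform(2)[OF \<alpha>])
    have g_bounded: "norm (g v) \<le> 1 / \<alpha>" for v
    proof (cases "v \<ge> 0")
      case True
      have "norm (g v) = norm (log_sum v) * exp (- ((1 + \<alpha>) * v))" by (simp add: g_def norm_mult)
      also have "\<dots> \<le> v * exp v * exp (- ((1 + \<alpha>) * v))" using norm_log_sum_le[OF True] by (intro mult_right_mono) auto
      also have "\<dots> = v * exp (- (\<alpha> * v))" by (simp add: mult.assoc exp_add[symmetric] algebra_simps)
      also have "\<dots> \<le> 1 / \<alpha>"
      proof -
        have "\<alpha> * v \<le> exp (\<alpha> * v)" using exp_ge_add_one_self[of "\<alpha> * v"] by linarith
        then have "\<alpha> * v * exp (- (\<alpha> * v)) \<le> exp (\<alpha> * v) * exp (- (\<alpha> * v))" by (intro mult_right_mono) auto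
        then show ?thesis using \<alpha> by (simp add: exp_add[symmetric] field_simps)
      qed
      finally show ?thesis .
    qed (use \<alpha> in \<open>simp add: g_def log_sum_negative\<close>)
    have g_cont: "AE v in lborel. isCont g v"
      using log_sum_isCont_AE by eventually_elim (auto simp: g_def intro!: continuous_intros)
    have K: "(\<integral>y. exp (- \<bar>y\<bar> / L) * (norm (\<integral>v. g v * cis (- (y * v)) \<partial>lborel))\<^sup>2 \<partial>lborel) \<le> 2 * B\<^sup>2 * (CG / \<alpha>)"
      if L: "L > 0" for L
    proof -
      let ?J = "\<integral>y. exp (- \<bar>y\<bar> / L) * (norm (\<integral>v. g v * cis (- (y * v)) \<partial>lborel))\<^sup>2 \<partial>lborel"
      have int: "integrable lborel (\<lambda>y. exp (- \<bar>y\<bar> / L) * (norm (\<integral>v. g v * cis (- (y * v)) \<partial>lborel))\<^sup>2)"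
        using poisson_quadratic_form(1)[OF sigma_finite_lborel g_int, of "\<lambda>v. v" L] L by simp
      have "ennreal ?J = (\<integral>\<^sup>+y. ennreal (exp (- \<bar>y\<bar> / L) * (norm (\<integral>v. g v * cis (- (y * v)) \<partial>lborel))\<^sup>2) \<partial>lborel)"
        by (rule nn_integral_eq_integral[OF int, symmetric]) simp
      also have "\<dots> \<le> (\<integral>\<^sup>+y. ennreal (2 * B\<^sup>2) * ennreal ((1 + \<bar>y\<bar>) powr (-3/2) * (norm (ldseries \<alpha> y))\<^sup>2) \<partial>lborel)"
      proof (intro nn_integral_mono)
        fix y :: real
        have t: "0 < 1 + \<bar>y\<bar>" "1 \<le> 1 + \<bar>y\<bar>" by auto
        have s_ge: "(1 + \<bar>y\<bar>)\<^sup>2 / 2 \<le> (norm (Complex (1 + \<alpha>) y))\<^sup>2"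
        proof -
          have "(1 + \<bar>y\<bar>)\<^sup>2 \<le> 2 * (1 + y\<^sup>2)"
            using zero_le_power2[of "1 - \<bar>y\<bar>"] by (simp add: power2_eq_square algebra_simps)
          moreover have "1\<^sup>2 \<le> (1 + \<alpha>)\<^sup>2" using \<alpha> by (intro power_mono) auto
          ultimately show ?thesis unfolding cmod_power2 by simp
        qed
        have "(norm (dseries \<alpha> y))\<^sup>2 \<le> (B * (1 + \<bar>y\<bar>) powr \<kappa>)\<^sup>2"
          using F_le[OF \<alpha>, of y] unfolding B_def by (intro power_mono) auto
        also have "\<dots> = B\<^sup>2 * (1 + \<bar>y\<bar>) powr (2 * \<kappa>)"
          using t by (simp add: power_mult_distrib powr_power)
        also have "\<dots> \<le> B\<^sup>2 * (1 + \<bar>y\<bar>) powr (1 / 2)"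
          using t \<kappa>_bounds by (intro mult_left_mono powr_mono) auto
        finally have "(norm (dseries \<alpha> y))\<^sup>2 / (norm (Complex (1 + \<alpha>) y))\<^sup>2
            \<le> B\<^sup>2 * (1 + \<bar>y\<bar>) powr (1 / 2) / ((1 + \<bar>y\<bar>)\<^sup>2 / 2)"
          using s_ge t by (intro frac_le) auto
        also have "\<dots> = 2 * B\<^sup>2 * ((1 + \<bar>y\<bar>) powr (1 / 2) / (1 + \<bar>y\<bar>) powr 2)"
          using t by (simp add: powr_numeral)
        also have "(1 + \<bar>y\<bar>) powr (1 / 2) / (1 + \<bar>y\<bar>) powr 2 = (1 + \<bar>y\<bar>) powr (-3/2)"
          by (subst powr_diff[symmetric]) simp
        finally have "(norm (dseries \<alpha> y))\<^sup>2 / (norm (Complex (1 + \<alpha>) y))\<^sup>2 * (norm (ldseries \<alpha> y))\<^sup>2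
            \<le> 2 * B\<^sup>2 * (1 + \<bar>y\<bar>) powr (-3/2) * (norm (ldseries \<alpha> y))\<^sup>2"
          by (rule mult_right_mono) simp
        moreover have "exp (- \<bar>y\<bar> / L) * (norm (\<integral>v. g v * cis (- (y * v)) \<partial>lborel))\<^sup>2
            \<le> 1 * ((norm (dseries \<alpha> y))\<^sup>2 / (norm (Complex (1 + \<alpha>) y))\<^sup>2 * (norm (ldseries \<alpha> y))\<^sup>2)"
          unfolding g_hat using L by (intro mult_mono) (auto simp: norm_mult norm_divide power_mult_distrib power_divide)
        ultimately have "exp (- \<bar>y\<bar> / L) * (norm (\<integral>v. g v * cis (- (y * v)) \<partial>lborel))\<^sup>2
            \<le> 2 * B\<^sup>2 * ((1 + \<bar>y\<bar>) powr (-3/2) * (norm (ldseries \<alpha> y))\<^sup>2)" by (simp only: mult_1_left mult.assoc)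
        then show "ennreal (exp (- \<bar>y\<bar> / L) * (norm (\<integral>v. g v * cis (- (y * v)) \<partial>lborel))\<^sup>2)
            \<le> ennreal (2 * B\<^sup>2) * ennreal ((1 + \<bar>y\<bar>) powr (-3/2) * (norm (ldseries \<alpha> y))\<^sup>2)"
          by (subst ennreal_mult[symmetric]) (auto intro: ennreal_leI)
      qed
      also have "\<dots> = ennreal (2 * B\<^sup>2) * (\<integral>\<^sup>+y. ennreal ((1 + \<bar>y\<bar>) powr (-3/2) * (norm (ldseries \<alpha> y))\<^sup>2) \<partial>lborel)"
        by (rule nn_integral_cmult) measurable
      also have "\<dots> \<le> ennreal (2 * B\<^sup>2) * ennreal (CG / \<alpha>)"
        by (intro mult_left_mono G_le[OF \<alpha>]) auto
      also have "\<dots> = ennreal (2 * B\<^sup>2 * (CG / \<alpha>))"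
        using CG \<alpha> by (subst ennreal_mult[symmetric]) auto
      finally show ?thesis using CG \<alpha> by (subst (asm) ennreal_le_iff) auto
    qed
    have g_sq_int: "integrable lborel (\<lambda>v. (norm (g v))\<^sup>2)"
      by (rule plancherel_le(1)[OF g_int g_bounded g_cont K])
    have norm_g: "(norm (g v))\<^sup>2 = (norm (log_sum v))\<^sup>2 * exp (- 2 * (1 + \<alpha>) * v)" for v
    proof -
      have "(exp (- ((1 + \<alpha>) * v)))\<^sup>2 = exp (- 2 * (1 + \<alpha>) * v)"
        by (simp add: power2_eq_square exp_add[symmetric] algebra_simps)
      then show ?thesis by (simp add: g_def norm_mult power_mult_distrib)
    qed
    have B2: "B\<^sup>2 = CF\<^sup>2 / \<alpha>\<^sup>2 * exp (- 2 * \<kappa> * recip_upto Q \<alpha>)"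
    proof -
      have "(exp (- \<kappa> * recip_upto Q \<alpha>))\<^sup>2 = exp (- 2 * \<kappa> * recip_upto Q \<alpha>)"
        by (simp add: power2_eq_square exp_add[symmetric])
      then show ?thesis by (simp add: B_def power_mult_distrib power_divide)
    qed
    have "2 * I * (\<integral>v. (norm (g v))\<^sup>2 \<partial>lborel) \<le> 2 * B\<^sup>2 * (CG / \<alpha>)" 
      unfolding I_def by (rule plancherel_le(2)[OF g_int g_bounded g_cont K])
    then have "(\<integral>v. (norm (g v))\<^sup>2 \<partial>lborel) \<le> 2 * B\<^sup>2 * (CG / \<alpha>) / (2 * I)"
      using I by (subst pos_le_divide_eq) (auto simp: mult.commute)
    also have "\<dots> = 2 * CF\<^sup>2 * CG / (2 * I) / \<alpha> ^ 3 * exp (- 2 * \<kappa> * recip_upto Q \<alpha>)"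
      unfolding B2 by (simp add: power2_eq_square power3_eq_cube mult_ac)
    finally have fin: "(\<integral>v. (norm (g v))\<^sup>2 \<partial>lborel) \<le> 2 * CF\<^sup>2 * CG / (2 * I) / \<alpha> ^ 3 * exp (- 2 * \<kappa> * recip_upto Q \<alpha>)" .
    show "(\<integral>\<^sup>+v. ennreal ((norm (log_sum v))\<^sup>2 * exp (- 2 * (1 + \<alpha>) * v)) \<partial>lborel)
         \<le> ennreal (2 * CF\<^sup>2 * CG / (2 * I) / \<alpha> ^ 3 * exp (- 2 * \<kappa> * recip_upto Q \<alpha>))"
      unfolding norm_g[symmetric]
      using nn_integral_eq_integral[OF g_sq_int] fin by (simp add: ennreal_leI)
  qed (use CF CG I in simp)
qed

end

section \<open>From mean squares to individual partial sums\<close>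

context root_valued
begin

lemma recip_upto_nonneg: "0 \<le> recip_upto Q \<alpha>"
  unfolding recip_upto_def by (intro sum_nonneg) simp

text \<open>Savings of the size considered here never outweigh \<open>1/\<alpha>\<close>, since
  \<open>recip_upto Q \<alpha>\<close> is at most
  \<open>ln (1/\<alpha>) + O(1)\<close>.\<close>
lemma saving_lower_bound:
  assumes \<alpha>: "0 < \<alpha>" "\<alpha> \<le> 1" and c: "0 \<le> c" "c \<le> 1"
  shows "exp (- (mertens_error + 1)) \<le> 1 / \<alpha> * exp (- c * recip_upto Q \<alpha>)"
proof -
  have "0 \<le> ln (1 / \<alpha>)" using \<alpha> by simp
  have "c * recip_upto Q \<alpha> \<le> 1 * recip_upto Q \<alpha>" using c recip_upto_nonneg by (intro mult_right_mono)
  then have "c * recip_upto Q \<alpha> \<le> ln (1 / \<alpha>) + mertens_error + 1"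
    using recip_upto_le[OF \<alpha>, of Q] by linarith
  then have "exp (- (mertens_error + 1)) \<le> exp (ln (1 / \<alpha>) + - c * recip_upto Q \<alpha>)" by simp
  also have "\<dots> = 1 / \<alpha> * exp (- c * recip_upto Q \<alpha>)" using \<alpha> by (simp only: exp_add exp_ln zero_less_divide_1_iff)
  finally show ?thesis .
qed

text \<open>Up to \<open>U\<close> the trivial bound is used. Beyond it \<open>v * partial_sum v\<close> is
  \<open>log_sum v\<close> up to \<open>exp v\<close>, and the restriction \<open>v \<le> 2/\<alpha>\<close>
  keeps the damping \<open>exp (- 2\<alpha>v)\<close> bounded below.\<close>
lemma partial_sum_square_split:
  assumes \<alpha>: "0 < \<alpha>" "\<alpha> \<le> 1" and U: "U > 0" and v: "0 \<le> v" "v \<le> 2 / \<alpha>"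
  shows "(norm (partial_sum v))\<^sup>2 * exp (- 2 * v)
     \<le> indicator {0..U} v + 2 * exp 4 / U\<^sup>2 * ((norm (log_sum v))\<^sup>2 * exp (- 2 * (1 + \<alpha>) * v)) + 2 / v\<^sup>2 * indicator {U..} v"
proof (cases "v \<le> U")
  case True
  have "(norm (partial_sum v))\<^sup>2 * exp (- 2 * v) \<le> (exp v)\<^sup>2 * exp (- 2 * v)"
    using norm_partial_sum_le[of v] by (intro mult_right_mono power_mono) auto
  also have "\<dots> = 1" by (simp add: power2_eq_square exp_add[symmetric])
  finally have "(norm (partial_sum v))\<^sup>2 * exp (- 2 * v) \<le> indicator {0..U} v" using True v by simp
  moreover have "0 \<le> 2 * exp 4 / U\<^sup>2 * ((norm (log_sum v))\<^sup>2 * exp (- 2 * (1 + \<alpha>) * v))" "0 \<le> 2 / v\<^sup>2 * indicator {U..} v" by simp_all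
  ultimately show ?thesis by linarith
next
  case False
  then have vU: "v > 0" "U < v" using U by auto
  have "(v * norm (partial_sum v))\<^sup>2 \<le> (norm (log_sum v) + exp v)\<^sup>2" using partial_sum_times_log[OF v(1)] v by (intro power_mono) auto
  also have "\<dots> \<le> 2 * (norm (log_sum v))\<^sup>2 + 2 * (exp v)\<^sup>2"
    using zero_le_power2[of "norm (log_sum v) - exp v"] by (simp add: power2_eq_square algebra_simps)
  finally have "(norm (partial_sum v))\<^sup>2 \<le> (2 * (norm (log_sum v))\<^sup>2 + 2 * (exp v)\<^sup>2) / v\<^sup>2"
    using vU by (simp add: power_mult_distrib field_simps)
  then have "(norm (partial_sum v))\<^sup>2 * exp (- 2 * v) \<le> (2 * (norm (log_sum v))\<^sup>2 + 2 * (exp v)\<^sup>2) / v\<^sup>2 * exp (- 2 * v)"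
    by (rule mult_right_mono) simp
  also have "\<dots> = 2 / v\<^sup>2 * ((norm (log_sum v))\<^sup>2 * exp (- 2 * v)) + 2 / v\<^sup>2 * ((exp v)\<^sup>2 * exp (- 2 * v))"
    by (simp add: add_divide_distrib algebra_simps)
  also have "(exp v)\<^sup>2 * exp (- 2 * v) = 1" by (simp add: power2_eq_square exp_add[symmetric])
  also have "2 / v\<^sup>2 * ((norm (log_sum v))\<^sup>2 * exp (- 2 * v)) \<le> 2 / U\<^sup>2 * ((norm (log_sum v))\<^sup>2 * (exp 4 * exp (- 2 * (1 + \<alpha>) * v)))"
  proof (intro mult_mono order_refl)
    show "2 / v\<^sup>2 \<le> 2 / U\<^sup>2" using vU U by (intro divide_left_mono power_mono mult_pos_pos) auto
    have "\<alpha> * v \<le> \<alpha> * (2 / \<alpha>)" using v \<alpha> by (intro mult_left_mono) auto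
    then have "- 2 * v \<le> 4 + (- 2 * (1 + \<alpha>) * v)" using \<alpha> by (simp add: algebra_simps)
    then show "exp (- 2 * v) \<le> exp 4 * exp (- 2 * (1 + \<alpha>) * v)" unfolding exp_add[symmetric] exp_le_cancel_iff .
  qed auto
  finally show ?thesis using vU by (simp add: mult_ac)
qed

text \<open>The three terms of \<open>partial_sum_square_split\<close> integrate to \<open>U\<close>, to
  \<open>D ^ 3 / (\<alpha> ^ 3 U\<^sup>2)\<close> and to \<open>1/U\<close> up to constants, where \<open>D ^
  3\<close> is the saving of \<open>log_sum_mean_square\<close>. The choice \<open>U = D/\<alpha>\<close> makes
  the first two equal, and the third is no larger up to a constant because \<open>U\<close> is bounded
  below.\<close>
lemma partial_sum_mean_square:
  obtains C where "C > 0" and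
    "\<And>\<alpha>. 0 < \<alpha> \<Longrightarrow> \<alpha> \<le> 1 \<Longrightarrow>
      (\<integral>\<^sup>+v. ennreal ((norm (partial_sum v))\<^sup>2 * exp (- 2 * v)) * indicator {0..2 / \<alpha>} v \<partial>lborel)
         \<le> ennreal (C / \<alpha> * exp (- (2 / 3 * \<kappa>) * recip_upto Q \<alpha>))"
proof -
  obtain C where C: "C > 0" and le: "\<And>\<alpha>. 0 < \<alpha> \<Longrightarrow> \<alpha> \<le> 1 \<Longrightarrow>
      (\<integral>\<^sup>+v. ennreal ((norm (log_sum v))\<^sup>2 * exp (- 2 * (1 + \<alpha>) * v)) \<partial>lborel)
         \<le> ennreal (C / \<alpha> ^ 3 * exp (- 2 * \<kappa> * recip_upto Q \<alpha>))"
    by (rule log_sum_mean_square, rule that)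
  define m0 where "m0 = mertens_error + 1"
  show ?thesis
  proof (rule that[of "1 + 2 * exp 4 * C + 2 * exp (2 * m0)"])
    fix \<alpha> :: real assume \<alpha>: "0 < \<alpha>" "\<alpha> \<le> 1"
    define D where "D = exp (- (2 / 3 * \<kappa>) * recip_upto Q \<alpha>)"
    define U where "U = 1 / \<alpha> * D"
    have D: "D > 0" by (simp add: D_def)
    have D3: "exp (- 2 * \<kappa> * recip_upto Q \<alpha>) = D ^ 3"
      unfolding D_def exp_of_nat_mult[symmetric] by simp
    have U: "U > 0" using \<alpha> D by (simp add: U_def)
    have U_ge: "exp (- m0) \<le> U"
      unfolding U_def D_def m0_def using \<kappa>_bounds by (intro saving_lower_bound \<alpha>) auto
    then have "exp (- m0) * exp (- m0) \<le> U * U" using U by (intro mult_mono) auto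
    then have "exp (2 * m0) * (exp (- m0) * exp (- m0)) \<le> exp (2 * m0) * (U * U)" by (intro mult_left_mono) auto
    then have "1 \<le> exp (2 * m0) * (U * U)" by (simp add: exp_add[symmetric])
    then have U_inv: "1 / U \<le> exp (2 * m0) * U" using U by (simp add: field_simps)
    let ?h = "\<lambda>v. (norm (log_sum v))\<^sup>2 * exp (- 2 * (1 + \<alpha>) * v)"
    have "(\<integral>\<^sup>+v. ennreal ((norm (partial_sum v))\<^sup>2 * exp (- 2 * v)) * indicator {0..2 / \<alpha>} v \<partial>lborel)
        \<le> (\<integral>\<^sup>+v. indicator {0..U} v + ennreal (2 * exp 4 / U\<^sup>2) * ennreal (?h v) + ennreal (2 / v\<^sup>2) * indicator {U..} v \<partial>lborel)"
    proof (intro nn_integral_mono)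
      fix v :: real
      show "ennreal ((norm (partial_sum v))\<^sup>2 * exp (- 2 * v)) * indicator {0..2 / \<alpha>} v
          \<le> indicator {0..U} v + ennreal (2 * exp 4 / U\<^sup>2) * ennreal (?h v) + ennreal (2 / v\<^sup>2) * indicator {U..} v"
      proof (cases "v \<in> {0..2 / \<alpha>}")
        case True
        then have "(norm (partial_sum v))\<^sup>2 * exp (- 2 * v)
            \<le> indicator {0..U} v + 2 * exp 4 / U\<^sup>2 * ?h v + 2 / v\<^sup>2 * indicator {U..} v"
          using partial_sum_square_split[OF \<alpha> U, of v] by simp
        then have "ennreal ((norm (partial_sum v))\<^sup>2 * exp (- 2 * v))
            \<le> ennreal (indicator {0..U} v + 2 * exp 4 / U\<^sup>2 * ?h v + 2 / v\<^sup>2 * indicator {U..} v)"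
          by (rule ennreal_leI)
        also have "\<dots> = ennreal (indicator {0..U} v) + ennreal (2 * exp 4 / U\<^sup>2 * ?h v) + ennreal (2 / v\<^sup>2 * indicator {U..} v)"
          using U by (simp add: ennreal_plus[symmetric] del: ennreal_plus)
        also have "\<dots> = indicator {0..U} v + ennreal (2 * exp 4 / U\<^sup>2) * ennreal (?h v) + ennreal (2 / v\<^sup>2) * indicator {U..} v"
          using U by (subst (1 2) ennreal_mult) (auto simp: ennreal_indicator)
        finally show ?thesis using True by simp
      qed simp
    qed
    also have "\<dots> = (\<integral>\<^sup>+v. indicator {0..U} v \<partial>lborel) + (\<integral>\<^sup>+v. ennreal (2 * exp 4 / U\<^sup>2) * ennreal (?h v) \<partial>lborel)
        + (\<integral>\<^sup>+v. ennreal (2 / v\<^sup>2) * indicator {U..} v \<partial>lborel)"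
      by (subst nn_integral_add, measurable, subst nn_integral_add, measurable)
    also have "(\<integral>\<^sup>+v. indicator {0..U} v \<partial>lborel) = ennreal U" using U by simp
    also have "(\<integral>\<^sup>+v. ennreal (2 * exp 4 / U\<^sup>2) * ennreal (?h v) \<partial>lborel) = ennreal (2 * exp 4 / U\<^sup>2) * (\<integral>\<^sup>+v. ennreal (?h v) \<partial>lborel)"
      by (rule nn_integral_cmult) measurable
    also have "(\<integral>\<^sup>+v. ennreal (2 / v\<^sup>2) * indicator {U..} v \<partial>lborel) = ennreal (0 - (- 2 / U))"
    proof (rule nn_integral_FTC_atLeast)
      show "((\<lambda>v::real. - 2 / v) \<longlongrightarrow> 0) at_top" by real_asymp
      show "DERIV (\<lambda>v. - 2 / v) v :> 2 / v\<^sup>2" if "U \<le> v" for v :: real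
        using that U by (auto intro!: derivative_eq_intros simp: power2_eq_square)
    qed auto
    also have "ennreal U + ennreal (2 * exp 4 / U\<^sup>2) * (\<integral>\<^sup>+v. ennreal (?h v) \<partial>lborel) + ennreal (0 - (- 2 / U))
        \<le> ennreal U + ennreal (2 * exp 4 / U\<^sup>2) * ennreal (C / \<alpha> ^ 3 * D ^ 3) + ennreal (2 * (exp (2 * m0) * U))"
      using le[OF \<alpha>] U_inv unfolding D3 by (intro add_mono mult_left_mono ennreal_leI) auto
    also have "ennreal (2 * exp 4 / U\<^sup>2) * ennreal (C / \<alpha> ^ 3 * D ^ 3) = ennreal (2 * exp 4 * C * U)"
    proof -
      have "2 * exp 4 / U\<^sup>2 * (C / \<alpha> ^ 3 * D ^ 3) = 2 * exp 4 * C * U"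
        using \<alpha> D unfolding U_def by (simp add: field_simps power2_eq_square power3_eq_cube)
      then show ?thesis using U C \<alpha> D by (subst ennreal_mult[symmetric]) auto
    qed
    also have "ennreal U + ennreal (2 * exp 4 * C * U) + ennreal (2 * (exp (2 * m0) * U))
        = ennreal ((1 + 2 * exp 4 * C + 2 * exp (2 * m0)) * U)"
      using U C by (simp add: ennreal_plus[symmetric] algebra_simps del: ennreal_plus)
    also have "(1 + 2 * exp 4 * C + 2 * exp (2 * m0)) * U = (1 + 2 * exp 4 * C + 2 * exp (2 * m0)) / \<alpha> * D"
      by (simp add: U_def)
    finally show "(\<integral>\<^sup>+v. ennreal ((norm (partial_sum v))\<^sup>2 * exp (- 2 * v)) * indicator {0..2 / \<alpha>} v \<partial>lborel)
        \<le> ennreal ((1 + 2 * exp 4 * C + 2 * exp (2 * m0)) / \<alpha> * exp (- (2 / 3 * \<kappa>) * recip_upto Q \<alpha>))"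
      unfolding D_def .
  qed (use C in \<open>simp add: add_pos_pos\<close>)
qed

end

lemma mangoldt_window:
  assumes "finite A" and A: "\<And>d. d \<in> A \<Longrightarrow> d > 0" and "c > 0"
  shows "(\<Sum>d\<in>{d\<in>A. \<bar>ln (real d) - ln (real c)\<bar> \<le> 1}. mangoldt d / real d) \<le> (24 :: real)"
proof -
  let ?L = "{d\<in>A. real c / exp 1 \<le> real d \<and> real d \<le> exp 1 * (real c / exp 1)}"
  let ?R = "{d\<in>A. real c \<le> real d \<and> real d \<le> exp 1 * real c}"
  have "{d\<in>A. \<bar>ln (real d) - ln (real c)\<bar> \<le> 1} \<subseteq> ?L \<union> ?R"
  proof
    fix d assume d: "d \<in> {d\<in>A. \<bar>ln (real d) - ln (real c)\<bar> \<le> 1}"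
    then have pos: "real d > 0" "real c > 0" using A assms(3) by auto
    have "ln (real d) \<le> ln (real c) + 1" "ln (real c) \<le> ln (real d) + 1" using d by auto
    then have "exp (ln (real d)) \<le> exp (ln (real c) + 1)" "exp (ln (real c)) \<le> exp (ln (real d) + 1)"
      by (simp_all only: exp_le_cancel_iff)
    then have "real d \<le> exp 1 * real c" "real c \<le> exp 1 * real d" using pos by (simp_all add: exp_add mult.commute)
    then show "d \<in> ?L \<union> ?R" using d by (cases "d \<le> c") (auto simp: field_simps)
  qed
  then have "(\<Sum>d\<in>{d\<in>A. \<bar>ln (real d) - ln (real c)\<bar> \<le> 1}. mangoldt d / real d) \<le> (\<Sum>d\<in>?L \<union> ?R. mangoldt d / real d :: real)"
    using assms(1) by (intro sum_mono2) (auto simp: mangoldt_nonneg)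
  also have "\<dots> \<le> (\<Sum>d\<in>?L. mangoldt d / real d) + (\<Sum>d\<in>?R. mangoldt d / real d)"
    using assms(1) by (subst sum.union_inter[symmetric]) (auto simp: mangoldt_nonneg intro!: sum_nonneg)
  also have "\<dots> \<le> 12 + 12"
    using assms by (intro add_mono mangoldt_block[of _ "real c / exp 1"] mangoldt_block[of _ "real c"]) auto
  finally show ?thesis by simp
qed

text \<open>A substitute, on average, for an upper bound on the number of primes in intervals of relative length
  \<open>\<eta>\<close>. When the square is expanded, the windows of two prime powers overlap in length at most
  \<open>\<eta>\<close>, and only if the prime powers are within a factor \<open>e\<close> of each other;
  Chebyshev's bound counts such pairs.\<close>
lemma mangoldt_short_mean_square:
  assumes \<alpha>: "0 < \<alpha>" "\<alpha> \<le> 1" and \<eta>: "0 < \<eta>" "\<eta> \<le> 1" and A: "finite A" "\<And>d. d \<in> A \<Longrightarrow> d > 0 \<and> \<alpha> * ln (real d) \<le> 2"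
  shows "(\<integral>\<^sup>+w. ennreal ((\<Sum>d\<in>A. mangoldt d / real d * indicator {V - ln (real d)..V + \<eta> - ln (real d)} w)\<^sup>2) \<partial>lborel)
     \<le> ennreal (864 * exp 2 * \<eta> / \<alpha>)"
proof -
  let ?a = "\<lambda>d::nat. mangoldt d / real d :: real"
  let ?I = "\<lambda>d::nat. {V - ln (real d)..V + \<eta> - ln (real d)}"
  have a0: "0 \<le> ?a d" for d by (simp add: mangoldt_nonneg)
  have "(\<integral>\<^sup>+w. ennreal ((\<Sum>d\<in>A. ?a d * indicator (?I d) w)\<^sup>2) \<partial>lborel)
      = (\<integral>\<^sup>+w. (\<Sum>d\<in>A. \<Sum>e\<in>A. ennreal (?a d * ?a e) * indicator (?I d \<inter> ?I e) w) \<partial>lborel)"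
  proof (intro nn_integral_cong)
    fix w :: real
    have "(\<Sum>d\<in>A. ?a d * indicator (?I d) w)\<^sup>2 = (\<Sum>d\<in>A. \<Sum>e\<in>A. ?a d * ?a e * indicator (?I d \<inter> ?I e) w)"
      unfolding power2_eq_square sum_product
      by (intro sum.cong refl) (simp add: indicator_inter_arith del: Int_atLeastAtMost)
    then have "ennreal ((\<Sum>d\<in>A. ?a d * indicator (?I d) w)\<^sup>2) = ennreal (\<Sum>d\<in>A. \<Sum>e\<in>A. ?a d * ?a e * indicator (?I d \<inter> ?I e) w)"
      by (simp only:)
    also have "\<dots> = (\<Sum>d\<in>A. \<Sum>e\<in>A. ennreal (?a d * ?a e * indicator (?I d \<inter> ?I e) w))"
      by (subst sum_ennreal[symmetric]; intro sum_nonneg mult_nonneg_nonneg a0 indicator_pos_le sum.cong refl sum_ennreal[symmetric])+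
    also have "\<dots> = (\<Sum>d\<in>A. \<Sum>e\<in>A. ennreal (?a d * ?a e) * indicator (?I d \<inter> ?I e) w)"
      by (intro sum.cong refl) (auto simp: indicator_def)
    finally show "ennreal ((\<Sum>d\<in>A. ?a d * indicator (?I d) w)\<^sup>2) = (\<Sum>d\<in>A. \<Sum>e\<in>A. ennreal (?a d * ?a e) * indicator (?I d \<inter> ?I e) w)" .
  qed
  also have "\<dots> = (\<Sum>d\<in>A. \<Sum>e\<in>A. \<integral>\<^sup>+w. ennreal (?a d * ?a e) * indicator (?I d \<inter> ?I e) w \<partial>lborel)"
    by (simp add: nn_integral_sum)
  also have "\<dots> \<le> (\<Sum>d\<in>A. \<Sum>e\<in>A. ennreal (if \<bar>ln (real e) - ln (real d)\<bar> \<le> 1 then ?a d * ?a e * \<eta> else 0))"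
  proof (intro sum_mono)
    fix d e
    have "emeasure lborel (?I d \<inter> ?I e) \<le> emeasure lborel (?I d)" by (intro emeasure_mono) auto
    also have "\<dots> = ennreal \<eta>" using \<eta> by simp
    finally have 1: "emeasure lborel (?I d \<inter> ?I e) \<le> ennreal \<eta>" .
    have "?I d \<inter> ?I e = {}" if "\<not> \<bar>ln (real e) - ln (real d)\<bar> \<le> 1" using that \<eta> by auto
    then have 2: "emeasure lborel (?I d \<inter> ?I e) = 0" if "\<not> \<bar>ln (real e) - ln (real d)\<bar> \<le> 1" using that by simp
    have "(\<integral>\<^sup>+w. ennreal (?a d * ?a e) * indicator (?I d \<inter> ?I e) w \<partial>lborel) = ennreal (?a d * ?a e) * emeasure lborel (?I d \<inter> ?I e)"
      by (rule nn_integral_cmult_indicator) simp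
    also have "\<dots> \<le> ennreal (if \<bar>ln (real e) - ln (real d)\<bar> \<le> 1 then ?a d * ?a e * \<eta> else 0)"
    proof (cases "\<bar>ln (real e) - ln (real d)\<bar> \<le> 1")
      case True
      have "ennreal (?a d * ?a e) * emeasure lborel (?I d \<inter> ?I e) \<le> ennreal (?a d * ?a e) * ennreal \<eta>"
        by (intro mult_left_mono 1) simp
      also have "\<dots> = ennreal (?a d * ?a e * \<eta>)"
        using \<eta> by (intro ennreal_mult[symmetric] mult_nonneg_nonneg a0) auto
      finally show ?thesis using True by simp
    next
      case False
      then show ?thesis using 2 by simp
    qed
    finally show "(\<integral>\<^sup>+w. ennreal (?a d * ?a e) * indicator (?I d \<inter> ?I e) w \<partial>lborel)
        \<le> ennreal (if \<bar>ln (real e) - ln (real d)\<bar> \<le> 1 then ?a d * ?a e * \<eta> else 0)" .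
  qed
  also have "\<dots> = ennreal (\<Sum>d\<in>A. \<Sum>e\<in>A. if \<bar>ln (real e) - ln (real d)\<bar> \<le> 1 then ?a d * ?a e * \<eta> else 0)"
  proof -
    have nn: "0 \<le> (if \<bar>ln (real e) - ln (real d)\<bar> \<le> 1 then ?a d * ?a e * \<eta> else 0)" for d e
      by (subst if_split) (intro conjI impI mult_nonneg_nonneg a0 less_imp_le[OF \<eta>(1)] order_refl)
    show ?thesis by (simp only: sum_ennreal[OF nn] sum_ennreal[OF sum_nonneg[OF nn]])
  qed
  also have "(\<Sum>d\<in>A. \<Sum>e\<in>A. if \<bar>ln (real e) - ln (real d)\<bar> \<le> 1 then ?a d * ?a e * \<eta> else 0) \<le> 864 * exp 2 * \<eta> / \<alpha>"
  proof -
    have "(\<Sum>d\<in>A. \<Sum>e\<in>A. if \<bar>ln (real e) - ln (real d)\<bar> \<le> 1 then ?a d * ?a e * \<eta> else 0)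
        = (\<Sum>d\<in>A. ?a d * \<eta> * (\<Sum>e\<in>{e\<in>A. \<bar>ln (real e) - ln (real d)\<bar> \<le> 1}. ?a e))"
    proof (rule sum.cong[OF refl])
      fix d
      have "?a d * \<eta> * (\<Sum>e\<in>{e\<in>A. \<bar>ln (real e) - ln (real d)\<bar> \<le> 1}. ?a e)
          = (\<Sum>e\<in>{e\<in>A. \<bar>ln (real e) - ln (real d)\<bar> \<le> 1}. ?a d * ?a e * \<eta>)"
        unfolding sum_distrib_left by (intro sum.cong refl) simp
      also have "\<dots> = (\<Sum>e\<in>A. if \<bar>ln (real e) - ln (real d)\<bar> \<le> 1 then ?a d * ?a e * \<eta> else 0)"
        by (rule sum.inter_filter[OF A(1)])
      finally show "(\<Sum>e\<in>A. if \<bar>ln (real e) - ln (real d)\<bar> \<le> 1 then ?a d * ?a e * \<eta> else 0)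
          = ?a d * \<eta> * (\<Sum>e\<in>{e\<in>A. \<bar>ln (real e) - ln (real d)\<bar> \<le> 1}. ?a e)" ..
    qed
    also have "\<dots> \<le> (\<Sum>d\<in>A. ?a d * \<eta> * 24)"
      using A \<eta> by (intro sum_mono mult_left_mono mangoldt_window mult_nonneg_nonneg a0) auto
    also have "\<dots> = 24 * \<eta> * (\<Sum>d\<in>A. ?a d)" by (simp add: sum_distrib_left mult_ac)
    also have "(\<Sum>d\<in>A. ?a d) \<le> (\<Sum>d\<in>A. exp 2 * (mangoldt d * real d powr (-1 - \<alpha>)))"
    proof (rule sum_mono)
      fix d assume "d \<in> A"
      then have d: "d > 0" "\<alpha> * ln (real d) \<le> 2" using A(2) by auto
      have "real d powr (-1 - \<alpha>) = exp (- (\<alpha> * ln (real d))) / real d"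
        using d(1) by (simp add: powr_def left_diff_distrib exp_diff exp_minus inverse_eq_divide)
      moreover have "1 \<le> exp 2 * exp (- (\<alpha> * ln (real d)))" using d(2) by (simp add: exp_add[symmetric])
      ultimately have "1 / real d \<le> exp 2 * real d powr (-1 - \<alpha>)"
        using divide_right_mono[of 1 "exp 2 * exp (- (\<alpha> * ln (real d)))" "real d"] by simp
      from mult_left_mono[OF this mangoldt_nonneg] show "?a d \<le> exp 2 * (mangoldt d * real d powr (-1 - \<alpha>))"
        by (simp add: mult_ac)
    qed
    also have "\<dots> = exp 2 * (\<Sum>d\<in>A. mangoldt d * real d powr (-1 - \<alpha>))" by (simp add: sum_distrib_left)
    also have "(\<Sum>d\<in>A. mangoldt d * real d powr (-1 - \<alpha>)) \<le> (\<Sum>n. mangoldt n * real n powr (-1 - \<alpha>))"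
      by (rule sum_le_suminf[OF mangoldt_powr_sum(1)[OF \<alpha>] A(1)]) (simp add: mangoldt_nonneg)
    also have "\<dots> \<le> 36 / \<alpha>" by (rule mangoldt_powr_sum(2)[OF \<alpha>])
    finally show ?thesis using \<eta> by (simp add: mult_ac)
  qed
  finally show ?thesis by (simp add: ennreal_leI)
qed

context root_valued
begin

text \<open>The smoothing error: only the integers between \<open>exp V\<close> and \<open>exp (V +
  \<eta>)\<close> are involved.\<close>
lemma log_sum_increment:
  assumes V: "0 \<le> V" and \<eta>: "0 \<le> \<eta>" "\<eta> \<le> 1" and v: "V \<le> v" "v \<le> V + \<eta>"
  shows "norm (log_sum V) \<le> norm (log_sum v) + (V + 1) * (2 * \<eta> * exp V + 1)"
proof -
  have sub: "log_upto V \<subseteq> log_upto v" using v by (intro log_upto_mono)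
  have "log_sum v - log_sum V = (\<Sum>n\<in>log_upto v - log_upto V. f n * of_real (ln (real n)))"
    unfolding log_sum_def using sub by (simp add: sum_diff)
  then have "norm (log_sum v - log_sum V) \<le> (\<Sum>n\<in>log_upto v - log_upto V. V + 1)"
  proof (simp only:, intro sum_norm_le)
    fix n assume n: "n \<in> log_upto v - log_upto V"
    then have "norm (f n) = 1" by (simp add: f_norm log_upto_def)
    moreover have "0 \<le> ln (real n)" "ln (real n) \<le> v" using ln_log_upto[of n v] n by auto
    ultimately show "norm (f n * of_real (ln (real n))) \<le> V + 1" using v \<eta> by (simp add: norm_mult)
  qed
  also have "\<dots> = (V + 1) * real (card (log_upto v - log_upto V))" by simp
  also have "\<dots> \<le> (V + 1) * (2 * \<eta> * exp V + 1)"
  proof (rule mult_left_mono)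
    have "card (log_upto v - log_upto V) = card (log_upto v) - card (log_upto V)"
      using sub by (simp add: card_Diff_subset)
    moreover have "card (log_upto V) \<le> card (log_upto v)" using sub by (intro card_mono) auto
    ultimately have "real (card (log_upto v - log_upto V)) = real (card (log_upto v)) - real (card (log_upto V))" by simp
    also have "\<dots> \<le> exp v - (exp V - 1)"
    proof (rule diff_mono[OF card_log_upto_le])
      have "exp V - 1 \<le> of_int \<lfloor>exp V\<rfloor>" by linarith
      then show "exp V - 1 \<le> real (card (log_upto V))" by (simp add: log_upto_eq)
    qed
    also have "exp v \<le> exp (V + \<eta>)" using v by simp
    also have "exp (V + \<eta>) \<le> exp V * (1 + 2 * \<eta>)"
    proof -
      have "exp \<eta> \<le> 1 + \<eta> + \<eta>\<^sup>2" using \<eta> by (rule exp_bound)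
      also have "\<eta>\<^sup>2 \<le> \<eta>" using \<eta> by (simp add: power2_eq_square mult_left_le)
      finally have "exp \<eta> \<le> 1 + 2 * \<eta>" by simp
      then show ?thesis unfolding exp_add by (intro mult_left_mono) auto
    qed
    finally show "real (card (log_upto v - log_upto V)) \<le> 2 * \<eta> * exp V + 1" by (simp add: algebra_simps)
  qed (use V in simp)
  finally have "norm (log_sum v - log_sum V) \<le> (V + 1) * (2 * \<eta> * exp V + 1)" .
  then show ?thesis using norm_triangle_ineq3[of "log_sum v" "log_sum V"] by linarith
qed

text \<open>Averaging over \<open>[V, V + \<eta>]\<close> and inserting \<open>log_sum_convolution\<close>;
  substituting \<open>w = v - ln d\<close> collects the prime powers \<open>d\<close> into a window that depends
  on \<open>w\<close>.\<close>
lemma log_sum_average: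
  assumes V: "0 \<le> V" and \<eta>: "0 < \<eta>" "\<eta> \<le> 1"
  defines "A \<equiv> log_upto (V + 1)"
  shows "ennreal (\<eta> * norm (log_sum V)) \<le>
     (\<integral>\<^sup>+w. ennreal (norm (partial_sum w) * (\<Sum>d\<in>A. mangoldt d * indicator {V - ln (real d)..V + \<eta> - ln (real d)} w)) \<partial>lborel)
       + ennreal (\<eta> * ((V + 1) * (2 * \<eta> * exp V + 1)))"
proof -
  define B where "B = (V + 1) * (2 * \<eta> * exp V + 1)"
  have B: "0 \<le> B" unfolding B_def using V \<eta> by (intro mult_nonneg_nonneg add_nonneg_nonneg) auto
  let ?J = "{V..V + \<eta>}"
  have "ennreal (\<eta> * norm (log_sum V)) = (\<integral>\<^sup>+v. ennreal (norm (log_sum V)) * indicator ?J v \<partial>lborel)"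
    using \<eta> by (subst nn_integral_cmult_indicator) (auto simp: ennreal_mult mult.commute)
  also have "\<dots> \<le> (\<integral>\<^sup>+v. (\<Sum>d\<in>A. ennreal (mangoldt d) * (ennreal (norm (partial_sum (v - ln (real d)))) * indicator ?J v)) + ennreal B * indicator ?J v \<partial>lborel)"
  proof (intro nn_integral_mono)
    fix v
    show "ennreal (norm (log_sum V)) * indicator ?J v
        \<le> (\<Sum>d\<in>A. ennreal (mangoldt d) * (ennreal (norm (partial_sum (v - ln (real d)))) * indicator ?J v)) + ennreal B * indicator ?J v"
    proof (cases "v \<in> ?J")
      case True
      then have "norm (log_sum V) \<le> norm (log_sum v) + B"
        unfolding B_def using V \<eta> by (intro log_sum_increment) auto
      also have "norm (log_sum v) \<le> (\<Sum>d\<in>A. mangoldt d * norm (partial_sum (v - ln (real d))))"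
        unfolding A_def log_sum_convolution[of v "V + 1"]
      proof -
        have "log_sum v = (\<Sum>d\<in>log_upto (V + 1). mangoldt d * f d * partial_sum (v - ln (real d)))"
          using True \<eta> by (intro log_sum_convolution) auto
        then show "norm (log_sum v) \<le> (\<Sum>d\<in>log_upto (V + 1). mangoldt d * norm (partial_sum (v - ln (real d))))"
        proof (simp only:, intro sum_norm_le)
          fix d assume "d \<in> log_upto (V + 1)"
          then have "norm (f d) = 1" by (simp add: f_norm log_upto_def)
          then show "norm (mangoldt d * f d * partial_sum (v - ln (real d))) \<le> mangoldt d * norm (partial_sum (v - ln (real d)))"
            by (simp add: norm_mult)
        qed
      qed
      finally have "ennreal (norm (log_sum V)) \<le> ennreal ((\<Sum>d\<in>A. mangoldt d * norm (partial_sum (v - ln (real d)))) + B)"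
        by (simp add: ennreal_leI)
      also have "\<dots> = ennreal (\<Sum>d\<in>A. mangoldt d * norm (partial_sum (v - ln (real d)))) + ennreal B"
        using B by (intro ennreal_plus sum_nonneg mult_nonneg_nonneg) (auto simp: mangoldt_nonneg)
      also have "ennreal (\<Sum>d\<in>A. mangoldt d * norm (partial_sum (v - ln (real d)))) = (\<Sum>d\<in>A. ennreal (mangoldt d * norm (partial_sum (v - ln (real d)))))"
        by (intro sum_ennreal[symmetric] mult_nonneg_nonneg) (auto simp: mangoldt_nonneg)
      also have "\<dots> = (\<Sum>d\<in>A. ennreal (mangoldt d) * ennreal (norm (partial_sum (v - ln (real d)))))"
        by (intro sum.cong refl ennreal_mult) (auto simp: mangoldt_nonneg)
      finally show ?thesis using True by simp
    qed simp
  qed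
  also have "\<dots> = (\<Sum>d\<in>A. \<integral>\<^sup>+v. ennreal (mangoldt d) * (ennreal (norm (partial_sum (v - ln (real d)))) * indicator ?J v) \<partial>lborel) + ennreal (\<eta> * B)"
  proof -
    have "(\<integral>\<^sup>+v. ennreal B * indicator ?J v \<partial>lborel) = ennreal (\<eta> * B)"
      using \<eta> B by (subst nn_integral_cmult_indicator) (auto simp: ennreal_mult[symmetric] mult.commute)
    then show ?thesis by (subst nn_integral_add) (auto simp: nn_integral_sum)
  qed
  also have "(\<Sum>d\<in>A. \<integral>\<^sup>+v. ennreal (mangoldt d) * (ennreal (norm (partial_sum (v - ln (real d)))) * indicator ?J v) \<partial>lborel)
      = (\<Sum>d\<in>A. \<integral>\<^sup>+w. ennreal (norm (partial_sum w) * (mangoldt d * indicator {V - ln (real d)..V + \<eta> - ln (real d)} w)) \<partial>lborel)"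
  proof (rule sum.cong[OF refl])
    fix d
    have "(\<integral>\<^sup>+v. ennreal (mangoldt d) * (ennreal (norm (partial_sum (v - ln (real d)))) * indicator ?J v) \<partial>lborel)
        = (\<integral>\<^sup>+w. ennreal (mangoldt d) * (ennreal (norm (partial_sum (ln (real d) + w - ln (real d)))) * indicator ?J (ln (real d) + w)) \<partial>lborel)"
      using nn_integral_real_affine[of "\<lambda>v. ennreal (mangoldt d) * (ennreal (norm (partial_sum (v - ln (real d)))) * indicator ?J v)" 1 "ln (real d)"]
      by simp
    also have "\<dots> = (\<integral>\<^sup>+w. ennreal (norm (partial_sum w) * (mangoldt d * indicator {V - ln (real d)..V + \<eta> - ln (real d)} w)) \<partial>lborel)"
    proof (rule nn_integral_cong)
      fix w
      have "(ln (real d) + w \<in> ?J) = (w \<in> {V - ln (real d)..V + \<eta> - ln (real d)})" by auto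
      then show "ennreal (mangoldt d) * (ennreal (norm (partial_sum (ln (real d) + w - ln (real d)))) * indicator ?J (ln (real d) + w))
          = ennreal (norm (partial_sum w) * (mangoldt d * indicator {V - ln (real d)..V + \<eta> - ln (real d)} w))"
        by (simp add: indicator_def ennreal_mult[symmetric] mangoldt_nonneg mult.commute)
    qed
    finally show "(\<integral>\<^sup>+v. ennreal (mangoldt d) * (ennreal (norm (partial_sum (v - ln (real d)))) * indicator ?J v) \<partial>lborel)
        = (\<integral>\<^sup>+w. ennreal (norm (partial_sum w) * (mangoldt d * indicator {V - ln (real d)..V + \<eta> - ln (real d)} w)) \<partial>lborel)" .
  qed
  also have "\<dots> = (\<integral>\<^sup>+w. (\<Sum>d\<in>A. ennreal (norm (partial_sum w) * (mangoldt d * indicator {V - ln (real d)..V + \<eta> - ln (real d)} w))) \<partial>lborel)"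
    by (rule nn_integral_sum[symmetric]) measurable
  also have "\<dots> = (\<integral>\<^sup>+w. ennreal (norm (partial_sum w) * (\<Sum>d\<in>A. mangoldt d * indicator {V - ln (real d)..V + \<eta> - ln (real d)} w)) \<partial>lborel)"
    unfolding sum_distrib_left
    by (intro nn_integral_cong sum_ennreal mult_nonneg_nonneg) (auto simp: mangoldt_nonneg)
  finally show ?thesis unfolding B_def .
qed

text \<open>By \<open>log_sum_average\<close> it suffices to bound a bilinear integral of
  \<open>partial_sum\<close> against the prime powers in short windows. The inequality between the arithmetic
  and geometric means, with the parameter \<open>t\<close>, separates the two mean squares, which are of
  relative size \<open>\<eta> ^ 3 / \<alpha>\<close> and \<open>\<eta> / \<alpha>\<close>. Their geometric mean
  is \<open>\<eta>\<^sup>2 / \<alpha>\<close>; after division by the length \<open>\<eta>\<close> of the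
  interval this is a saving of \<open>\<eta>\<close>, the size of the smoothing error.\<close>
lemma norm_partial_sum_le_saving:
  obtains C where "C > 0" and
    "\<And>\<alpha>. 0 < \<alpha> \<Longrightarrow> \<alpha> \<le> 1 \<Longrightarrow> norm (partial_sum (1 / \<alpha>)) \<le> C * exp (1 / \<alpha>) * exp (- (2 / 9 * \<kappa>) * recip_upto Q \<alpha>)"
proof -
  obtain C where C: "C > 0" and mean: "\<And>\<alpha>. 0 < \<alpha> \<Longrightarrow> \<alpha> \<le> 1 \<Longrightarrow>
      (\<integral>\<^sup>+v. ennreal ((norm (partial_sum v))\<^sup>2 * exp (- 2 * v)) * indicator {0..2 / \<alpha>} v \<partial>lborel)
         \<le> ennreal (C / \<alpha> * exp (- (2 / 3 * \<kappa>) * recip_upto Q \<alpha>))"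
    by (rule partial_sum_mean_square, rule that)
  define m0 where "m0 = mertens_error + 1"
  define C3 where "C3 = 864 * exp (4 :: real)"
  define C5 where "C5 = exp m0"
  have C_pos: "C3 > 0" "C5 > 0" by (simp_all add: C3_def C5_def)
  show ?thesis
  proof (rule that[of "(C + C3) / 2 + 4 + 3 * C5"])
    fix \<alpha> :: real assume \<alpha>: "0 < \<alpha>" "\<alpha> \<le> 1"
    define V where "V = 1 / \<alpha>"
    define \<eta> where "\<eta> = exp (- (2 / 9 * \<kappa>) * recip_upto Q \<alpha>)"
    have V: "V \<ge> 1" "V > 0" using \<alpha> by (auto simp: V_def)
    have \<eta>: "0 < \<eta>" "\<eta> \<le> 1" using \<kappa>_bounds recip_upto_nonneg[of \<alpha>] by (auto simp: \<eta>_def)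
    have \<eta>3: "exp (- (2 / 3 * \<kappa>) * recip_upto Q \<alpha>) = \<eta> ^ 3"
      unfolding \<eta>_def exp_of_nat_mult[symmetric] by simp
    have "exp (- m0) \<le> V * \<eta>"
      unfolding V_def \<eta>_def m0_def using \<kappa>_bounds by (intro saving_lower_bound \<alpha>) auto
    from mult_left_mono[OF this, of C5] have one_le: "1 \<le> C5 * (V * \<eta>)"
      by (simp add: C5_def exp_add[symmetric])
    define A where "A = log_upto (V + 1)"
    define m where "m = (\<lambda>w. \<Sum>d\<in>A. mangoldt d * indicator {V - ln (real d)..V + \<eta> - ln (real d)} w :: real)"
    define \<mu> where "\<mu> = (\<lambda>w. \<Sum>d\<in>A. mangoldt d / real d * indicator {V - ln (real d)..V + \<eta> - ln (real d)} w :: real)"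
    have m0: "0 \<le> m w" for w unfolding m_def by (intro sum_nonneg mult_nonneg_nonneg) (auto simp: mangoldt_nonneg)
    have m_mu: "m w * exp w \<le> exp (V + 1) * \<mu> w" for w
      unfolding m_def \<mu>_def sum_distrib_left sum_distrib_right
    proof (rule sum_mono)
      fix d assume d: "d \<in> A"
      then have pos: "real d > 0" by (simp add: A_def log_upto_def)
      show "mangoldt d * indicator {V - ln (real d)..V + \<eta> - ln (real d)} w * exp w
          \<le> exp (V + 1) * (mangoldt d / real d * indicator {V - ln (real d)..V + \<eta> - ln (real d)} w)"
      proof (cases "w \<in> {V - ln (real d)..V + \<eta> - ln (real d)}")
        case True
        then have "exp w \<le> exp (V + 1 - ln (real d))" using \<eta> by simp
        also have "\<dots> = exp (V + 1) / real d" using pos by (simp add: exp_diff)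
        finally have "mangoldt d * exp w \<le> mangoldt d * (exp (V + 1) / real d)"
          by (intro mult_left_mono mangoldt_nonneg)
        then show ?thesis using True by (simp add: mult_ac)
      qed simp
    qed
    have m_zero: "m w = 0" if "w > 2 / \<alpha>" for w
      unfolding m_def
    proof (rule sum.neutral, rule ballI)
      fix d assume "d \<in> A"
      then have "0 \<le> ln (real d)" using ln_log_upto A_def by blast
      moreover have "V + \<eta> \<le> 2 / \<alpha>" using V(1) \<eta> by (simp add: V_def)
      ultimately have "w \<notin> {V - ln (real d)..V + \<eta> - ln (real d)}" using that by auto
      then show "mangoldt d * indicator {V - ln (real d)..V + \<eta> - ln (real d)} w = (0::real)" by simp
    qed
    \<comment> \<open>The weight that makes the two mean squares equal.\<close>
    define t where "t = exp V / \<eta>"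
    have t: "t > 0" using \<eta> by (simp add: t_def)
    have am_gm: "norm (partial_sum w) * m w \<le> t / 2 * ((norm (partial_sum w))\<^sup>2 * exp (- 2 * w) * indicator {0..2 / \<alpha>} w)
        + exp (V + 1) ^ 2 / (2 * t) * (\<mu> w)\<^sup>2" for w
    proof (cases "w \<in> {0..2 / \<alpha>}")
      case True
      define x where "x = norm (partial_sum w) * exp (- w)"
      define y where "y = m w * exp w"
      have "exp (- w) * exp w = 1" by (simp add: exp_add[symmetric])
      then have xy: "norm (partial_sum w) * m w = x * y" by (simp add: x_def y_def mult_ac)
      have "0 \<le> (t * x - y)\<^sup>2" by simp
      then have "2 * t * (x * y) \<le> t\<^sup>2 * x\<^sup>2 + y\<^sup>2" by (simp add: power2_eq_square algebra_simps)
      then have "x * y \<le> (t\<^sup>2 * x\<^sup>2 + y\<^sup>2) / (2 * t)" using t by (simp add: pos_le_divide_eq mult_ac)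
      also have "\<dots> = t / 2 * x\<^sup>2 + y\<^sup>2 / (2 * t)" using t by (simp add: add_divide_distrib power2_eq_square)
      also have "y\<^sup>2 / (2 * t) \<le> (exp (V + 1) * \<mu> w)\<^sup>2 / (2 * t)"
        using m_mu[of w] m0[of w] t unfolding y_def by (intro divide_right_mono power_mono) auto
      finally have "x * y \<le> t / 2 * x\<^sup>2 + exp (V + 1) ^ 2 / (2 * t) * (\<mu> w)\<^sup>2" by (simp add: power_mult_distrib)
      moreover have "x\<^sup>2 = (norm (partial_sum w))\<^sup>2 * exp (- 2 * w)"
        by (simp add: x_def power_mult_distrib power2_eq_square[of "exp (- w)"] exp_add[symmetric])
      ultimately show ?thesis using True xy by simp
    next
      case False
      then have "norm (partial_sum w) * m w = 0" using partial_sum_negative[of w] m_zero[of w] by auto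
      also have "0 \<le> t / 2 * ((norm (partial_sum w))\<^sup>2 * exp (- 2 * w) * indicator {0..2 / \<alpha>} w) + exp (V + 1) ^ 2 / (2 * t) * (\<mu> w)\<^sup>2"
        using t by (intro add_nonneg_nonneg mult_nonneg_nonneg) auto
      finally show ?thesis .
    qed
    have [measurable]: "\<mu> \<in> borel_measurable borel" unfolding \<mu>_def by measurable
    have mu_sq: "(\<integral>\<^sup>+w. ennreal ((\<mu> w)\<^sup>2) \<partial>lborel) \<le> ennreal (864 * exp 2 * \<eta> / \<alpha>)"
      unfolding \<mu>_def
    proof (rule mangoldt_short_mean_square[OF \<alpha> \<eta>])
      show "finite A" by (simp add: A_def)
      fix d assume "d \<in> A"
      then have "d > 0" "ln (real d) \<le> V + 1" by (auto simp: A_def log_upto_def)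
      moreover from this have "\<alpha> * ln (real d) \<le> \<alpha> * (V + 1)" using \<alpha> by (intro mult_left_mono) auto
      moreover have "\<alpha> * (V + 1) \<le> 2" using \<alpha> by (simp add: V_def algebra_simps)
      ultimately show "d > 0 \<and> \<alpha> * ln (real d) \<le> 2" by simp
    qed
    have "(\<integral>\<^sup>+w. ennreal (norm (partial_sum w) * m w) \<partial>lborel)
        \<le> (\<integral>\<^sup>+w. ennreal (t / 2) * (ennreal ((norm (partial_sum w))\<^sup>2 * exp (- 2 * w)) * indicator {0..2 / \<alpha>} w)
            + ennreal (exp (V + 1) ^ 2 / (2 * t)) * ennreal ((\<mu> w)\<^sup>2) \<partial>lborel)"
    proof (intro nn_integral_mono)
      fix w
      let ?x = "(norm (partial_sum w))\<^sup>2 * exp (- 2 * w) * indicator {0..2 / \<alpha>} w :: real"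
      have "ennreal (norm (partial_sum w) * m w) \<le> ennreal (t / 2 * ?x + exp (V + 1) ^ 2 / (2 * t) * (\<mu> w)\<^sup>2)"
        by (rule ennreal_leI[OF am_gm])
      also have "\<dots> = ennreal (t / 2 * ?x) + ennreal (exp (V + 1) ^ 2 / (2 * t) * (\<mu> w)\<^sup>2)"
        by (rule ennreal_plus) (use t in \<open>auto intro!: mult_nonneg_nonneg\<close>)
      also have "ennreal (t / 2 * ?x) = ennreal (t / 2) * ennreal ?x"
        by (rule ennreal_mult) (use t in auto)
      also have "ennreal (exp (V + 1) ^ 2 / (2 * t) * (\<mu> w)\<^sup>2) = ennreal (exp (V + 1) ^ 2 / (2 * t)) * ennreal ((\<mu> w)\<^sup>2)"
        by (rule ennreal_mult) (use t in auto)
      also have "ennreal ?x = ennreal ((norm (partial_sum w))\<^sup>2 * exp (- 2 * w)) * indicator {0..2 / \<alpha>} w"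
        by (simp add: indicator_def)
      finally show "ennreal (norm (partial_sum w) * m w)
          \<le> ennreal (t / 2) * (ennreal ((norm (partial_sum w))\<^sup>2 * exp (- 2 * w)) * indicator {0..2 / \<alpha>} w)
            + ennreal (exp (V + 1) ^ 2 / (2 * t)) * ennreal ((\<mu> w)\<^sup>2)" .
    qed
    also have "\<dots> = ennreal (t / 2) * (\<integral>\<^sup>+w. ennreal ((norm (partial_sum w))\<^sup>2 * exp (- 2 * w)) * indicator {0..2 / \<alpha>} w \<partial>lborel)
        + ennreal (exp (V + 1) ^ 2 / (2 * t)) * (\<integral>\<^sup>+w. ennreal ((\<mu> w)\<^sup>2) \<partial>lborel)"
      by (subst nn_integral_add, measurable, subst (1 2) nn_integral_cmult, measurable)
    also have "\<dots> \<le> ennreal (t / 2) * ennreal (C / \<alpha> * \<eta> ^ 3) + ennreal (exp (V + 1) ^ 2 / (2 * t)) * ennreal (864 * exp 2 * \<eta> / \<alpha>)"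
      using mean[OF \<alpha>] mu_sq unfolding \<eta>3 by (intro add_mono mult_left_mono) auto
    also have "\<dots> = ennreal (t / 2 * (C / \<alpha> * \<eta> ^ 3) + exp (V + 1) ^ 2 / (2 * t) * (864 * exp 2 * \<eta> / \<alpha>))"
      using t C \<alpha> \<eta> by (subst (1 2) ennreal_mult[symmetric]) (auto simp: ennreal_plus[symmetric] simp del: ennreal_plus)
    also have "t / 2 * (C / \<alpha> * \<eta> ^ 3) + exp (V + 1) ^ 2 / (2 * t) * (864 * exp 2 * \<eta> / \<alpha>)
        = (C + C3) / 2 * exp V * V * \<eta>\<^sup>2"
    proof -
      have e4: "exp (V + 1) ^ 2 * exp 2 = exp V ^ 2 * exp (4 :: real)"
        by (simp add: power2_eq_square exp_add[symmetric])
      have "exp (V + 1) ^ 2 / (2 * t) * (864 * exp 2 * \<eta> / \<alpha>) = exp (V + 1) ^ 2 * exp 2 * 864 * \<eta> / (2 * t * \<alpha>)"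
        by (simp add: mult_ac)
      also have "\<dots> = exp V ^ 2 * exp 4 * 864 * \<eta> / (2 * t * \<alpha>)" unfolding e4 ..
      also have "\<dots> = C3 / 2 * exp V * V * \<eta>\<^sup>2"
        using \<alpha> \<eta> unfolding t_def C3_def V_def by (simp add: power2_eq_square)
      finally show ?thesis
        using \<alpha> \<eta> by (simp add: t_def V_def power2_eq_square power3_eq_cube add_divide_distrib algebra_simps)
    qed
    finally have int_le: "(\<integral>\<^sup>+w. ennreal (norm (partial_sum w) * m w) \<partial>lborel) \<le> ennreal ((C + C3) / 2 * exp V * V * \<eta>\<^sup>2)" .
    define R where "R = (V + 1) * (2 * \<eta> * exp V + 1)"
    have R: "0 \<le> R" unfolding R_def using V \<eta> by (intro mult_nonneg_nonneg add_nonneg_nonneg) auto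
    have "ennreal (\<eta> * norm (log_sum V)) \<le> (\<integral>\<^sup>+w. ennreal (norm (partial_sum w) * m w) \<partial>lborel) + ennreal (\<eta> * R)"
      using log_sum_average[of V \<eta>] V \<eta> unfolding m_def A_def R_def by simp
    also have "\<dots> \<le> ennreal ((C + C3) / 2 * exp V * V * \<eta>\<^sup>2) + ennreal (\<eta> * R)"
      by (rule add_right_mono[OF int_le])
    also have "\<dots> = ennreal ((C + C3) / 2 * exp V * V * \<eta>\<^sup>2 + \<eta> * R)"
      using C C_pos V \<eta> R by (subst ennreal_plus) auto
    finally have "\<eta> * norm (log_sum V) \<le> (C + C3) / 2 * exp V * V * \<eta>\<^sup>2 + \<eta> * R"
      using C C_pos V \<eta> R by (subst (asm) ennreal_le_iff) auto
    then have "\<eta> * norm (log_sum V) \<le> \<eta> * ((C + C3) / 2 * exp V * V * \<eta> + R)"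
      by (simp add: power2_eq_square algebra_simps)
    then have log_sum_le: "norm (log_sum V) \<le> (C + C3) / 2 * exp V * V * \<eta> + R"
      using \<eta> by (simp only: mult_le_cancel_left_pos)
    have "R \<le> 2 * V * (2 * \<eta> * exp V + 1)"
      unfolding R_def using V \<eta> by (intro mult_right_mono add_nonneg_nonneg) auto
    with log_sum_le have V_le: "V * norm (partial_sum V) \<le> (C + C3) / 2 * exp V * V * \<eta> + 2 * V * (2 * \<eta> * exp V + 1) + exp V"
      using partial_sum_times_log[of V] V by linarith
    have "1 \<le> C5 * exp V * \<eta>"
    proof -
      have "V \<le> exp V" using exp_ge_add_one_self[of V] by linarith
      then have "C5 * (V * \<eta>) \<le> C5 * (exp V * \<eta>)" using C_pos \<eta> by (intro mult_left_mono mult_right_mono) auto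
      then show ?thesis using one_le by (simp add: mult_ac)
    qed
    then have "2 * V * (2 * \<eta> * exp V + 1) \<le> 2 * V * (2 * \<eta> * exp V + C5 * exp V * \<eta>)"
      using V by (intro mult_left_mono) auto
    moreover have "exp V \<le> exp V * (C5 * (V * \<eta>))" using mult_left_mono[OF one_le, of "exp V"] by simp
    ultimately have "V * norm (partial_sum V)
        \<le> (C + C3) / 2 * exp V * V * \<eta> + 2 * V * (2 * \<eta> * exp V + C5 * exp V * \<eta>) + exp V * (C5 * (V * \<eta>))"
      using V_le by linarith
    also have "\<dots> = V * (((C + C3) / 2 + 4 + 3 * C5) * exp V * \<eta>)" by (simp add: algebra_simps)
    finally have "norm (partial_sum V) \<le> ((C + C3) / 2 + 4 + 3 * C5) * exp V * \<eta>" using V by (simp only: mult_le_cancel_left_pos)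
    then show "norm (partial_sum (1 / \<alpha>)) \<le> ((C + C3) / 2 + 4 + 3 * C5) * exp (1 / \<alpha>) * exp (- (2 / 9 * \<kappa>) * recip_upto Q \<alpha>)"
      unfolding V_def \<eta>_def .
  qed (use C C_pos in \<open>simp add: add_pos_pos\<close>)
qed

end

section \<open>Residue classes and characters\<close>

lemma finite_primes_le: "finite {p \<in> primes_outside P. p \<le> N}"
  by (rule finite_subset[of _ "{..N}"]) auto

lemma Omega_outside_eq_sum:
  assumes "finite T" and "prime_factors n - P \<subseteq> T" and "\<And>p. p \<in> T \<Longrightarrow> prime p \<and> p \<notin> P"
  shows "Omega_outside P n = (\<Sum>p\<in>T. multiplicity p n)"
  unfolding Omega_outside_def
proof (rule sum.mono_neutral_left[OF assms(1,2)], rule ballI)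
  fix p assume p: "p \<in> T - (prime_factors n - P)"
  then have "prime p" "p \<notin> prime_factors n" using assms(3) by auto
  then show "multiplicity p n = 0"
    by (cases "n = 0") (auto simp: prime_factors_multiplicity)
qed

lemma Omega_outside_mult:
  assumes "m > 0" "n > 0"
  shows "Omega_outside P (m * n) = Omega_outside P m + Omega_outside P n"
proof -
  let ?T = "prime_factors (m * n) - P"
  have union: "prime_factors (m * n) = prime_factors m \<union> prime_factors n"
    using assms by (intro prime_factors_product) auto
  have T: "finite ?T" "\<And>p. p \<in> ?T \<Longrightarrow> prime p \<and> p \<notin> P" by (auto simp: in_prime_factors_imp_prime)
  have "Omega_outside P (m * n) = (\<Sum>p\<in>?T. multiplicity p (m * n))" by (simp add: Omega_outside_def)
  also have "\<dots> = (\<Sum>p\<in>?T. multiplicity p m + multiplicity p n)"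
    using T(2) assms by (intro sum.cong refl prime_elem_multiplicity_mult_distrib) (auto intro: prime_imp_prime_elem)
  also have "\<dots> = (\<Sum>p\<in>?T. multiplicity p m) + (\<Sum>p\<in>?T. multiplicity p n)" by (rule sum.distrib)
  also have "(\<Sum>p\<in>?T. multiplicity p m) = Omega_outside P m"
    by (rule Omega_outside_eq_sum[symmetric, OF T(1) _ T(2)]) (auto simp: union)
  also have "(\<Sum>p\<in>?T. multiplicity p n) = Omega_outside P n"
    by (rule Omega_outside_eq_sum[symmetric, OF T(1) _ T(2)]) (auto simp: union)
  finally show ?thesis .
qed

lemma Omega_outside_one [simp]: "Omega_outside P (Suc 0) = 0"
  by (simp add: Omega_outside_def)

lemma Omega_outside_prime: "prime p \<Longrightarrow> Omega_outside P p = (if p \<in> P then 0 else 1)"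
  by (simp add: Omega_outside_def prime_prime_factors insert_Diff_if)

lemma sin_ge_chord:
  assumes "0 \<le> x" "x \<le> pi / 2"
  shows "2 / pi * x \<le> sin x"
proof -
  have convex: "convex_on {0..pi / 2} (\<lambda>x. - sin x)"
  proof (rule f''_ge0_imp_convex[where f' = "\<lambda>x. - cos x" and f'' = sin])
    show "0 \<le> sin x" if "x \<in> {0..pi / 2}" for x using that by (intro sin_ge_zero) auto
  qed (auto intro!: derivative_eq_intros)
  define t where "t = 2 / pi * x"
  have t: "0 \<le> t" "t \<le> 1" "x = (1 - t) * 0 + t * (pi / 2)"
    using assms by (auto simp: t_def field_simps)
  have "- sin ((1 - t) *\<^sub>R 0 + t *\<^sub>R (pi / 2)) \<le> (1 - t) * - sin 0 + t * - sin (pi / 2)"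
    using t by (intro convex_onD[OF convex]) auto
  moreover have "(1 - t) *\<^sub>R 0 + t *\<^sub>R (pi / 2) = x" by (simp add: t_def)
  ultimately have "t \<le> sin x" by simp
  then show ?thesis unfolding t_def .
qed

text \<open>The distance is \<open>2 sin (\<pi>j/b)\<close>, and replacing \<open>j\<close> by \<open>b -
  j\<close> brings the angle into the range where the sine lies above its chord.\<close>
lemma root_of_unity_gap:
  assumes "0 < j" "j < b"
  shows "4 / real b \<le> norm (1 - cis (2 * pi * real j / real b))"
proof -
  have b: "real b > 0" using assms by simp
  have norm_eq: "norm (1 - cis (2 * pi * real j / real b)) = 2 * \<bar>sin (pi * real j / real b)\<bar>"
    using dist_exp_i_1[of "2 * pi * real j / real b"] by (simp add: cis_conv_exp norm_minus_commute)
  have "2 / real b \<le> sin (pi * real j / real b)"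
  proof (cases "2 * j \<le> b")
    case True
    then have "real j / real b \<le> 1 / 2" using b by (simp add: field_simps)
    then have "pi * (real j / real b) \<le> pi * (1 / 2)" by (intro mult_left_mono) auto
    then have "2 / pi * (pi * (real j / real b)) \<le> sin (pi * (real j / real b))"
      using b by (intro sin_ge_chord) auto
    moreover have "2 / real b \<le> 2 / pi * (pi * (real j / real b))" using assms b by (simp add: field_simps)
    ultimately show ?thesis by simp
  next
    case False
    have sym: "sin (pi * real j / real b) = sin (pi * (real (b - j) / real b))"
    proof -
      have "pi * (real (b - j) / real b) = pi - pi * real j / real b"
        using assms b by (simp add: of_nat_diff field_simps)
      then show ?thesis by simp
    qed
    have "real (b - j) / real b \<le> 1 / 2" using b False assms by (simp add: field_simps of_nat_diff)
    then have "pi * (real (b - j) / real b) \<le> pi * (1 / 2)" by (intro mult_left_mono) auto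
    then have "2 / pi * (pi * (real (b - j) / real b)) \<le> sin (pi * (real (b - j) / real b))"
      using b by (intro sin_ge_chord) auto
    moreover have "2 / real b \<le> 2 / pi * (pi * (real (b - j) / real b))"
    proof -
      have "2 / real b \<le> 2 * real (b - j) / real b" using assms by (intro divide_right_mono) auto
      then show ?thesis by simp
    qed
    ultimately show ?thesis unfolding sym by simp
  qed
  then have "2 * (2 / real b) \<le> 2 * \<bar>sin (pi * real j / real b)\<bar>" by (intro mult_left_mono) auto
  then show ?thesis unfolding norm_eq by simp
qed

definition character :: "nat set \<Rightarrow> nat \<Rightarrow> nat \<Rightarrow> nat \<Rightarrow> complex" where
  "character P b j n = cis (2 * pi * real j / real b) ^ Omega_outside P n"

lemma cis_root_power:
  assumes "b > 0"
  shows "cis (2 * pi * real j / real b) ^ b = 1"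
proof -
  have "real b * (2 * pi * real j / real b) = 2 * pi * real j" using assms by simp
  then show ?thesis unfolding Complex.DeMoivre by (simp only: cis_multiple_2pi Ints_of_nat)
qed

lemma power_swap: "(z ^ m) ^ n = (z ^ n) ^ (m :: nat)" for z :: "'a :: monoid_mult"
  by (simp only: power_mult[symmetric] mult.commute)

lemma character_residue:
  assumes "b > 0"
  shows "character P b j n = cis (2 * pi * real j / real b) ^ Omega_residue P b n"
proof -
  let ?z = "cis (2 * pi * real j / real b)" and ?m = "Omega_outside P n"
  have "?z ^ ?m = ?z ^ (b * (?m div b) + ?m mod b)" by simp
  also have "\<dots> = (?z ^ b) ^ (?m div b) * ?z ^ (?m mod b)" by (simp only: power_add power_mult)
  finally show ?thesis by (simp add: character_def Omega_residue_def cis_root_power[OF assms])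
qed

lemma root_valued_character:
  assumes "b \<ge> 2" "0 < j" "j < b"
  shows "root_valued (character P b j) (primes_outside P) b"
proof unfold_locales
  fix p :: nat assume p: "prime p"
  show "character P b j p ^ b = 1"
    unfolding character_def power_swap[of _ "Omega_outside P p"] using assms by (simp add: cis_root_power)
  show "4 / real b \<le> norm (1 - character P b j p)" if "p \<in> primes_outside P"
  proof -
    have "Omega_outside P p = 1" using that p by (simp add: Omega_outside_prime primes_outside_def)
    then have "character P b j p = cis (2 * pi * real j / real b)" by (simp add: character_def)
    then show ?thesis using root_of_unity_gap[OF assms(2,3)] by (simp only:)
  qed
next
  show "2 \<le> b" by fact
  show "character P b j 1 = 1" by (simp add: character_def)
  show "character P b j (m * n) = character P b j m * character P b j n" if "m > 0" "n > 0" for m n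
    unfolding character_def Omega_outside_mult[OF that] by (rule power_add)
  show "norm (character P b j n) = 1" for n unfolding character_def norm_power by simp
qed

text \<open>The sum is geometric with ratio \<open>w\<close>, a \<open>b\<close>-th root of unity which is
  \<open>1\<close> only if \<open>b\<close> divides \<open>r - k\<close>.\<close>
lemma sum_roots_of_unity:
  assumes "r < b" "k < b"
  shows "(\<Sum>j<b. cis (2 * pi * real j / real b) ^ r * cnj (cis (2 * pi * real j / real b) ^ k)) = (if r = k then of_nat b else 0)"
proof -
  have b: "b > 0" using assms by simp
  define w where "w = cis (2 * pi / real b) ^ r * cnj (cis (2 * pi / real b) ^ k)"
  have eq: "cis (2 * pi * real j / real b) ^ r * cnj (cis (2 * pi * real j / real b) ^ k) = w ^ j" for j
  proof -
    have "cis (2 * pi * real j / real b) = cis (2 * pi / real b) ^ j"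
      by (simp add: Complex.DeMoivre mult_ac)
    then show ?thesis by (simp add: w_def power_mult_distrib power_mult[symmetric] mult.commute)
  qed
  show ?thesis
  proof (cases "r = k")
    case True
    have "w = (cis (2 * pi / real b) * cnj (cis (2 * pi / real b))) ^ k"
      by (simp add: w_def True power_mult_distrib)
    then have "w = 1" by (simp add: cis_cnj cis_mult)
    then show ?thesis unfolding eq using True by simp
  next
    case False
    have w_cis: "w = cis (2 * pi * (real r - real k) / real b)"
      by (simp add: w_def Complex.DeMoivre cis_cnj cis_mult diff_divide_distrib right_diff_distrib mult_ac)
    have "w \<noteq> 1"
    proof
      assume "w = 1"
      then have "cos (2 * pi * (real r - real k) / real b) = 1" unfolding w_cis by (simp add: complex_eq_iff)
      then obtain i :: int where "2 * pi * (real r - real k) / real b = of_int i * 2 * pi"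
        by (auto simp: cos_one_2pi_int)
      then have "(2 * pi) * ((real r - real k) / real b) = (2 * pi) * of_int i" by (simp add: mult_ac)
      then have "(real r - real k) / real b = of_int i" by (simp only: mult_cancel_left) simp
      then have "real r - real k = of_int i * real b" using b by (simp add: field_simps)
      then have "of_int (int r - int k) = (of_int (i * int b) :: real)" by simp
      then have rk: "int r - int k = i * int b" by (simp only: of_int_eq_iff)
      have "\<bar>int r - int k\<bar> < int b" using assms by linarith
      then have "\<bar>i\<bar> * int b < 1 * int b" unfolding rk by (simp add: abs_mult)
      then have "i = 0" using b by (subst (asm) mult_less_cancel_right_pos) auto
      then show False using rk False by simp
    qed
    moreover have "w ^ b = 1"
    proof -
      have root: "cis (2 * pi / real b) ^ b = 1" using cis_root_power[OF b, of 1] by simp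
      have "w ^ b = (cis (2 * pi / real b) ^ r) ^ b * cnj ((cis (2 * pi / real b) ^ k) ^ b)"
        by (simp add: w_def power_mult_distrib)
      then show ?thesis unfolding power_swap[of _ r] power_swap[of _ k] root by simp
    qed
    ultimately show ?thesis unfolding eq using False by (simp add: sum_gp_strict)
  qed
qed

lemma count_residue:
  assumes "b > 0" "k < b"
  shows "of_nat b * of_nat (card {n \<in> {1..N}. Omega_residue P b n = k})
     = (\<Sum>j<b. (\<Sum>n=1..N. character P b j n) * cnj (cis (2 * pi * real j / real b) ^ k))"
proof -
  have "(\<Sum>j<b. (\<Sum>n=1..N. character P b j n) * cnj (cis (2 * pi * real j / real b) ^ k))
      = (\<Sum>n=1..N. \<Sum>j<b. cis (2 * pi * real j / real b) ^ Omega_residue P b n * cnj (cis (2 * pi * real j / real b) ^ k))"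
    unfolding sum_distrib_right character_residue[OF assms(1)] by (rule sum.swap)
  also have "\<dots> = (\<Sum>n=1..N. if Omega_residue P b n = k then of_nat b else 0)"
    using assms by (intro sum.cong refl sum_roots_of_unity) (simp add: Omega_residue_def)
  also have "\<dots> = (\<Sum>n\<in>{n \<in> {1..N}. Omega_residue P b n = k}. of_nat b)"
    by (rule sum.inter_filter[symmetric]) simp
  also have "\<dots> = of_nat b * of_nat (card {n \<in> {1..N}. Omega_residue P b n = k})" by simp
  finally show ?thesis ..
qed

text \<open>The term \<open>j = 0\<close> of the Fourier inversion is the main term \<open>N/b\<close>.\<close>
lemma residue_discrepancy_le_characters:
  assumes "b > 0" "k < b" "N \<ge> 1"
  shows "residue_discrepancy P b N k \<le> (\<Sum>j=1..<b. norm (\<Sum>n=1..N. character P b j n)) / (real b * real N)"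
proof -
  let ?c = "real (card {n \<in> {1..N}. Omega_residue P b n = k})"
  let ?t = "\<lambda>j. (\<Sum>n=1..N. character P b j n) * cnj (cis (2 * pi * real j / real b) ^ k)"
  have "complex_of_real (real b * ?c) = (\<Sum>j<b. ?t j)"
    using count_residue[OF assms(1,2), of N P] by simp
  also have "\<dots> = ?t 0 + (\<Sum>j=1..<b. ?t j)"
    using assms by (simp add: lessThan_atLeast0 sum.atLeast_Suc_lessThan)
  also have "?t 0 = of_nat N" by (simp add: character_def)
  finally have "complex_of_real (real b * ?c - real N) = (\<Sum>j=1..<b. ?t j)" by simp
  then have "norm (complex_of_real (real b * ?c - real N)) = norm (\<Sum>j=1..<b. ?t j)" by (simp only:)
  then have "\<bar>real b * ?c - real N\<bar> = norm (\<Sum>j=1..<b. ?t j)" by (simp only: norm_of_real)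
  also have "\<dots> \<le> (\<Sum>j=1..<b. norm (\<Sum>n=1..N. character P b j n))"
    by (rule sum_norm_le) (simp add: norm_mult norm_power)
  finally have "\<bar>real b * ?c - real N\<bar> / (real b * real N) \<le> (\<Sum>j=1..<b. norm (\<Sum>n=1..N. character P b j n)) / (real b * real N)"
    by (rule divide_right_mono) simp
  moreover have "residue_discrepancy P b N k = \<bar>(real b * ?c - real N) / (real b * real N)\<bar>"
    unfolding residue_discrepancy_def using assms by (simp add: diff_divide_distrib)
  moreover have "\<dots> = \<bar>real b * ?c - real N\<bar> / (real b * real N)" using assms by (simp add: abs_divide)
  ultimately show ?thesis by simp
qed

lemma character_sum_le:
  assumes "b \<ge> 2" "0 < j" "j < b"
  obtains C where "C > 0" and
    "\<And>N. N \<ge> 3 \<Longrightarrow> norm (\<Sum>n=1..N. character P b j n) \<le> C * real N * exp (- (2 * recip_sum P N / (9 * (real b)\<^sup>2)))"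
proof -
  interpret root_valued "character P b j" "primes_outside P" b by (rule root_valued_character) fact+
  obtain C where C: "C > 0" and le: "\<And>\<alpha>. 0 < \<alpha> \<Longrightarrow> \<alpha> \<le> 1 \<Longrightarrow>
      norm (partial_sum (1 / \<alpha>)) \<le> C * exp (1 / \<alpha>) * exp (- (2 / 9 * \<kappa>) * recip_upto (primes_outside P) \<alpha>)"
    by (rule norm_partial_sum_le_saving, rule that)
  show ?thesis
  proof (rule that[OF C])
    fix N :: nat assume N: "N \<ge> 3"
    have "exp 1 \<le> real N" using exp_le N by linarith
    then have ln: "1 \<le> ln (real N)" using N by (simp add: ln_ge_iff)
    define \<alpha> where "\<alpha> = 1 / ln (real N)"
    have \<alpha>: "0 < \<alpha>" "\<alpha> \<le> 1" "1 / \<alpha> = ln (real N)" using ln by (auto simp: \<alpha>_def)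
    have upto: "log_upto (ln (real N)) = {1..N}"
      using N by (auto simp: log_upto_def)
    have "primes_upto \<alpha> \<inter> primes_outside P = {p \<in> primes_outside P. p \<le> N}"
    proof -
      have "(\<alpha> * ln (real p) \<le> 1) = (p \<le> N)" if "prime p" for p
        using that ln N prime_gt_0_nat[OF that] by (simp add: \<alpha>_def divide_le_eq)
      then show ?thesis by (auto simp: primes_upto_def primes_outside_def)
    qed
    then have rec: "recip_upto (primes_outside P) \<alpha> = recip_sum P N"
      by (simp add: recip_upto_def recip_sum_def)
    have exponent: "- (2 / 9 * \<kappa>) * recip_sum P N = - (2 * recip_sum P N / (9 * (real b)\<^sup>2))"
      by (simp add: \<kappa>_def)
    show "norm (\<Sum>n=1..N. character P b j n) \<le> C * real N * exp (- (2 * recip_sum P N / (9 * (real b)\<^sup>2)))"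
      using le[OF \<alpha>(1,2)] N unfolding \<alpha>(3) partial_sum_def upto rec exponent by simp
  qed
qed

theorem residue_discrepancy_le:
  assumes "b \<ge> 2"
  shows "\<exists>C>0. \<forall>N\<ge>1. \<forall>k<b. residue_discrepancy P b N k \<le> C * exp (- (2 * recip_sum P N / (9 * (real b)\<^sup>2)))"
proof -
  let ?e = "\<lambda>N. exp (- (2 * recip_sum P N / (9 * (real b)\<^sup>2)))"
  have "\<forall>j\<in>{1..<b}. \<exists>C>0. \<forall>N\<ge>3. norm (\<Sum>n=1..N. character P b j n) \<le> C * real N * ?e N"
  proof
    fix j assume "j \<in> {1..<b}"
    then obtain C where "C > 0" "\<And>N. N \<ge> 3 \<Longrightarrow> norm (\<Sum>n=1..N. character P b j n) \<le> C * real N * ?e N"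
      using character_sum_le[OF assms, of j P] by auto
    then show "\<exists>C>0. \<forall>N\<ge>3. norm (\<Sum>n=1..N. character P b j n) \<le> C * real N * ?e N" by blast
  qed
  then obtain C where C: "\<And>j. j \<in> {1..<b} \<Longrightarrow> C j > 0"
    "\<And>j N. j \<in> {1..<b} \<Longrightarrow> N \<ge> 3 \<Longrightarrow> norm (\<Sum>n=1..N. character P b j n) \<le> C j * real N * ?e N"
    by metis
  define D where "D = (\<Sum>j=1..<b. C j) + exp 1"
  have sumC: "0 \<le> (\<Sum>j=1..<b. C j)" using C(1) by (intro sum_nonneg) (auto intro: less_imp_le)
  have D: "D > 0" unfolding D_def using sumC by (intro add_nonneg_pos) auto
  have "residue_discrepancy P b N k \<le> D * ?e N" if N: "N \<ge> 1" and k: "k < b" for N k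
  proof (cases "N \<ge> 3")
    case True
    have "residue_discrepancy P b N k \<le> (\<Sum>j=1..<b. norm (\<Sum>n=1..N. character P b j n)) / (real b * real N)"
      using assms k N by (intro residue_discrepancy_le_characters) auto
    also have "\<dots> \<le> (\<Sum>j=1..<b. C j * real N * ?e N) / (real b * real N)"
      using C(2) True by (intro divide_right_mono sum_mono) auto
    also have "\<dots> = (\<Sum>j=1..<b. C j) * ?e N / real b"
      using N by (simp add: sum_distrib_right[symmetric])
    also have "\<dots> \<le> (\<Sum>j=1..<b. C j) * ?e N / 1"
      using assms sumC by (intro divide_left_mono) auto
    also have "\<dots> \<le> D * ?e N" by (simp add: D_def)
    finally show ?thesis .
  next
    case False
    have "{p \<in> primes_outside P. p \<le> N} \<subseteq> {2}"
    proof
      fix p assume p: "p \<in> {p \<in> primes_outside P. p \<le> N}"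
      then have "prime p" "p \<le> 2" using False by (auto simp: primes_outside_def)
      then show "p \<in> {2}" using prime_ge_2_nat[of p] by simp
    qed
    then have "recip_sum P N \<le> (\<Sum>p\<in>{2}. 1 / real p)" unfolding recip_sum_def by (intro sum_mono2) auto
    then have "recip_sum P N \<le> 1" by simp
    moreover have "1 \<le> (real b)\<^sup>2" using assms by simp
    ultimately have "2 * recip_sum P N / (9 * (real b)\<^sup>2) \<le> 1" by (simp add: divide_le_eq)
    then have "exp 1 * exp (- 1) \<le> D * ?e N" using sumC unfolding D_def by (intro mult_mono) auto
    then have "1 \<le> D * ?e N" by (simp add: exp_add[symmetric])
    moreover have "residue_discrepancy P b N k \<le> 1"
    proof -
      have "card {n \<in> {1..N}. Omega_residue P b n = k} \<le> card {1..N}" by (intro card_mono) auto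
      then have "0 \<le> real (card {n \<in> {1..N}. Omega_residue P b n = k}) / real N"
        "real (card {n \<in> {1..N}. Omega_residue P b n = k}) / real N \<le> 1" using N by (auto simp: divide_le_eq)
      moreover have "0 \<le> 1 / real b" "1 / real b \<le> 1" using assms by auto
      ultimately show ?thesis unfolding residue_discrepancy_def by linarith
    qed
    ultimately show ?thesis by linarith
  qed
  then show ?thesis using D by blast
qed

section \<open>Digits, and the necessity of divergence\<close>

text \<open>A digit different from \<open>b - 1\<close> beyond the \<open>n\<close>-th place makes the tail
  strictly smaller than one unit of that place, so that no carry occurs.\<close>
lemma digit_of_expansion:
  fixes d :: "nat \<Rightarrow> nat"
  assumes b: "b \<ge> 2" and d: "\<And>m. d m < b" and not_max: "\<And>N. \<exists>m\<ge>N. d m \<noteq> b - 1" and n: "n \<ge> 1"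
  shows "base_digit b (\<Sum>m. real (d (Suc m)) / real b ^ Suc m) n = d n"
proof -
  define t where "t = (\<lambda>m. real (d (Suc m)) / real b ^ Suc m)"
  have b0: "real b > 1" "real b \<noteq> 0" using b by auto
  have geom: "(\<lambda>m. (real b - 1) / real b ^ Suc m) sums 1"
  proof -
    have "(\<lambda>m. (real b - 1) / real b * (1 / real b) ^ m) sums ((real b - 1) / real b * (1 / (1 - 1 / real b)))"
      using b0 by (intro sums_mult geometric_sums) simp
    moreover have "(real b - 1) / real b * (1 / (1 - 1 / real b)) = 1"
    proof -
      have "1 - 1 / real b = (real b - 1) / real b" using b0 by (simp add: diff_divide_distrib)
      then show ?thesis using b0 by simp
    qed
    moreover have "(real b - 1) / real b * (1 / real b) ^ m = (real b - 1) / real b ^ Suc m" for m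
      by (simp add: power_divide)
    ultimately show ?thesis by (simp only:)
  qed
  have d_le: "real (d m) \<le> real b - 1" for m using d[of m] by linarith
  have summ: "summable t"
  proof (rule summable_comparison_test'[OF sums_summable[OF geom], of 0])
    show "norm (t m) \<le> (real b - 1) / real b ^ Suc m" for m
      unfolding t_def using b0 d_le by (simp add: divide_right_mono)
  qed
  define R where "R = (\<Sum>m. real (d (Suc (m + n))) / real b ^ Suc m)"
  have shift: "real b ^ n * t (m + n) = real (d (Suc (m + n))) / real b ^ Suc m" for m
    using b0 by (simp add: t_def power_add field_simps)
  have summ_R: "summable (\<lambda>m. real (d (Suc (m + n))) / real b ^ Suc m)"
    unfolding shift[symmetric] by (intro summable_mult summable_ignore_initial_segment summ)
  have R_eq: "R = real b ^ n * (\<Sum>m. t (m + n))"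
    unfolding R_def shift[symmetric] by (intro suminf_mult summable_ignore_initial_segment summ)
  have R0: "0 \<le> R" unfolding R_def by (intro suminf_nonneg summ_R) simp
  have "0 < (\<Sum>m. (real b - 1) / real b ^ Suc m - real (d (Suc (m + n))) / real b ^ Suc m)"
  proof -
    obtain m where m: "m \<ge> Suc n" "d m \<noteq> b - 1" using not_max by blast
    then have "real (d (Suc (m - Suc n + n))) < real b - 1" using d[of m] by simp
    then have "0 < (real b - 1) / real b ^ Suc (m - Suc n) - real (d (Suc (m - Suc n + n))) / real b ^ Suc (m - Suc n)"
      using b0 by (simp add: diff_divide_distrib[symmetric])
    then show ?thesis
      using b0 d_le by (intro suminf_pos2 summable_diff sums_summable[OF geom] summ_R)
        (auto intro!: divide_right_mono)
  qed
  also have "\<dots> = (\<Sum>m. (real b - 1) / real b ^ Suc m) - R"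
    unfolding R_def by (rule suminf_diff[symmetric, OF sums_summable[OF geom] summ_R])
  also have "(\<Sum>m. (real b - 1) / real b ^ Suc m) = 1" by (rule sums_unique[OF geom, symmetric])
  finally have R1: "R < 1" by simp
  define I where "I = (\<Sum>m<n. int (d (Suc m)) * int b ^ (n - Suc m))"
  have "suminf t * real b ^ n = (\<Sum>m<n. t m) * real b ^ n + R"
    unfolding suminf_split_initial_segment[OF summ, of n] R_eq by (simp add: algebra_simps)
  also have "(\<Sum>m<n. t m) * real b ^ n = of_int I"
    unfolding I_def sum_distrib_right of_int_sum
  proof (rule sum.cong[OF refl])
    fix m assume "m \<in> {..<n}"
    then have "n = (n - Suc m) + Suc m" by simp
    then have pow: "real b ^ n = real b ^ (n - Suc m) * real b ^ Suc m" by (metis power_add)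
    have "t m * real b ^ Suc m = real (d (Suc m))" using b0 by (simp add: t_def)
    then show "t m * real b ^ n = of_int (int (d (Suc m)) * int b ^ (n - Suc m))"
      unfolding pow by (simp add: mult.left_commute[of _ "real b ^ (n - Suc m)"] del: power_Suc)
  qed
  finally have "\<lfloor>suminf t * real b ^ n\<rfloor> = I" using R0 R1 by linarith
  moreover have "I mod int b = int (d n)"
  proof -
    obtain n' where n': "n = Suc n'" using n by (cases n) auto
    have I_split: "I = (\<Sum>m<n'. int (d (Suc m)) * int b ^ (n - Suc m)) + int (d n)" by (simp add: I_def n')
    have "int b dvd (\<Sum>m<n'. int (d (Suc m)) * int b ^ (n - Suc m))"
      by (intro dvd_sum dvd_mult dvd_power) (auto simp: n')
    then obtain k where "(\<Sum>m<n'. int (d (Suc m)) * int b ^ (n - Suc m)) = int b * k" by (elim dvdE)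
    then have "I mod int b = int (d n) mod int b" unfolding I_split by simp
    also have "\<dots> = int (d n)" using d[of n] by simp
    finally show ?thesis .
  qed
  ultimately show ?thesis unfolding base_digit_def t_def by simp
qed

text \<open>Multiplying by a prime outside \<open>P\<close> shifts the residue by one, so the digits never
  become constant.\<close>
lemma Omega_residue_not_eventually_max:
  assumes "b \<ge> 2"
  shows "\<exists>m\<ge>N. Omega_residue P b m \<noteq> b - 1"
proof (cases "primes_outside P = {}")
  case True
  have "prime_factors N - P = {}" using True by (auto simp: primes_outside_def in_prime_factors_imp_prime)
  then have "Omega_residue P b N = 0" unfolding Omega_residue_def Omega_outside_def by (simp only: sum.empty mod_0)
  then show ?thesis using assms by (intro exI[of _ N]) auto
next
  case False
  then obtain q where q: "prime q" "q \<notin> P" by (auto simp: primes_outside_def)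
  define n where "n = Suc N"
  then have "n > 0" by simp
  have "Omega_outside P (n * q) = Omega_outside P n + 1"
    using q prime_gt_0_nat[OF q(1)] \<open>n > 0\<close> by (simp add: Omega_outside_mult Omega_outside_prime)
  then have ne: "Omega_residue P b (n * q) \<noteq> Omega_residue P b n"
    using assms by (simp add: Omega_residue_def mod_Suc)
  have "n * 1 \<le> n * q" using prime_ge_1_nat[OF q(1)] by (intro mult_le_mono2)
  then have "N \<le> n" "N \<le> n * q" by (auto simp: n_def)
  with ne show ?thesis by metis
qed

lemma base_digit_xi:
  assumes "b \<ge> 2" "n \<ge> 1"
  shows "base_digit b (xi P b) n = Omega_residue P b n"
  unfolding xi_def using assms
  by (intro digit_of_expansion Omega_residue_not_eventually_max) (auto simp: Omega_residue_def)

lemma simply_normal_xi_iff: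
  assumes "b \<ge> 2"
  shows "simply_normal b (xi P b) \<longleftrightarrow>
    (\<forall>k<b. (\<lambda>N. real (card {n \<in> {1..N}. Omega_residue P b n = k}) / real N) \<longlonglongrightarrow> 1 / real b)"
proof -
  have "{n \<in> {1..N}. base_digit b (xi P b) n = k} = {n \<in> {1..N}. Omega_residue P b n = k}" for N k
    using base_digit_xi[OF assms] by auto
  then show ?thesis by (simp add: simply_normal_def)
qed

lemma recip_sum_mono: "M \<le> N \<Longrightarrow> recip_sum P M \<le> recip_sum P N"
  unfolding recip_sum_def by (intro sum_mono2 finite_primes_le) auto

lemma recip_sum_at_top:
  assumes inf: "(\<Sum>\<^sub>\<infinity>p\<in>primes_outside P. ennreal (1 / real p)) = \<infinity>"
  shows "filterlim (recip_sum P) at_top sequentially"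
  unfolding filterlim_at_top
proof
  fix B :: real
  have "\<exists>N. B \<le> recip_sum P N"
  proof (rule ccontr)
    assume "\<not> (\<exists>N. B \<le> recip_sum P N)"
    then have le: "recip_sum P N \<le> B" for N by (meson less_imp_le not_le)
    have "(\<Sum>\<^sub>\<infinity>p\<in>primes_outside P. ennreal (1 / real p)) \<le> ennreal B"
    proof (rule infsum_le_finite_sums)
      fix F assume F: "finite F" "F \<subseteq> primes_outside P"
      have "(\<Sum>p\<in>F. ennreal (1 / real p)) = ennreal (\<Sum>p\<in>F. 1 / real p)" by (rule sum_ennreal) simp
      also have "(\<Sum>p\<in>F. 1 / real p) \<le> recip_sum P (Max F)"
        unfolding recip_sum_def using F by (intro sum_mono2 finite_primes_le) auto
      then have "ennreal (\<Sum>p\<in>F. 1 / real p) \<le> ennreal B" using le[of "Max F"] by (intro ennreal_leI) simp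
      finally show "(\<Sum>p\<in>F. ennreal (1 / real p)) \<le> ennreal B" .
    qed (rule nonneg_summable_on_complete, simp)
    then show False using inf by (simp add: top_unique)
  qed
  then obtain N where "B \<le> recip_sum P N" by blast
  then have "B \<le> recip_sum P n" if "n \<ge> N" for n using recip_sum_mono[OF that, of P] by linarith
  then show "\<forall>\<^sub>F n in sequentially. B \<le> recip_sum P n" by (auto simp: eventually_at_top_linorder)
qed

lemma simply_normal_if_divergent:
  assumes b: "b \<ge> 2" and inf: "(\<Sum>\<^sub>\<infinity>p\<in>primes_outside P. ennreal (1 / real p)) = \<infinity>"
  shows "simply_normal b (xi P b)"
  unfolding simply_normal_xi_iff[OF b]
proof (intro allI impI)
  fix k assume k: "k < b"
  obtain C where C: "C > 0" "\<And>N k. N \<ge> 1 \<Longrightarrow> k < b \<Longrightarrow>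
      residue_discrepancy P b N k \<le> C * exp (- (2 * recip_sum P N / (9 * (real b)\<^sup>2)))"
    using residue_discrepancy_le[OF b, of P] by blast
  have "filterlim (\<lambda>N. 2 / (9 * (real b)\<^sup>2) * recip_sum P N) at_top sequentially"
    using b by (intro filterlim_tendsto_pos_mult_at_top[OF tendsto_const _ recip_sum_at_top[OF inf]]) simp
  then have "(\<lambda>N. exp (- (2 / (9 * (real b)\<^sup>2) * recip_sum P N))) \<longlonglongrightarrow> 0"
    by (intro filterlim_compose[OF exp_at_bot] filterlim_compose[OF filterlim_uminus_at_bot_at_top])
  then have "(\<lambda>N. C * exp (- (2 / (9 * (real b)\<^sup>2) * recip_sum P N))) \<longlonglongrightarrow> C * 0"
    by (intro tendsto_intros)
  then have lim: "(\<lambda>N. C * exp (- (2 * recip_sum P N / (9 * (real b)\<^sup>2)))) \<longlonglongrightarrow> 0" by simp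
  have "(\<lambda>N. real (card {n \<in> {1..N}. Omega_residue P b n = k}) / real N - 1 / real b) \<longlonglongrightarrow> 0"
  proof (rule Lim_null_comparison[OF _ lim])
    show "\<forall>\<^sub>F N in sequentially. norm (real (card {n \<in> {1..N}. Omega_residue P b n = k}) / real N - 1 / real b)
        \<le> C * exp (- (2 * recip_sum P N / (9 * (real b)\<^sup>2)))"
      using C(2)[OF _ k] unfolding residue_discrepancy_def real_norm_def
      by (auto simp: eventually_at_top_linorder intro!: exI[of _ 1])
  qed
  then show "(\<lambda>N. real (card {n \<in> {1..N}. Omega_residue P b n = k}) / real N) \<longlonglongrightarrow> 1 / real b"
    by (simp add: LIM_zero_iff)
qed

text \<open>\<open>F(N) = o(N)\<close>, in a form without quotients that is convenient for recursions on
  \<open>N\<close>.\<close>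
definition negligible_sums :: "(nat \<Rightarrow> complex) \<Rightarrow> bool" where
  "negligible_sums F \<longleftrightarrow> (\<forall>\<epsilon>>0. \<exists>K\<ge>0. \<forall>N. norm (F N) \<le> \<epsilon> * real N + K)"

definition char_sum :: "nat set \<Rightarrow> nat \<Rightarrow> nat \<Rightarrow> complex" where
  "char_sum P b N = (\<Sum>n=1..N. character P b 1 n)"

lemma norm_character: "norm (character P b j n) = 1"
  by (simp add: character_def norm_power)

lemma norm_char_sum_le: "norm (char_sum P b N) \<le> real N"
  unfolding char_sum_def using sum_norm_le[of "{1..N}" "character P b 1" "\<lambda>_. 1"] by (simp add: norm_character)

lemma sum_split_multiples:
  fixes g :: "nat \<Rightarrow> complex"
  assumes "q > 0"
  shows "(\<Sum>n=1..N. g n) = (\<Sum>n\<in>{n \<in> {1..N}. \<not> q dvd n}. g n) + (\<Sum>m=1..N div q. g (q * m))"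
proof -
  have "{n \<in> {1..N}. q dvd n} = (*) q ` {1..N div q}"
  proof (intro set_eqI iffI)
    fix n assume "n \<in> {n \<in> {1..N}. q dvd n}"
    then obtain m where m: "n = q * m" "q * m \<le> N" "0 < q * m" by auto
    then have "m \<le> N div q" using assms by (simp add: less_eq_div_iff_mult_less_eq mult.commute)
    then show "n \<in> (*) q ` {1..N div q}" using m by (intro image_eqI[of _ _ m]) auto
  next
    fix n assume "n \<in> (*) q ` {1..N div q}"
    then obtain m where "m \<in> {1..N div q}" "n = q * m" by blast
    then have m: "n = q * m" "1 \<le> m" "m \<le> N div q" by simp_all
    then have "m * q \<le> N" using assms by (simp add: less_eq_div_iff_mult_less_eq)
    then show "n \<in> {n \<in> {1..N}. q dvd n}" using m assms by (auto simp: mult.commute)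
  qed
  then have mult: "(\<Sum>n\<in>{n \<in> {1..N}. q dvd n}. g n) = (\<Sum>m=1..N div q. g (q * m))"
    using assms by (simp add: sum.reindex inj_on_def)
  have "(\<Sum>n=1..N. g n) = (\<Sum>n\<in>{n \<in> {1..N}. \<not> q dvd n} \<union> {n \<in> {1..N}. q dvd n}. g n)"
    by (rule sum.cong) auto
  also have "\<dots> = (\<Sum>n\<in>{n \<in> {1..N}. \<not> q dvd n}. g n) + (\<Sum>n\<in>{n \<in> {1..N}. q dvd n}. g n)"
    by (rule sum.union_disjoint) auto
  finally show ?thesis unfolding mult .
qed

text \<open>Declaring one prime \<open>q\<close> inert changes the character sums \<open>F\<close> into
  \<open>F'\<close> with
  \<open>F'(N) - F'(N/q) = F(N) - \<zeta>F(N/q)\<close>: both sides are the sum over the integers prime to \<open>q\<close>. As the scale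
  drops by a factor \<open>q\<close> each time, \<open>F'\<close> inherits the bound \<open>o(N)\<close>.\<close>
lemma negligible_insert_prime:
  assumes q: "prime q" "q \<notin> P" and F: "negligible_sums (char_sum P b)"
  shows "negligible_sums (char_sum (insert q P) b)"
proof -
  let ?F = "char_sum P b" and ?F' = "char_sum (insert q P) b" and ?z = "cis (2 * pi * real 1 / real b)"
  have q2: "q \<ge> 2" "q > 0" using prime_ge_2_nat[OF q(1)] by auto
  have f_q: "character P b 1 (q * m) = ?z * character P b 1 m" if "m \<ge> 1" for m
    using that q q2 by (simp add: character_def Omega_outside_mult Omega_outside_prime)
  have f'_q: "character (insert q P) b 1 (q * m) = character (insert q P) b 1 m" if "m \<ge> 1" for m
    using that q q2 by (simp add: character_def Omega_outside_mult Omega_outside_prime)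
  have f'_f: "character (insert q P) b 1 n = character P b 1 n" if "\<not> q dvd n" for n
  proof -
    have "prime_factors n - insert q P = prime_factors n - P" using that by auto
    then show ?thesis by (simp add: character_def Omega_outside_def)
  qed
  have F_eq: "?F N = (\<Sum>n\<in>{n \<in> {1..N}. \<not> q dvd n}. character P b 1 n) + ?z * ?F (N div q)" for N
    unfolding char_sum_def sum_split_multiples[OF q2(2), of "character P b 1" N] sum_distrib_left
    by (intro arg_cong2[where f = "(+)"] sum.cong refl f_q) simp
  have F'_eq: "?F' N = (\<Sum>n\<in>{n \<in> {1..N}. \<not> q dvd n}. character P b 1 n) + ?F' (N div q)" for N
    unfolding char_sum_def sum_split_multiples[OF q2(2), of "character (insert q P) b 1" N]
    by (intro arg_cong2[where f = "(+)"] sum.cong refl f'_q f'_f) simp_all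
  have rec: "?F' N = ?F' (N div q) + (?F N - ?z * ?F (N div q))" for N
    using F_eq[of N] F'_eq[of N] by algebra
  show ?thesis
    unfolding negligible_sums_def
  proof (intro allI impI)
    fix \<epsilon> :: real assume \<epsilon>: "\<epsilon> > 0"
    then obtain K where K: "K \<ge> 0" "\<And>N. norm (?F N) \<le> \<epsilon> / 8 * real N + K"
      using F[unfolded negligible_sums_def, rule_format, of "\<epsilon> / 8"] by auto
    \<comment> \<open>From \<open>n0\<close> on the constant \<open>K\<close> is absorbed by \<open>\<epsilon> *
      N / 8\<close>; below \<open>n0\<close> the trivial bound serves.\<close>
    define n0 where "n0 = 8 * K / \<epsilon>"
    have "norm (?F' N) \<le> \<epsilon> * real N + n0" for N
    proof (induction N rule: less_induct)
      case (less N)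
      show ?case
      proof (cases "real N < n0 \<or> N = 0")
        case True
        have "norm (?F' N) \<le> real N" by (rule norm_char_sum_le)
        moreover have "0 \<le> n0" using K \<epsilon> by (simp add: n0_def)
        moreover have "0 \<le> \<epsilon> * real N" using \<epsilon> by simp
        ultimately show ?thesis using True by auto
      next
        case False
        have half: "real (N div q) \<le> real N / 2"
        proof -
          have "N div q \<le> N div 2" using q2 by (intro div_le_mono2) auto
          then have "2 * (N div q) \<le> N" by linarith
          then show ?thesis by linarith
        qed
        have "K \<le> \<epsilon> / 8 * real N" using False \<epsilon> by (simp add: n0_def field_simps)
        have "norm (?F' N) \<le> norm (?F' (N div q)) + (norm (?F N) + norm (?F (N div q)))"
          unfolding rec[of N]
          by (intro order_trans[OF norm_triangle_ineq] add_left_mono order_trans[OF norm_triangle_ineq4]) (simp add: norm_mult)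
        also have "norm (?F' (N div q)) \<le> \<epsilon> * real (N div q) + n0"
          using False q2 by (intro less) simp
        also have "norm (?F N) \<le> \<epsilon> / 8 * real N + K" by (rule K)
        also have "norm (?F (N div q)) \<le> \<epsilon> / 8 * real (N div q) + K" by (rule K)
        also have "\<epsilon> / 8 * real (N div q) \<le> \<epsilon> / 8 * real N" using half \<epsilon> by (intro mult_left_mono) auto
        also have "\<epsilon> * real (N div q) \<le> \<epsilon> * (real N / 2)" using half \<epsilon> by (intro mult_left_mono) auto
        finally show ?thesis using \<open>K \<le> \<epsilon> / 8 * real N\<close> by (simp add: field_simps)
      qed
    qed
    moreover have "0 \<le> n0" using K \<epsilon> by (simp add: n0_def)
    ultimately show "\<exists>K\<ge>0. \<forall>N. norm (?F' N) \<le> \<epsilon> * real N + K" by blast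
  qed
qed

lemma negligible_union_primes:
  assumes "finite T" "T \<subseteq> primes_outside P" "negligible_sums (char_sum P b)"
  shows "negligible_sums (char_sum (P \<union> T) b)"
  using assms
proof (induction T rule: finite_induct)
  case (insert q T)
  then show ?case
    using negligible_insert_prime[of q "P \<union> T" b] by (auto simp: primes_outside_def)
qed simp

lemma simply_normal_imp_negligible:
  assumes b: "b \<ge> 2" and "simply_normal b (xi P b)"
  shows "negligible_sums (char_sum P b)"
proof -
  let ?z = "cis (2 * pi * real 1 / real b)"
  let ?c = "\<lambda>N k. real (card {n \<in> {1..N}. Omega_residue P b n = k})"
  have z1: "?z \<noteq> 1" using root_of_unity_gap[of 1 b] b by auto
  have zsum: "(\<Sum>k<b. ?z ^ k) = 0"
    using z1 cis_root_power[of b 1] b by (simp add: sum_gp_strict)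
  have eq: "char_sum P b N = (\<Sum>k<b. of_real (?c N k) * ?z ^ k)" for N
  proof -
    have "char_sum P b N = (\<Sum>n=1..N. ?z ^ Omega_residue P b n)"
      unfolding char_sum_def using b by (intro sum.cong refl character_residue) simp
    also have "\<dots> = (\<Sum>k<b. \<Sum>n\<in>{n \<in> {1..N}. Omega_residue P b n = k}. ?z ^ Omega_residue P b n)"
      using b by (intro sum.group[symmetric]) (auto simp: Omega_residue_def)
    also have "\<dots> = (\<Sum>k<b. of_real (?c N k) * ?z ^ k)"
      by (intro sum.cong refl) simp
    finally show ?thesis .
  qed
  have "(\<lambda>N. \<Sum>k<b. of_real (?c N k / real N) * ?z ^ k) \<longlonglongrightarrow> (\<Sum>k<b. of_real (1 / real b) * ?z ^ k)"
    using assms(2) unfolding simply_normal_xi_iff[OF b] by (intro tendsto_sum tendsto_mult tendsto_of_real tendsto_const) auto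
  also have "(\<Sum>k<b. of_real (1 / real b) * ?z ^ k) = 0"
    unfolding sum_distrib_left[symmetric] zsum by simp
  also have "(\<lambda>N. \<Sum>k<b. of_real (?c N k / real N) * ?z ^ k) = (\<lambda>N. char_sum P b N / of_nat N)"
    unfolding eq by (simp add: sum_divide_distrib)
  finally have lim: "(\<lambda>N. char_sum P b N / of_nat N) \<longlonglongrightarrow> 0" .
  show ?thesis
    unfolding negligible_sums_def
  proof (intro allI impI)
    fix \<epsilon> :: real assume \<epsilon>: "\<epsilon> > 0"
    then obtain N0 where N0: "\<And>N. N \<ge> N0 \<Longrightarrow> norm (char_sum P b N / of_nat N) < \<epsilon>"
      using LIMSEQ_D[OF lim] by auto
    have "norm (char_sum P b N) \<le> \<epsilon> * real N + real N0" for N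
    proof (cases "N \<ge> N0 \<and> N > 0")
      case True
      then have "norm (char_sum P b N) / real N < \<epsilon>" using N0[of N] by (simp add: norm_divide)
      then show ?thesis using True by (simp add: field_simps)
    next
      case False
      then have "N \<le> N0" by auto
      then have "norm (char_sum P b N) \<le> real N0" using norm_char_sum_le[of P b N] by linarith
      moreover have "0 \<le> \<epsilon> * real N" using \<epsilon> by simp
      ultimately show ?thesis by linarith
    qed
    then show "\<exists>K\<ge>0. \<forall>N. norm (char_sum P b N) \<le> \<epsilon> * real N + K" by (intro exI[of _ "real N0"]) auto
  qed
qed

lemma convergent_tail:
  assumes "(\<Sum>\<^sub>\<infinity>p\<in>Q. ennreal (1 / real p)) \<noteq> \<infinity>"
  obtains T where "finite T" "T \<subseteq> Q" "\<And>F. finite F \<Longrightarrow> F \<subseteq> Q - T \<Longrightarrow> (\<Sum>p\<in>F. 1 / real p) \<le> 1 / 4"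
proof -
  define X where "X = (\<lambda>F. \<Sum>p\<in>F. 1 / real p) ` {F. finite F \<and> F \<subseteq> Q}"
  obtain s where s: "s \<ge> 0" "(\<Sum>\<^sub>\<infinity>p\<in>Q. ennreal (1 / real p)) = ennreal s"
    using assms by (cases "(\<Sum>\<^sub>\<infinity>p\<in>Q. ennreal (1 / real p))") auto
  have "(\<Sum>p\<in>F. 1 / real p) \<le> s" if F: "finite F" "F \<subseteq> Q" for F
  proof -
    have "ennreal (\<Sum>p\<in>F. 1 / real p) = (\<Sum>p\<in>F. ennreal (1 / real p))" by (rule sum_ennreal[symmetric]) simp
    also have "\<dots> = (\<Sum>\<^sub>\<infinity>p\<in>F. ennreal (1 / real p))" using F by simp
    also have "\<dots> \<le> (\<Sum>\<^sub>\<infinity>p\<in>Q. ennreal (1 / real p))"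
      using F by (intro infsum_mono_neutral nonneg_summable_on_complete) auto
    finally show ?thesis unfolding s(2) using s(1) by (simp add: ennreal_le_iff)
  qed
  then have bdd: "bdd_above X" unfolding X_def by (intro bdd_aboveI2) auto
  have ne: "X \<noteq> {}" unfolding X_def by auto
  then obtain x where x: "x \<in> X" "Sup X - 1 / 4 < x" using less_cSupE[of "Sup X - 1 / 4" X] by auto
  then obtain T where T: "finite T" "T \<subseteq> Q" "x = (\<Sum>p\<in>T. 1 / real p)" unfolding X_def by auto
  show ?thesis
  proof (rule that[OF T(1,2)])
    fix F assume F: "finite F" "F \<subseteq> Q - T"
    have "x + (\<Sum>p\<in>F. 1 / real p) = (\<Sum>p\<in>T \<union> F. 1 / real p)"
      using T F by (subst sum.union_disjoint) auto
    also have "\<dots> \<le> Sup X"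
      using T F bdd by (intro cSup_upper) (auto simp: X_def)
    finally show "(\<Sum>p\<in>F. 1 / real p) \<le> 1 / 4" using x by linarith
  qed
qed

text \<open>An integer up to \<open>N\<close> with a prime factor outside \<open>P\<close> is a multiple of such
  a prime; there are at most \<open>N/4\<close> of them, and every other term of the sum is
  \<open>1\<close>.\<close>
lemma char_sum_large:
  assumes tail: "\<And>F. finite F \<Longrightarrow> F \<subseteq> primes_outside P \<Longrightarrow> (\<Sum>p\<in>F. 1 / real p) \<le> 1 / 4"
  shows "real N / 2 \<le> norm (char_sum P b N)"
proof -
  define F where "F = {p \<in> primes_outside P. p \<le> N}"
  define bad where "bad = (\<Union>p\<in>F. (*) p ` {1..N div p})"
  have F: "finite F" "F \<subseteq> primes_outside P" unfolding F_def by (auto intro: finite_primes_le)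
  have fin: "finite bad" unfolding bad_def using F by auto
  have "real (card bad) \<le> (\<Sum>p\<in>F. real (card ((*) p ` {1..N div p})))"
    unfolding bad_def of_nat_sum[symmetric] using F by (simp only: of_nat_le_iff card_UN_le)
  also have "\<dots> \<le> (\<Sum>p\<in>F. real N * (1 / real p))"
  proof (rule sum_mono)
    fix p assume "p \<in> F"
    have "card ((*) p ` {1..N div p}) \<le> N div p" using card_image_le[of "{1..N div p}" "(*) p"] by simp
    then have "real (card ((*) p ` {1..N div p})) \<le> real (N div p)" by simp
    also have "\<dots> \<le> real N / real p"
    proof (cases "p = 0")
      case False
      have "real (N div p * p) \<le> real N" by (simp only: of_nat_le_iff div_times_less_eq_dividend)
      then show ?thesis using False by (simp add: pos_le_divide_eq)
    qed simp
    finally show "real (card ((*) p ` {1..N div p})) \<le> real N * (1 / real p)" by simp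
  qed
  also have "\<dots> = real N * (\<Sum>p\<in>F. 1 / real p)" by (rule sum_distrib_left[symmetric])
  also have "\<dots> \<le> real N * (1 / 4)" using tail[OF F] by (intro mult_left_mono) auto
  finally have card_bad: "real (card bad) \<le> real N / 4" by simp
  have good: "character P b 1 n = 1" if n: "n \<in> {1..N}" "n \<notin> bad" for n
  proof -
    have "prime_factors n - P = {}"
    proof (rule ccontr)
      assume "prime_factors n - P \<noteq> {}"
      then obtain p where p: "p \<in> prime_factors n" "p \<notin> P" by auto
      then have pp: "prime p" "p dvd n" by auto
      then obtain m where m: "n = p * m" by auto
      have "p \<le> N" using pp(2) n(1) dvd_imp_le[of p n] by auto
      then have "p \<in> F" using pp p(2) by (auto simp: F_def primes_outside_def)
      moreover have "m \<in> {1..N div p}"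
        using n(1) m prime_gt_0_nat[OF pp(1)] by (auto simp: less_eq_div_iff_mult_less_eq mult.commute intro!: Suc_leI Nat.gr0I)
      ultimately have "n \<in> bad" unfolding bad_def m by blast
      then show False using n(2) by simp
    qed
    then show ?thesis unfolding character_def Omega_outside_def by (simp only: sum.empty power_0)
  qed
  have "char_sum P b N - of_nat N = (\<Sum>n=1..N. character P b 1 n - 1)"
    by (simp add: char_sum_def sum_subtractf)
  also have "\<dots> = (\<Sum>n\<in>{1..N} \<inter> bad. character P b 1 n - 1)"
    by (rule sum.mono_neutral_right) (use good in auto)
  also have "norm \<dots> \<le> (\<Sum>n\<in>{1..N} \<inter> bad. 2)"
  proof (rule sum_norm_le)
    fix n show "norm (character P b 1 n - 1) \<le> 2"
      using norm_triangle_ineq4[of "character P b 1 n" 1] by (simp add: norm_character)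
  qed
  also have "\<dots> \<le> 2 * real (card bad)" using card_mono[OF fin, of "{1..N} \<inter> bad"] by simp
  also have "\<dots> \<le> real N / 2" using card_bad by simp
  finally have "norm (char_sum P b N - of_nat N) \<le> real N / 2" .
  then show ?thesis using norm_triangle_ineq2[of "of_nat N" "char_sum P b N"] by (simp add: norm_minus_commute)
qed

text \<open>Moving finitely many primes into \<open>P\<close> leaves a tail of \<open>\<Sum>1/p\<close> below
  \<open>1/4\<close>. The resulting sums are then both \<open>o(N)\<close> and at least
  \<open>N/2\<close>.\<close>
lemma divergent_if_simply_normal:
  assumes b: "b \<ge> 2" and "simply_normal b (xi P b)"
  shows "(\<Sum>\<^sub>\<infinity>p\<in>primes_outside P. ennreal (1 / real p)) = \<infinity>"
proof (rule ccontr)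
  assume conv: "(\<Sum>\<^sub>\<infinity>p\<in>primes_outside P. ennreal (1 / real p)) \<noteq> \<infinity>"
  obtain T where T: "finite T" "T \<subseteq> primes_outside P"
    "\<And>F. finite F \<Longrightarrow> F \<subseteq> primes_outside P - T \<Longrightarrow> (\<Sum>p\<in>F. 1 / real p) \<le> 1 / 4"
    by (rule convergent_tail[OF conv], rule that)
  have "primes_outside (P \<union> T) = primes_outside P - T" by (auto simp: primes_outside_def)
  then have large: "real N / 2 \<le> norm (char_sum (P \<union> T) b N)" for N
    using T(3) by (intro char_sum_large) auto
  have "negligible_sums (char_sum (P \<union> T) b)"
    by (rule negligible_union_primes[OF T(1,2) simply_normal_imp_negligible[OF assms]])
  then have "\<exists>K\<ge>0. \<forall>N. norm (char_sum (P \<union> T) b N) \<le> 1 / 4 * real N + K"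
    unfolding negligible_sums_def by - (drule spec[of _ "1 / 4"], simp)
  then obtain K where K: "\<And>N. norm (char_sum (P \<union> T) b N) \<le> 1 / 4 * real N + K" by blast
  obtain N :: nat where "4 * K < real N" using reals_Archimedean2 by blast
  then show False using K[of N] large[of N] by linarith
qed

theorem mainTheorem1:
  fixes P :: "nat set" and b :: nat
  assumes "P \<subseteq> {p. prime p}" and "b \<ge> 2"
  shows "(simply_normal b (xi P b) \<longleftrightarrow>
            (\<Sum>\<^sub>\<infinity>p\<in>primes_outside P. ennreal (1 / real p)) = \<infinity>) \<and>
         (\<exists>C>0. \<forall>N\<ge>1. \<forall>k<b.
            residue_discrepancy P b N k \<le> C * exp (- (2 * recip_sum P N / (9 * (real b)\<^sup>2))))"
  using divergent_if_simply_normal[OF assms(2)] simply_normal_if_divergent[OF assms(2)]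
    residue_discrepancy_le[OF assms(2)]
  by blast

end
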